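(* Let $n\ge 2$, $0<\lambda\le\Lambda$, $0<\theta<1$, and let $a_{ij}\colon B_1\to\mathbb{R}$ ($1\le i,j\le n$) be $\theta$-H\"older continuous coefficients, $a_{ij}\in C^{0,\theta}(B_1)$, forming a symmetric matrix that is uniformly elliptic: $\lambda\,\mathrm{Id}\le (a_{ij}(X))\le \Lambda\,\mathrm{Id}$ for all $X\in B_1$, where $B_1\subset\mathbb{R}^n$ is the open unit ball. (i) (Non-divergence form.) Let $u\in C^2(B_1)$ satisfy $a_{ij}(X)D_{ij}u=0$ in $B_1$ (summation over repeated indices), and let $Z\in B_1$ be a zero Hessian point, i.e. $D^2u(Z)=0$. Then $u$ is of class $C^{2,1^-}$ at $Z$: for every $\alpha\in(0,1)$ there exist $r_0>0$ and $C>0$ such that $|u(X)-u(Z)-\nabla u(Z)\cdot(X-Z)|\le C|X-Z|^{2+\alpha}$ for all $X\in B_{r_0}(Z)$. (ii) (Divergence form.) Let $u\in H^1(B_1)$ be a weak (distributional) solution of $\mathrm{div}\big(a_{ij}(X)\nabla u\big)=0$ in $B_1$ (so that, by classical Schauder theory, $u\in C^{1,\theta}_{\mathrm{loc}}(B_1)$), and let $Z\in B_1$ be a critical point, i.e. $\nabla u(Z)=0$. Then $u$ is of class $C^{1,1^-}$ at $Z$: for every $\alpha\in(0,1)$ there exist $r_0>0$ and $C>0$ such that $|u(X)-u(Z)|\le C|X-Z|^{1+\alpha}$ for all $X\in B_{r_0}(Z)$; in particular $\frac{1}{|B_r|}\int_{B_r(Z)}|u(X)-u(Z)|^2\,dX\le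 C^2 r^{2(1+\alpha)}$ for all $0<r<r_0$.
   Context: The Einstein summation convention is used. $H^1(B_1)$ is the Sobolev space of $L^2$ functions with $L^2$ weak gradient; a weak solution of $\mathrm{div}(a_{ij}\nabla u)=0$ means $\int_{B_1} a_{ij}(X)\,\partial_j u\,\partial_i\varphi\,dX=0$ for all $\varphi\in C^\infty_c(B_1)$. *)

theory Defs
  imports "HOL-Analysis.Analysis"
begin

definition partial_d :: "'n::finite \<Rightarrow> (real^'n \<Rightarrow> real) \<Rightarrow> real^'n \<Rightarrow> real" where
  "partial_d i g = (\<lambda>x. frechet_derivative g (at x) (axis i 1))"

definition C_infinity :: "(real^'n::finite \<Rightarrow> real) \<Rightarrow> bool" where
  "C_infinity g \<longleftrightarrow> (\<forall>is. foldr partial_d is g differentiable_on UNIV)"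

definition test_fun :: "(real^'n::finite) set \<Rightarrow> (real^'n \<Rightarrow> real) \<Rightarrow> bool" where
  "test_fun S \<phi> \<longleftrightarrow> C_infinity \<phi> \<and>
     (\<exists>K. compact K \<and> K \<subseteq> S \<and> (\<forall>x. x \<notin> K \<longrightarrow> \<phi> x = 0))"

definition holder_on :: "real \<Rightarrow> (real^'n::finite) set \<Rightarrow> (real^'n \<Rightarrow> real) \<Rightarrow> bool" where
  "holder_on \<theta> S f \<longleftrightarrow> bounded (f ` S) \<and>
     (\<exists>C. \<forall>x\<in>S. \<forall>y\<in>S. \<bar>f x - f y\<bar> \<le> C * dist x y powr \<theta>)"

definition H1_weak_grad :: "(real^'n::finite) set \<Rightarrow> (real^'n \<Rightarrow> real) \<Rightarrow> (real^'n \<Rightarrow> real^'n) \<Rightarrow> bool" where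
  "H1_weak_grad S u g \<longleftrightarrow>
     set_borel_measurable lebesgue S u \<and> set_integrable lebesgue S (\<lambda>x. (u x)\<^sup>2) \<and>
     (\<forall>i. set_borel_measurable lebesgue S (\<lambda>x. g x $ i) \<and>
          set_integrable lebesgue S (\<lambda>x. (g x $ i)\<^sup>2)) \<and>
     (\<forall>\<phi> i. test_fun S \<phi> \<longrightarrow>
        (LINT x:S|lebesgue. u x * partial_d i \<phi> x) = - (LINT x:S|lebesgue. g x $ i * \<phi> x))"

definition weak_div_solution :: "('n::finite \<Rightarrow> 'n \<Rightarrow> real^'n \<Rightarrow> real) \<Rightarrow> (real^'n) set \<Rightarrow> (real^'n \<Rightarrow> real^'n) \<Rightarrow> bool" where
  "weak_div_solution a S g \<longleftrightarrow>
     (\<forall>\<phi>. test_fun S \<phi> \<longrightarrow>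
        (LINT x:S|lebesgue. (\<Sum>i\<in>UNIV. \<Sum>j\<in>UNIV. a i j x * g x $ j * partial_d i \<phi> x)) = 0)"

end

theory Submission
  imports Defs
begin

text \<open>
  Both parts follow from one estimate for a family \<open>W\<close> of continuous functions vanishing at \<open>Z\<close>:
  the second derivatives of \<open>u\<close> in (i), the first derivatives of the solution in (ii).

  Freeze the coefficients at a point \<open>X\<close> and let \<open>\<phi>\<^sub>s\<close> be a compactly supported kernel of width
  \<open>s\<close> around \<open>X\<close> whose level sets are the ellipsoids of \<open>(a\<^sub>i\<^sub>j(X))\<^sup>-\<^sup>1\<close>. As for the heat kernel, the
  derivative of \<open>\<phi>\<^sub>s\<close> in \<open>s\<close> is \<open>a\<^sub>i\<^sub>j(X) D\<^sub>i\<^sub>j\<close> of a bump function, so after integrating by parts the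
  equation gives \<open>d/ds \<integral>W \<phi>\<^sub>s = O(s\<^sup>\<theta>\<^sup>-\<^sup>1) sup \<bar>W\<bar>\<close>. Hence \<open>W X\<close> differs from a multiple of its average
  at scale \<open>R\<close> by \<open>O(R\<^sup>\<theta>) sup \<bar>W\<bar>\<close>. Comparing the averages at \<open>X\<close> and at \<open>Z\<close>, where \<open>W Z = 0\<close>, yields
  \<open>sup\<^bsub>B(Z,r)\<^esub> \<bar>W\<bar> \<le> C (R\<^sup>\<theta> + r/R) sup\<^bsub>B(Z,2R)\<^esub> \<bar>W\<bar>\<close> for \<open>r \<le> R\<close>. With \<open>r/R\<close> fixed and small, iteration
  gives \<open>W = O(\<bar>X - Z\<bar>\<^sup>\<alpha>)\<close> for every \<open>\<alpha> < 1\<close>, and the mean value theorem finishes the proof.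
\<close>

section \<open>Smooth bump functions\<close>

text \<open>Because the coefficients are only Hoelder continuous, the equation cannot be
  differentiated: every extra derivative has to fall on a smooth kernel, and the only gain is
  \<open>a i j X - a i j Y\<close> = O(s^\<theta>) on its support. A Gaussian would spread over the
  whole space, so a compactly supported profile replaces it. The heat-type identity holds for every
  profile F: put e(Y) = 1 - q(Y)/s^2, where q is the quadratic form of a matrix B with AB = \<beta>
  I. The operator with matrix A sends F(e) to (2 \<beta>/s^2)(2(1 - e)F''(e) - n F'(e)), and the
  last bracket is s^(n+1) times the s-derivative of s^(-n) F'(e). Hence the bump has profile F and
  the averaging kernel has profile F'. With F(t) = exp(-1/t) all derivatives stay in one explicit
  family. Moving the centre by r changes the kernel at scale R by O(r/R). This rate is what confines
  the argument to exponents below 1: for an unspecified constant C, the loss C r/R can be absorbed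
  into (r/R)^\<alpha> by making r/R small only if \<alpha> < 1.\<close>

definition flat_exp :: "nat \<Rightarrow> real \<Rightarrow> real" where
  "flat_exp k t = (if t > 0 then exp (- 1 / t) / t ^ k else 0)"

lemma flat_exp_nonneg: "0 \<le> flat_exp k t"
  by (simp add: flat_exp_def)

lemma flat_exp_nonpos [simp]: "t \<le> 0 \<Longrightarrow> flat_exp k t = 0"
  by (simp add: flat_exp_def)

lemma flat_exp_pos: "0 < t \<Longrightarrow> 0 < flat_exp k t"
  by (simp add: flat_exp_def)

lemma flat_exp_step: "flat_exp k t = t * flat_exp (Suc k) t"
  by (simp add: flat_exp_def)

text \<open>For positive \<open>t\<close> and \<open>u = 1 / t\<close> this is
  \<open>u ^ k / fact k \<le> exp u\<close>, a single term of the exponential series.\<close>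

lemma flat_exp_le_fact: "flat_exp k t \<le> fact k"
proof (cases "t > 0")
  case True
  define u where "u = 1 / t"
  have u: "u > 0" using True by (simp add: u_def)
  have "u ^ k / fact k \<le> exp u"
  proof -
    have "(\<Sum>n\<in>{k}. u ^ n /\<^sub>R fact n) \<le> (\<Sum>n. u ^ n /\<^sub>R fact n)"
      by (intro sum_le_suminf summable_exp_generic) (use u in auto)
    then show ?thesis by (simp add: exp_def divide_inverse mult.commute)
  qed
  then have "u ^ k * exp (- u) \<le> fact k"
    by (simp add: exp_minus divide_simps mult.commute)
  moreover have "flat_exp k t = u ^ k * exp (- u)"
    using True by (simp add: flat_exp_def u_def power_divide)
  ultimately show ?thesis by simp
qed auto

text \<open>Differentiation stays inside the family \<open>flat_exp\<close>, so no other
  transcendental functions appear. For \<open>k = 0\<close> the derivative is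
  \<open>flat_exp 2\<close>.\<close>

definition flat_exp' :: "nat \<Rightarrow> real \<Rightarrow> real" where
  "flat_exp' k t = flat_exp (k + 2) t - real k * flat_exp (k + 1) t"

lemma flat_exp_deriv: "(flat_exp k has_real_derivative flat_exp' k t) (at t)"
proof -
  consider "t > 0" | "t < 0" | "t = 0" by linarith
  then show ?thesis
  proof cases
    case 1
    have "((\<lambda>t. exp (- 1 / t) / t ^ k) has_real_derivative flat_exp' k t) (at t)"
    proof -
      have "((\<lambda>t. inverse t ^ k) has_real_derivative
          real k * (- (inverse t ^ 2) * inverse t ^ (k - 1))) (at t)"
        using DERIV_power[OF DERIV_inverse[of t UNIV], of k] 1 by (simp add: numeral_2_eq_2)
      moreover have "((\<lambda>t. exp (- 1 / t)) has_real_derivative exp (- 1 / t) * inverse t ^ 2) (at t)"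
        using 1 by (auto intro!: derivative_eq_intros simp: power2_eq_square divide_inverse)
      ultimately have "((\<lambda>t. exp (- 1 / t) * inverse t ^ k) has_real_derivative
          exp (- 1 / t) * (real k * (- (inverse t ^ 2) * inverse t ^ (k - 1)))
            + exp (- 1 / t) * inverse t ^ 2 * inverse t ^ k) (at t)"
        by (rule DERIV_mult'[rotated])
      moreover have "flat_exp' k t = exp (- 1 / t) * (real k * (- (inverse t ^ 2) * inverse t ^ (k - 1)))
            + exp (- 1 / t) * inverse t ^ 2 * inverse t ^ k"
        using 1 by (cases k) (simp_all add: flat_exp'_def flat_exp_def field_simps power2_eq_square)
      ultimately show ?thesis by (simp add: divide_inverse power_inverse)
    qed
    then show ?thesis
      by (rule has_field_derivative_transform_within_open[where S="{0<..}"])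
         (use 1 in \<open>auto simp: flat_exp_def\<close>)
  next
    case 2
    have "((\<lambda>t. 0) has_real_derivative flat_exp' k t) (at t)"
      using 2 by (auto simp: flat_exp'_def)
    then show ?thesis
      by (rule has_field_derivative_transform_within_open[where S="{..<0}"])
         (use 2 in \<open>auto simp: flat_exp_def\<close>)
  next
    case 3
    have "((\<lambda>h. (flat_exp k (0 + h) - flat_exp k 0) / h) \<longlongrightarrow> 0) (at 0)"
    proof (rule Lim_null_comparison)
      show "\<forall>\<^sub>F h in at 0. norm ((flat_exp k (0 + h) - flat_exp k 0) / h) \<le> \<bar>h\<bar> * fact (k+2)"
      proof (rule always_eventually, rule allI)
        fix h :: real
        \<comment> \<open>Of the two factors \<open>h\<close> split off here, one cancels against
          the denominator of the difference quotient and the other tends to 0 against the bound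
          \<open>fact (k+2)\<close>.\<close>
        have "flat_exp k h = h * h * flat_exp (k+2) h"
          using flat_exp_step[of k h] flat_exp_step[of "Suc k" h] by simp
        then have "norm ((flat_exp k (0 + h) - flat_exp k 0) / h) = \<bar>h\<bar> * flat_exp (k+2) h"
          by (simp add: abs_mult flat_exp_nonneg)
        also have "\<dots> \<le> \<bar>h\<bar> * fact (k+2)"
          by (intro mult_left_mono flat_exp_le_fact) auto
        finally show "norm ((flat_exp k (0 + h) - flat_exp k 0) / h) \<le> \<bar>h\<bar> * fact (k+2)" .
      qed
      show "((\<lambda>h. \<bar>h\<bar> * fact (k+2)) \<longlongrightarrow> (0::real)) (at 0)"
        by (rule tendsto_eq_intros refl | simp)+
    qed
    moreover have "flat_exp' k t = 0" using 3 by (simp add: flat_exp'_def)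
    ultimately show ?thesis using 3 by (simp add: DERIV_def)
  qed
qed

lemma flat_exp_continuous: "continuous_on UNIV (flat_exp k)"
  by (intro continuous_at_imp_continuous_on ballI DERIV_isCont[OF flat_exp_deriv])

lemma flat_exp'_continuous: "continuous_on UNIV (flat_exp' k)"
  unfolding flat_exp'_def by (intro continuous_intros flat_exp_continuous)

text \<open>36 = 4! + 2 * 3!, from the factorial bounds for \<open>flat_exp 4\<close> and
  \<open>flat_exp 3\<close>.\<close>

lemma flat_exp'_2_bound: "\<bar>flat_exp' 2 t\<bar> \<le> 36"
  using flat_exp_nonneg[of 3 t] flat_exp_nonneg[of 4 t] flat_exp_le_fact[of 3 t] flat_exp_le_fact[of 4 t]
  by (simp add: flat_exp'_def fact_numeral abs_le_iff)

lemma flat_exp_2_bound: "\<bar>flat_exp 2 t\<bar> \<le> 2"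
  using flat_exp_nonneg[of 2 t] flat_exp_le_fact[of 2 t] by (simp add: fact_numeral)

lemma flat_exp_2_lipschitz: "\<bar>flat_exp 2 s - flat_exp 2 t\<bar> \<le> 36 * \<bar>s - t\<bar>"
proof -
  have "norm (flat_exp 2 s - flat_exp 2 t) \<le> 36 * norm (s - t)"
    by (rule field_differentiable_bound[where S=UNIV and f'="flat_exp' 2"])
       (use flat_exp_deriv flat_exp'_2_bound in auto)
  then show ?thesis by simp
qed

text \<open>Keeps the kernel away from 0 near its centre: exp(-1/t) is increasing, and dividing by
  t^2 \<le> 1 only enlarges it.\<close>

lemma flat_exp_2_lower: "1 / 2 \<le> t \<Longrightarrow> t \<le> 1 \<Longrightarrow> exp (-2) \<le> flat_exp 2 t"
proof -
  assume t: "1 / 2 \<le> t" "t \<le> 1"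
  have "exp (-2) \<le> exp (- 1 / t)" using t by (simp add: divide_simps)
  also have "\<dots> \<le> exp (- 1 / t) / t ^ 2"
    using t by (simp add: le_divide_eq power_le_one)
  finally show ?thesis using t by (simp add: flat_exp_def)
qed

text \<open>A class of smooth functions closed under \<open>partial_d\<close> that contains polynomials and bumps: membership
  gives \<open>C_infinity\<close> without differentiability bookkeeping for iterated derivatives.\<close>
inductive_set flat_algebra :: "(real^'n::finite \<Rightarrow> real) set" where
  const: "(\<lambda>x. c) \<in> flat_algebra"
| coord: "(\<lambda>x. x $ i) \<in> flat_algebra"
| add: "f \<in> flat_algebra \<Longrightarrow> g \<in> flat_algebra \<Longrightarrow> (\<lambda>x. f x + g x) \<in> flat_algebra"
| mult: "f \<in> flat_algebra \<Longrightarrow> g \<in> flat_algebra \<Longrightarrow> (\<lambda>x. f x * g x) \<in> flat_algebra"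
| flat: "f \<in> flat_algebra \<Longrightarrow> (\<lambda>x. flat_exp k (f x)) \<in> flat_algebra"

lemma flat_algebra_sum:
  assumes "\<And>i. i \<in> I \<Longrightarrow> f i \<in> flat_algebra"
  shows "(\<lambda>x. \<Sum>i\<in>I. f i x) \<in> flat_algebra"
  using assms by (induction I rule: infinite_finite_induct) (auto intro: flat_algebra.intros)

lemma flat_algebra_cmult: "f \<in> flat_algebra \<Longrightarrow> (\<lambda>x. c * f x) \<in> flat_algebra"
  by (rule flat_algebra.mult[OF flat_algebra.const])

lemma flat_algebra_diff: "f \<in> flat_algebra \<Longrightarrow> g \<in> flat_algebra \<Longrightarrow> (\<lambda>x. f x - g x) \<in> flat_algebra"
  using flat_algebra.add[of f "\<lambda>x. (-1) * g x"] flat_algebra_cmult[of g "-1"] by simp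

lemma flat_algebra_flat': "f \<in> flat_algebra \<Longrightarrow> (\<lambda>x. flat_exp' k (f x)) \<in> flat_algebra"
  unfolding flat_exp'_def by (intro flat_algebra_diff flat_algebra_cmult flat_algebra.flat)

lemma partial_d_eq: "(f has_derivative f') (at x) \<Longrightarrow> partial_d i f x = f' (axis i 1)"
  by (simp add: partial_d_def frechet_derivative_at[symmetric])

lemma has_derivative_flat_exp_comp:
  assumes "(f has_derivative f') (at x)"
  shows "((\<lambda>x. flat_exp k (f x)) has_derivative (\<lambda>h. flat_exp' k (f x) * f' h)) (at x)"
  using has_derivative_compose[OF assms, of "flat_exp k" "(*) (flat_exp' k (f x))"] flat_exp_deriv[of k "f x"]
  by (simp add: has_field_derivative_def)

lemma flat_algebra_differentiable: "f \<in> flat_algebra \<Longrightarrow> f differentiable (at x)"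
proof (induction rule: flat_algebra.induct)
  case (coord i)
  then show ?case
    by (rule bounded_linear_imp_differentiable[OF bounded_linear_vec_nth])
next
  case (flat f k)
  then show ?case unfolding differentiable_def
    using has_derivative_flat_exp_comp by blast
qed auto

lemma flat_algebra_has_derivative:
  "f \<in> flat_algebra \<Longrightarrow> (f has_derivative frechet_derivative f (at x)) (at x)"
  using flat_algebra_differentiable frechet_derivative_works by blast

lemma flat_algebra_continuous: "f \<in> flat_algebra \<Longrightarrow> continuous_on S f"
  by (intro continuous_at_imp_continuous_on ballI differentiable_imp_continuous_within
      flat_algebra_differentiable)

lemma partial_d_const: "partial_d i (\<lambda>x. c) = (\<lambda>x. 0)"
  by (rule ext) (simp add: partial_d_def)

lemma partial_d_coord: "partial_d i (\<lambda>x. x $ j) = (\<lambda>x. if i = j then 1 else 0)"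
  by (rule ext, subst partial_d_eq[OF bounded_linear.has_derivative[OF bounded_linear_vec_nth has_derivative_ident]])
     (auto simp: axis_def)

lemma partial_d_add:
  assumes "f \<in> flat_algebra" "g \<in> flat_algebra"
  shows "partial_d i (\<lambda>x. f x + g x) = (\<lambda>x. partial_d i f x + partial_d i g x)"
  by (rule ext, subst partial_d_eq[OF has_derivative_add[OF assms[THEN flat_algebra_has_derivative]]])
     (simp add: partial_d_def)

lemma partial_d_mult:
  assumes "f \<in> flat_algebra" "g \<in> flat_algebra"
  shows "partial_d i (\<lambda>x. f x * g x) = (\<lambda>x. f x * partial_d i g x + partial_d i f x * g x)"
  by (rule ext, subst partial_d_eq[OF has_derivative_mult[OF assms[THEN flat_algebra_has_derivative]]])
     (simp add: partial_d_def)

lemma partial_d_flat_exp: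
  assumes "f \<in> flat_algebra"
  shows "partial_d i (\<lambda>x. flat_exp k (f x)) = (\<lambda>x. flat_exp' k (f x) * partial_d i f x)"
  by (rule ext, subst partial_d_eq[OF has_derivative_flat_exp_comp[OF assms[THEN flat_algebra_has_derivative]]])
     (simp add: partial_d_def)

lemma partial_d_cmult:
  "f \<in> flat_algebra \<Longrightarrow> partial_d i (\<lambda>x. c * f x) = (\<lambda>x. c * partial_d i f x)"
  by (subst partial_d_mult) (auto simp: partial_d_const intro: flat_algebra.const)

lemma flat_algebra_partial_d: "f \<in> flat_algebra \<Longrightarrow> partial_d i f \<in> flat_algebra"
proof (induction rule: flat_algebra.induct)
  case (flat f k)
  then show ?case
    by (auto simp: partial_d_flat_exp intro: flat_algebra.mult flat_algebra_flat')
qed (auto simp: partial_d_const partial_d_coord partial_d_add partial_d_mult intro: flat_algebra.intros)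

text \<open>Only the shape matters: the factor \<open>d\<close> is the same in all directions
  \<open>i\<close>, which makes the product \<open>d x * partial_d i f x * partial_d j f x\<close>
  symmetric when mixed derivatives are compared.\<close>

lemma partial_d_flat_exp':
  assumes "f \<in> flat_algebra"
  shows "\<exists>d. \<forall>i. partial_d i (\<lambda>x. flat_exp' k (f x)) = (\<lambda>x. d x * partial_d i f x)"
proof -
  have "partial_d i (\<lambda>x. flat_exp' k (f x)) =
      (\<lambda>x. (flat_exp' (k + 2) (f x) + - real k * flat_exp' (k + 1) (f x)) * partial_d i f x)" for i
    unfolding flat_exp'_def[of k] diff_conv_add_uminus mult_minus_left[symmetric]
    using assms by (subst partial_d_add)
      (auto simp only: partial_d_cmult partial_d_flat_exp flat_algebra_cmult flat_algebra.flat
         distrib_right mult.assoc)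
  then show ?thesis by (intro exI[of _ "\<lambda>x. flat_exp' (k + 2) (f x) + - real k * flat_exp' (k + 1) (f x)"]) blast
qed

text \<open>Structural induction takes the place of the general theorem on mixed partial
  derivatives.\<close>

lemma partial_d_commute:
  "f \<in> flat_algebra \<Longrightarrow> partial_d i (partial_d j f) = partial_d j (partial_d i f)"
proof (induction rule: flat_algebra.induct)
  case (mult f g)
  then show ?case
    by (simp add: partial_d_add partial_d_mult flat_algebra_partial_d flat_algebra.mult algebra_simps)
next
  case (flat f k)
  obtain d where "\<And>i. partial_d i (\<lambda>x. flat_exp' k (f x)) = (\<lambda>x. d x * partial_d i f x)"
    using partial_d_flat_exp'[OF flat.hyps, of k] by auto
  with flat show ?case
    by (simp add: partial_d_flat_exp partial_d_mult flat_algebra_partial_d flat_algebra_flat' algebra_simps)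
qed (auto simp: partial_d_const partial_d_coord partial_d_add flat_algebra_partial_d)

lemma flat_algebra_foldr_partial_d: "f \<in> flat_algebra \<Longrightarrow> foldr partial_d is f \<in> flat_algebra"
  by (induction "is") (auto intro: flat_algebra_partial_d)

lemma flat_algebra_C_infinity: "f \<in> flat_algebra \<Longrightarrow> C_infinity f"
  unfolding C_infinity_def
  by (intro allI differentiable_at_imp_differentiable_on flat_algebra_differentiable
      flat_algebra_foldr_partial_d)

lemma partial_d_eq_0:
  assumes "closed K" "\<And>x. x \<notin> K \<Longrightarrow> f x = 0" "x \<notin> K"
  shows "partial_d i f x = 0"
proof -
  have "((\<lambda>x. 0) has_derivative (\<lambda>h. 0)) (at x)" by simp
  then have "(f has_derivative (\<lambda>h. 0)) (at x)"
    by (rule has_derivative_transform_within_open[where s="-K"]) (use assms in auto)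
  then show ?thesis by (rule partial_d_eq)
qed

section \<open>Integration by parts against compactly supported functions\<close>

lemma integrable_compact_support:
  fixes f :: "'a::euclidean_space \<Rightarrow> real"
  assumes "continuous_on UNIV f" "compact K" "\<And>x. x \<notin> K \<Longrightarrow> f x = 0"
  shows "integrable lborel f"
proof -
  have "integrable lborel (\<lambda>x. indicator K x *\<^sub>R f x)"
    by (rule borel_integrable_compact) (use assms continuous_on_subset[OF _ subset_UNIV] in auto)
  moreover have "(\<lambda>x. indicator K x *\<^sub>R f x) = f"
    using assms(3) by (fastforce simp: indicator_def fun_eq_iff)
  ultimately show ?thesis by simp
qed

lemma integral_lborel_eq_integral_cbox:
  fixes f :: "'a::euclidean_space \<Rightarrow> real"
  assumes "continuous_on UNIV f" "\<And>x. x \<notin> cbox a b \<Longrightarrow> f x = 0"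
  shows "integral\<^sup>L lborel f = integral (cbox a b) f"
proof -
  have "integrable lborel f"
    using assms by (rule integrable_compact_support[OF _ compact_cbox])
  then have "integral\<^sup>L lborel f = integral UNIV f" by (simp add: integral_lborel)
  also have "\<dots> = integral (cbox a b) f"
  proof -
    have "f = (\<lambda>x. if x \<in> cbox a b then f x else 0)" using assms(2) by auto
    then show ?thesis using integral_restrict_UNIV[of "cbox a b" f] by simp
  qed
  finally show ?thesis .
qed

lemma continuous_on_mult_compact_support:
  fixes w \<phi> :: "'a::euclidean_space \<Rightarrow> real"
  assumes "open S" "continuous_on S w" "continuous_on UNIV \<phi>" "compact K" "K \<subseteq> S"
    "\<And>x. x \<notin> K \<Longrightarrow> \<phi> x = 0"
  shows "continuous_on UNIV (\<lambda>x. w x * \<phi> x)"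
proof -
  have "continuous_on S (\<lambda>x. w x * \<phi> x)"
    using assms continuous_on_subset[OF _ subset_UNIV] by (intro continuous_intros) auto
  moreover have "continuous_on (-K) (\<lambda>x. w x * \<phi> x)"
    using assms(6) by (subst continuous_on_cong[of "-K" "-K" _ "\<lambda>x. 0"]) auto
  moreover have "S \<union> - K = UNIV" using assms by auto
  ultimately show ?thesis
    using continuous_on_open_Un[of S "-K"] assms(1,4) by (simp add: open_Compl compact_imp_closed)
qed

lemma integral_lborel_translate:
  fixes f :: "'a::euclidean_space \<Rightarrow> real"
  assumes "f \<in> borel_measurable borel"
  shows "(\<integral>x. f (c + x) \<partial>lborel) = integral\<^sup>L lborel f"
proof -
  have "integral\<^sup>L (distr lborel borel ((+) c)) f = (\<integral>x. f (c + x) \<partial>lborel)"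
    using assms by (intro integral_distr) auto
  then show ?thesis by (simp add: lborel_distr_plus)
qed

text \<open>Translation invariance makes \<open>t \<mapsto> \<integral> F (x + t e\<^sub>i) dx\<close> constant; differentiate it at \<open>0\<close>.\<close>
lemma integral_partial_derivative_eq_0:
  fixes F :: "'a::euclidean_space \<Rightarrow> real"
  assumes deriv: "\<And>x. (F has_derivative F' x) (at x)"
    and supp: "compact K" "\<And>x. x \<notin> K \<Longrightarrow> F x = 0"
    and cont: "continuous_on UNIV (\<lambda>x. F' x e)"
  shows "(\<integral>x. F' x e \<partial>lborel) = 0"
proof -
  obtain M where M: "\<And>x. x \<in> K \<Longrightarrow> norm x \<le> M"
    using compact_imp_bounded[OF supp(1)] by (auto simp: bounded_iff)
  \<comment> \<open>One box contains the supports of all translates with \<bar>t\<bar> \<le> 1, so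
    the domain of integration stays fixed while \<open>t\<close> varies.\<close>
  obtain a b where ab: "cball 0 (M + norm e) \<subseteq> cbox (a :: 'a) b"
    using bounded_subset_cbox_symmetric[OF bounded_cball] by metis
  have contF: "continuous_on UNIV F"
    by (intro continuous_at_imp_continuous_on ballI has_derivative_continuous[OF deriv])
  have zero: "F (t *\<^sub>R e + x) = 0" if "\<bar>t\<bar> \<le> 1" "x \<notin> cbox a b" for t x
  proof (rule supp(2), rule notI)
    assume "t *\<^sub>R e + x \<in> K"
    then have "norm (t *\<^sub>R e + x) \<le> M" by (rule M)
    moreover have "norm x \<le> norm (t *\<^sub>R e + x) + norm (t *\<^sub>R e)"
      using norm_triangle_ineq4[of "t *\<^sub>R e + x" "t *\<^sub>R e"] by simp
    moreover have "norm (t *\<^sub>R e) \<le> 1 * norm e" 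
      unfolding norm_scaleR using that(1) by (intro mult_right_mono) auto
    ultimately have "x \<in> cball 0 (M + norm e)" by simp
    then show False using that(2) ab by blast
  qed
  have const: "integral (cbox a b) (\<lambda>x. F (t *\<^sub>R e + x)) = integral\<^sup>L lborel F" if "\<bar>t\<bar> \<le> 1" for t
  proof -
    have "continuous_on UNIV (\<lambda>x. F (t *\<^sub>R e + x))"
      by (intro continuous_on_compose2[OF contF] continuous_intros) auto
    then have "(\<integral>x. F (t *\<^sub>R e + x) \<partial>lborel) = integral (cbox a b) (\<lambda>x. F (t *\<^sub>R e + x))"
      by (rule integral_lborel_eq_integral_cbox) (use zero that in auto)
    moreover have "F \<in> borel_measurable borel"
      using contF by (rule borel_measurable_continuous_onI)
    ultimately show ?thesis by (simp add: integral_lborel_translate)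
  qed
  have d: "((\<lambda>t. F (t *\<^sub>R e + x)) has_real_derivative F' (t *\<^sub>R e + x) e) (at t within {-1<..<1})" for t x
  proof -
    have "((\<lambda>t. F (t *\<^sub>R e + x)) has_derivative (\<lambda>h. F' (t *\<^sub>R e + x) (h *\<^sub>R e))) (at t within {-1<..<1})"
      by (rule has_derivative_compose[OF _ deriv]) (auto intro!: derivative_eq_intros)
    then show ?thesis
      using linear_cmul[OF has_derivative_linear[OF deriv]]
      by (simp add: has_field_derivative_def mult.commute[of _ "F' _ _"])
  qed
  have "((\<lambda>t. integral (cbox a b) (\<lambda>x. F (t *\<^sub>R e + x))) has_real_derivative
      integral (cbox a b) (\<lambda>x. F' (0 *\<^sub>R e + x) e)) (at 0 within {-1<..<1})"
  proof (rule leibniz_rule_field_derivative[where fx="\<lambda>t x. F' (t *\<^sub>R e + x) e"])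
    show "(\<lambda>x. F (t *\<^sub>R e + x)) integrable_on cbox a b" for t
      by (intro integrable_continuous continuous_on_compose2[OF contF] continuous_intros) auto
    show "continuous_on ({- 1<..<1} \<times> cbox a b) (\<lambda>(t, x). F' (t *\<^sub>R e + x) e)"
      unfolding case_prod_beta
      by (intro continuous_on_compose2[OF cont] continuous_intros) auto
  qed (use d in auto)
  then have "((\<lambda>t. integral (cbox a b) (\<lambda>x. F (t *\<^sub>R e + x))) has_real_derivative
      integral (cbox a b) (\<lambda>x. F' x e)) (at 0 within {-1<..<1})"
    by simp
  then have "((\<lambda>t. integral\<^sup>L lborel F) has_real_derivative
      integral (cbox a b) (\<lambda>x. F' x e)) (at 0 within {-1<..<1})"
    by (rule has_field_derivative_transform_within[OF _ zero_less_one]) (auto simp: const)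
  then have "((\<lambda>t. integral\<^sup>L lborel F) has_real_derivative integral (cbox a b) (\<lambda>x. F' x e)) (at 0)"
    by (simp add: at_within_open[of 0 "{-1<..<(1::real)}"])
  then have "integral (cbox a b) (\<lambda>x. F' x e) = 0"
    by (rule DERIV_unique[OF _ DERIV_const])
  moreover have "F' x e = 0" if "x \<notin> cbox a b" for x
  proof -
    have "x \<notin> K" using that ab M[of x] norm_ge_zero[of e] by (force simp: subset_iff simp del: norm_ge_zero)
    moreover have "((\<lambda>x. 0) has_derivative (\<lambda>h. 0)) (at x)" by simp
    ultimately have "(F has_derivative (\<lambda>h. 0)) (at x)"
      by (rule_tac has_derivative_transform_within_open[where s="-K"])
         (use supp in \<open>auto simp: compact_imp_closed\<close>)
    then have "F' x = (\<lambda>h. 0)" by (rule has_derivative_unique[OF deriv])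
    then show ?thesis by simp
  qed
  ultimately show ?thesis
    using integral_lborel_eq_integral_cbox[OF cont, of a b] by simp
qed

lemma integration_by_parts_compact_support:
  fixes v :: "real^'n::finite \<Rightarrow> real"
  assumes S: "open S" and deriv: "\<And>x. x \<in> S \<Longrightarrow> (v has_derivative v' x) (at x)"
    and cont: "continuous_on S (\<lambda>x. v' x (axis i 1))"
    and \<phi>: "\<phi> \<in> flat_algebra" and K: "compact K" "K \<subseteq> S" "\<And>x. x \<notin> K \<Longrightarrow> \<phi> x = 0"
  shows "(\<integral>x. v' x (axis i 1) * \<phi> x \<partial>lborel) = - (\<integral>x. v x * partial_d i \<phi> x \<partial>lborel)"
proof -
  note \<phi>i = flat_algebra_partial_d[OF \<phi>, of i]
  have zero: "partial_d i \<phi> x = 0" if "x \<notin> K" for x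
    by (rule partial_d_eq_0[OF compact_imp_closed[OF K(1)] K(3) that])
  \<comment> \<open>\<open>v\<close> is differentiable only on \<open>S\<close>, but its product
    with \<phi> is differentiable everywhere: off \<open>K\<close> it is locally 0.\<close>
  define F' where "F' x h = (if x \<in> K then v x * frechet_derivative \<phi> (at x) h + v' x h * \<phi> x else 0)" for x h
  have "((\<lambda>x. v x * \<phi> x) has_derivative F' x) (at x)" for x
  proof (cases "x \<in> K")
    case True
    then show ?thesis 
      using has_derivative_mult[OF deriv flat_algebra_has_derivative[OF \<phi>], of x] K(2)
      by (auto simp: F'_def[abs_def])
  next
    case False
    have "((\<lambda>x. 0) has_derivative (\<lambda>h. 0)) (at x)" by simp
    then have "((\<lambda>x. v x * \<phi> x) has_derivative (\<lambda>h. 0)) (at x)"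
      by (rule has_derivative_transform_within_open[where s="-K"])
         (use False K in \<open>auto simp: compact_imp_closed\<close>)
    then show ?thesis using False by (simp add: F'_def[abs_def])
  qed
  moreover have F'_eq: "F' x (axis i 1) = v x * partial_d i \<phi> x + v' x (axis i 1) * \<phi> x" for x
    using K(3)[of x] zero[of x] by (auto simp: F'_def partial_d_def)
  have contv: "continuous_on S v"
    by (intro continuous_at_imp_continuous_on ballI has_derivative_continuous[OF deriv])
  have c1: "continuous_on UNIV (\<lambda>x. v x * partial_d i \<phi> x)"
    by (rule continuous_on_mult_compact_support[OF S contv flat_algebra_continuous[OF \<phi>i] K(1,2) zero])
  have c2: "continuous_on UNIV (\<lambda>x. v' x (axis i 1) * \<phi> x)"
    by (rule continuous_on_mult_compact_support[OF S cont flat_algebra_continuous[OF \<phi>] K])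
  ultimately have "(\<integral>x. F' x (axis i 1) \<partial>lborel) = 0"
    by (intro integral_partial_derivative_eq_0[of "\<lambda>x. v x * \<phi> x", OF _ K(1)])
       (auto simp: K(3) F'_eq[abs_def] intro: continuous_on_add[OF c1 c2])
  moreover have "(\<integral>x. F' x (axis i 1) \<partial>lborel) =
      (\<integral>x. v x * partial_d i \<phi> x \<partial>lborel) + (\<integral>x. v' x (axis i 1) * \<phi> x \<partial>lborel)"
    unfolding F'_eq
    by (intro Bochner_Integration.integral_add integrable_compact_support[OF c1 K(1)]
        integrable_compact_support[OF c2 K(1)]) (auto simp: K(3) zero)
  ultimately show ?thesis by simp
qed

lemma integral_partial_d_eq_0:
  fixes \<phi> :: "real^'n::finite \<Rightarrow> real"
  assumes \<phi>: "\<phi> \<in> flat_algebra" and K: "compact K" "\<And>x. x \<notin> K \<Longrightarrow> \<phi> x = 0"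
  shows "(\<integral>x. partial_d i \<phi> x \<partial>lborel) = 0"
  using integration_by_parts_compact_support[of UNIV "\<lambda>x. 1" "\<lambda>x h. 0" i \<phi> K] assms by simp

section \<open>Integral estimates over balls\<close>

lemma integral_abs_le_cball:
  fixes f :: "real^'n::finite \<Rightarrow> real"
  assumes "continuous_on UNIV f" "\<And>x. x \<notin> cball X s \<Longrightarrow> f x = 0"
    and "\<And>x. x \<in> cball X s \<Longrightarrow> \<bar>f x\<bar> \<le> B" "0 \<le> s"
  shows "\<bar>integral\<^sup>L lborel f\<bar> \<le> B * (unit_ball_vol (real CARD('n)) * s ^ CARD('n))"
proof -
  have "norm (integral\<^sup>L lborel f) \<le> (\<integral>x. norm (f x) \<partial>lborel)"
    by (rule integral_norm_bound)
  also have "\<dots> \<le> (\<integral>x. indicat_real (cball X s) x * B \<partial>lborel)"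
  proof (rule integral_mono)
    show "integrable lborel (\<lambda>x. norm (f x))"
      using integrable_compact_support[OF assms(1) compact_cball assms(2)] by simp
    show "integrable lborel (\<lambda>x. indicat_real (cball X s) x * B)"
      by (intro integrable_mult_left integrable_real_indicator) 
         (use emeasure_bounded_finite[OF bounded_cball, of X s] in \<open>simp_all add: less_top\<close>)
  qed (use assms in \<open>auto simp: indicator_def\<close>)
  also have "\<dots> = measure lborel (cball X s) * B" by simp
  also have "measure lborel (cball X s) = unit_ball_vol (real CARD('n)) * s ^ CARD('n)"
    using content_cball[of s X] assms(4) by simp
  finally show ?thesis by (simp add: mult.commute)
qed

lemma integral_ge_cball:
  fixes f :: "real^'n::finite \<Rightarrow> real"
  assumes "integrable lborel f" "\<And>x. 0 \<le> f x"
    and "\<And>x. x \<in> cball X s \<Longrightarrow> B \<le> f x" "0 \<le> s"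
  shows "B * (unit_ball_vol (real CARD('n)) * s ^ CARD('n)) \<le> integral\<^sup>L lborel f"
proof -
  have "(\<integral>x. indicat_real (cball X s) x * B \<partial>lborel) \<le> integral\<^sup>L lborel f"
  proof (rule integral_mono)
    show "integrable lborel (\<lambda>x. indicat_real (cball X s) x * B)"
      by (intro integrable_mult_left integrable_real_indicator) 
         (use emeasure_bounded_finite[OF bounded_cball, of X s] in \<open>simp_all add: less_top\<close>)
  qed (use assms in \<open>auto simp: indicator_def\<close>)
  moreover have "measure lborel (cball X s) = unit_ball_vol (real CARD('n)) * s ^ CARD('n)"
    using content_cball[of s X] assms(4) by simp
  ultimately show ?thesis by (simp add: mult.commute)
qed

section \<open>Ellipsoidal kernels\<close>

text \<open>For positive definite \<open>B\<close> this equals 1 at the centre and changes sign on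
  the boundary of the ellipsoid, so composing it with \<open>flat_exp\<close> gives a smooth
  function supported there.\<close>

definition ellipsoid :: "real^'n^'n \<Rightarrow> real^'n \<Rightarrow> real \<Rightarrow> real^'n \<Rightarrow> real" where
  "ellipsoid B X s Y = 1 - ((Y - X) \<bullet> (B *v (Y - X))) / s\<^sup>2"

text \<open>The lower bound has constant 1 so that \<open>ellipsoid B X s\<close> can be positive
  only inside \<open>cball X s\<close>. A suitable multiple of an inverse coefficient matrix meets
  this normalisation.\<close>

definition quad_form_bounds :: "real \<Rightarrow> real^'n^'n \<Rightarrow> bool" where
  "quad_form_bounds c B \<longleftrightarrow> 0 < c \<and> transpose B = B \<and>
     (\<forall>x. (norm x)\<^sup>2 \<le> x \<bullet> (B *v x)) \<and> (\<forall>x. norm (B *v x) \<le> c * norm x)"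

lemma ellipsoid_flat_algebra: "ellipsoid B X s \<in> flat_algebra" for B :: "real^'n::finite^'n"
proof -
  have "ellipsoid B X s = (\<lambda>Y. 1 - 1 / s\<^sup>2 *
      (\<Sum>i\<in>UNIV. (Y $ i - X $ i) * (\<Sum>j\<in>UNIV. B $ i $ j * (Y $ j - X $ j))))"
    by (simp add: ellipsoid_def[abs_def] inner_vec_def matrix_vector_mult_def)
  then show ?thesis
    by (simp only:) (intro flat_algebra_diff flat_algebra_cmult flat_algebra_sum flat_algebra.mult
        flat_algebra.const flat_algebra.coord)
qed

lemma matrix_vector_mult_flat_algebra: "(\<lambda>Y. (B *v (Y - X)) $ j) \<in> flat_algebra"
  for B :: "real^'n::finite^'n"
  unfolding matrix_vector_mult_def vec_lambda_beta vector_minus_component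
  by (intro flat_algebra_diff flat_algebra_cmult flat_algebra_sum flat_algebra.const flat_algebra.coord)

lemma partial_d_matrix_vector_mult: "partial_d i (\<lambda>Y. (B *v (Y - X)) $ j) Y = B $ j $ i"
  for B :: "real^'n::finite^'n"
proof -
  have "((\<lambda>Y. (B *v (Y - X)) $ j) has_derivative (\<lambda>h. (B *v h) $ j)) (at Y)"
    by (rule bounded_linear.has_derivative[OF bounded_linear_vec_nth])
       (auto intro!: derivative_eq_intros bounded_linear.has_derivative[OF matrix_vector_mul_bounded_linear])
  then show ?thesis
    by (simp add: partial_d_eq matrix_vector_mult_basis column_def)
qed

lemma symmetric_matrix_inner:
  fixes B :: "real^'n::finite^'n"
  shows "transpose B = B \<Longrightarrow> x \<bullet> (B *v y) = y \<bullet> (B *v x)"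
  by (metis dot_lmul_matrix inner_commute transpose_matrix_vector)

lemma partial_d_ellipsoid:
  fixes B :: "real^'n::finite^'n"
  assumes "transpose B = B"
  shows "partial_d i (ellipsoid B X s) Y = - 2 / s\<^sup>2 * (B *v (Y - X)) $ i"
proof -
  have lin: "((\<lambda>Y. B *v (Y - X)) has_derivative (\<lambda>h. B *v h)) (at Y)"
    by (auto intro!: derivative_eq_intros bounded_linear.has_derivative[OF matrix_vector_mul_bounded_linear])
  have "(ellipsoid B X s has_derivative
      (\<lambda>h. - (((Y - X) \<bullet> (B *v h) + h \<bullet> (B *v (Y - X))) / s\<^sup>2))) (at Y)"
    unfolding ellipsoid_def[abs_def] divide_inverse
    by (rule derivative_eq_intros lin refl | simp)+
  then have "partial_d i (ellipsoid B X s) Y =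
      - (((Y - X) \<bullet> (B *v axis i 1) + axis i 1 \<bullet> (B *v (Y - X))) / s\<^sup>2)"
    by (rule partial_d_eq)
  also have "(Y - X) \<bullet> (B *v axis i 1) = axis i 1 \<bullet> (B *v (Y - X))"
    by (rule symmetric_matrix_inner[OF assms])
  finally show ?thesis by (simp add: inner_axis inner_commute[of "axis i 1"])
qed

lemma ellipsoid_nonpos:
  fixes B :: "real^'n::finite^'n"
  assumes "quad_form_bounds c B" "0 < s" "Y \<notin> cball X s"
  shows "ellipsoid B X s Y \<le> 0"
proof -
  have "s\<^sup>2 \<le> (norm (Y - X))\<^sup>2"
    using assms(2,3) by (intro power_mono) (auto simp: dist_norm norm_minus_commute)
  also have "\<dots> \<le> (Y - X) \<bullet> (B *v (Y - X))"
    using assms(1) by (simp add: quad_form_bounds_def)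
  finally show ?thesis using assms(2) by (simp add: ellipsoid_def)
qed

lemma ellipsoid_continuous: "continuous_on S (ellipsoid B X s)" for B :: "real^'n::finite^'n"
  by (rule flat_algebra_continuous[OF ellipsoid_flat_algebra])

lemma ellipsoid_le_1:
  fixes B :: "real^'n::finite^'n"
  assumes "quad_form_bounds c B"
  shows "ellipsoid B X s Y \<le> 1"
proof -
  have "0 \<le> (Y - X) \<bullet> (B *v (Y - X))"
    using assms order_trans[OF zero_le_power2] by (auto simp: quad_form_bounds_def)
  then show ?thesis by (simp add: ellipsoid_def)
qed

section \<open>The bump, the kernel and its derivative in the scale\<close>

definition bump :: "real^'n^'n \<Rightarrow> real^'n \<Rightarrow> real \<Rightarrow> real^'n::finite \<Rightarrow> real" where
  "bump B X s Y = flat_exp 0 (ellipsoid B X s Y)"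

text \<open>The profile \<open>flat_exp 2\<close> is the derivative of \<open>flat_exp 0\<close>,
  the profile of \<open>bump\<close>; this pairing turns the scale derivative of the kernel into
  second derivatives of \<open>bump\<close>.\<close>

definition heat_kernel :: "real^'n^'n \<Rightarrow> real^'n \<Rightarrow> real \<Rightarrow> real^'n::finite \<Rightarrow> real" where
  "heat_kernel B X s Y = flat_exp 2 (ellipsoid B X s Y)"

text \<open>\<open>heat_kernel_ds\<close> is \<open>s\<^sup>n\<^sup>+\<^sup>1\<close> times the \<open>s\<close>-derivative of \<open>s\<^sup>-\<^sup>n heat_kernel\<close>.\<close>
definition heat_kernel_ds :: "real^'n^'n \<Rightarrow> real^'n \<Rightarrow> real \<Rightarrow> real^'n::finite \<Rightarrow> real" where
  "heat_kernel_ds B X s Y = 2 * (1 - ellipsoid B X s Y) * flat_exp' 2 (ellipsoid B X s Y)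
     - real CARD('n) * flat_exp 2 (ellipsoid B X s Y)"

lemma bump_flat_algebra: "bump B X s \<in> flat_algebra"
  unfolding bump_def[abs_def] by (intro flat_algebra.flat ellipsoid_flat_algebra)

lemma bump_support: "quad_form_bounds c B \<Longrightarrow> 0 < s \<Longrightarrow> Y \<notin> cball X s \<Longrightarrow> bump B X s Y = 0"
  unfolding bump_def by (intro flat_exp_nonpos ellipsoid_nonpos)

lemma partial_d_bump:
  fixes B :: "real^'n::finite^'n"
  assumes "transpose B = B"
  shows "partial_d j (bump B X s) =
    (\<lambda>Y. - 2 / s\<^sup>2 * (flat_exp 2 (ellipsoid B X s Y) * (B *v (Y - X)) $ j))"
  unfolding bump_def[abs_def]
  by (simp add: partial_d_flat_exp[OF ellipsoid_flat_algebra] partial_d_ellipsoid[OF assms]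
      flat_exp'_def numeral_2_eq_2 mult_ac)

lemma partial_d2_bump:
  fixes B :: "real^'n::finite^'n"
  assumes "transpose B = B"
  shows "partial_d i (partial_d j (bump B X s)) Y =
    - 2 / s\<^sup>2 * (flat_exp 2 (ellipsoid B X s Y) * B $ j $ i
      + flat_exp' 2 (ellipsoid B X s Y) * (- 2 / s\<^sup>2 * (B *v (Y - X)) $ i) * (B *v (Y - X)) $ j)"
proof -
  have m: "(\<lambda>Y. flat_exp 2 (ellipsoid B X s Y)) \<in> flat_algebra"
    by (intro flat_algebra.flat ellipsoid_flat_algebra)
  note l = matrix_vector_mult_flat_algebra[of B X j]
  show ?thesis
    unfolding partial_d_bump[OF assms] partial_d_cmult[OF flat_algebra.mult[OF m l]]
      partial_d_mult[OF m l] partial_d_flat_exp[OF ellipsoid_flat_algebra]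
      partial_d_ellipsoid[OF assms] partial_d_matrix_vector_mult by simp
qed

text \<open>With y = B(Y - X), the relation \<open>A ** B = mat \<beta>\<close> makes both
  contractions with \<open>A\<close> scalar: the trace of AB is \<beta> n, and y . Ay = \<beta> (Y -
  X) . y = \<beta> s^2 (1 - e), where e is the ellipsoid function. The operator applied to
  \<open>bump\<close> therefore depends on \<open>Y\<close> through e alone, as the scale derivative
  does.\<close>

lemma heat_kernel_ds_eq:
  fixes B :: "real^'n::finite^'n"
  assumes B: "transpose B = B" and AB: "A ** B = mat \<beta>" and "\<beta> \<noteq> 0" and s: "s \<noteq> 0"
  shows "heat_kernel_ds B X s Y =
    s\<^sup>2 / (2 * \<beta>) * (\<Sum>i\<in>UNIV. \<Sum>j\<in>UNIV. A $ i $ j * partial_d i (partial_d j (bump B X s)) Y)"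
proof -
  define y where "y = B *v (Y - X)"
  define e where "e = flat_exp 2 (ellipsoid B X s Y)"
  define e' where "e' = flat_exp' 2 (ellipsoid B X s Y)"
  have tr: "(\<Sum>i\<in>UNIV. \<Sum>j\<in>UNIV. A $ i $ j * B $ j $ i) = \<beta> * real CARD('n)"
  proof -
    have "(\<Sum>j\<in>UNIV. A $ i $ j * B $ j $ i) = \<beta>" for i
      using arg_cong[OF AB, of "\<lambda>M. M $ i $ i"] by (simp add: matrix_matrix_mult_def mat_def)
    then show ?thesis by simp
  qed
  have Ay: "A *v y = \<beta> *\<^sub>R (Y - X)"
  proof -
    have "A *v y = (A ** B) *v (Y - X)" by (simp add: y_def matrix_vector_mul_assoc)
    also have "\<dots> = \<beta> *\<^sub>R (Y - X)"
      unfolding AB by (simp add: vec_eq_iff matrix_vector_mult_def mat_def if_distrib[of "\<lambda>x. x * _"] cong: if_cong)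
    finally show ?thesis .
  qed
  have "(\<Sum>i\<in>UNIV. \<Sum>j\<in>UNIV. A $ i $ j * y $ i * y $ j) = y \<bullet> (A *v y)"
    by (simp add: inner_vec_def matrix_vector_mult_def sum_distrib_left mult_ac)
  also have "\<dots> = \<beta> * ((Y - X) \<bullet> y)" unfolding Ay by (simp add: inner_commute)
  also have "(Y - X) \<bullet> y = s\<^sup>2 * (1 - ellipsoid B X s Y)"
    using s by (simp add: ellipsoid_def y_def)
  finally have q: "(\<Sum>i\<in>UNIV. \<Sum>j\<in>UNIV. A $ i $ j * y $ i * y $ j) = \<beta> * (s\<^sup>2 * (1 - ellipsoid B X s Y))" .
  have "(\<Sum>i\<in>UNIV. \<Sum>j\<in>UNIV. A $ i $ j * partial_d i (partial_d j (bump B X s)) Y) =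
      (\<Sum>i\<in>UNIV. \<Sum>j\<in>UNIV. (- 2 / s\<^sup>2 * e) * (A $ i $ j * B $ j $ i)
          + (- 2 / s\<^sup>2 * e' * (- 2 / s\<^sup>2)) * (A $ i $ j * y $ i * y $ j))"
    unfolding partial_d2_bump[OF B] y_def e_def e'_def
    by (intro sum.cong refl) (simp only: distrib_left mult_ac)
  also have "\<dots> = (- 2 / s\<^sup>2 * e) * (\<beta> * real CARD('n))
      + (- 2 / s\<^sup>2 * e' * (- 2 / s\<^sup>2)) * (\<beta> * (s\<^sup>2 * (1 - ellipsoid B X s Y)))"
    unfolding sum.distrib sum_distrib_left[symmetric] tr q ..
  finally have *: "(\<Sum>i\<in>UNIV. \<Sum>j\<in>UNIV. A $ i $ j * partial_d i (partial_d j (bump B X s)) Y) = \<dots>" .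
  show ?thesis
    unfolding * heat_kernel_ds_def e_def[symmetric] e'_def[symmetric] using assms(3) s
    by (simp add: field_simps power2_eq_square)
qed

lemma matrix_entry_le:
  fixes B :: "real^'n::finite^'n"
  assumes "\<And>x. norm (B *v x) \<le> c * norm x"
  shows "\<bar>B $ i $ j\<bar> \<le> c"
proof -
  have "\<bar>B $ i $ j\<bar> = \<bar>(B *v axis j 1) $ i\<bar>" by (simp add: matrix_vector_mult_basis column_def)
  also have "\<dots> \<le> norm (B *v axis j 1)" by (rule component_le_norm_cart)
  also have "\<dots> \<le> c * norm (axis j 1 :: real^'n)" by (rule assms)
  finally show ?thesis by simp
qed

text \<open>Each derivative costs a factor 1/s. The numbers come from the bounds 2 and 36 for
  \<open>flat_exp 2\<close> and \<open>flat_exp' 2\<close>, with matrix entries at most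
  \<open>c\<close> and components of \<open>B *v (Y - X)\<close> at most
  \<open>c * s\<close>.\<close>

lemma partial_d2_bump_bound:
  fixes B :: "real^'n::finite^'n"
  assumes B: "quad_form_bounds c B" and s: "0 < s" and Y: "Y \<in> cball X s"
  shows "\<bar>partial_d i (partial_d j (bump B X s)) Y\<bar> \<le> (4 * c + 144 * c\<^sup>2) / s\<^sup>2"
proof -
  have c: "0 < c" and sym: "transpose B = B" and bd: "\<And>x. norm (B *v x) \<le> c * norm x"
    using B by (auto simp: quad_form_bounds_def)
  have y: "\<bar>(B *v (Y - X)) $ i\<bar> \<le> c * s" for i
  proof -
    have "\<bar>(B *v (Y - X)) $ i\<bar> \<le> norm (B *v (Y - X))" by (rule component_le_norm_cart)
    also have "\<dots> \<le> c * norm (Y - X)" by (rule bd)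
    also have "\<dots> \<le> c * s" using Y c by (intro mult_left_mono) (auto simp: dist_norm norm_minus_commute)
    finally show ?thesis .
  qed
  define e where "e = flat_exp 2 (ellipsoid B X s Y)"
  define e' where "e' = flat_exp' 2 (ellipsoid B X s Y)"
  have "\<bar>e * B $ j $ i\<bar> \<le> 2 * c"
    unfolding abs_mult e_def
    by (intro mult_mono flat_exp_2_bound matrix_entry_le bd) auto
  moreover have "\<bar>e' * (- 2 / s\<^sup>2 * (B *v (Y - X)) $ i) * (B *v (Y - X)) $ j\<bar> \<le> 36 * (2 / s\<^sup>2 * (c * s)) * (c * s)"
    unfolding abs_mult e'_def
    by (intro mult_mono flat_exp'_2_bound y) (use c s in auto)
  moreover have "36 * (2 / s\<^sup>2 * (c * s)) * (c * s) = 72 * c\<^sup>2"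
    using s by (simp add: power2_eq_square)
  ultimately have "\<bar>e * B $ j $ i + e' * (- 2 / s\<^sup>2 * (B *v (Y - X)) $ i) * (B *v (Y - X)) $ j\<bar> \<le> 2 * c + 72 * c\<^sup>2"
    by linarith
  then have "2 / s\<^sup>2 * \<bar>e * B $ j $ i + e' * (- 2 / s\<^sup>2 * (B *v (Y - X)) $ i) * (B *v (Y - X)) $ j\<bar> \<le> 2 / s\<^sup>2 * (2 * c + 72 * c\<^sup>2)"
    by (intro mult_left_mono) auto
  moreover have "\<bar>partial_d i (partial_d j (bump B X s)) Y\<bar> =
      2 / s\<^sup>2 * \<bar>e * B $ j $ i + e' * (- 2 / s\<^sup>2 * (B *v (Y - X)) $ i) * (B *v (Y - X)) $ j\<bar>"
    unfolding partial_d2_bump[OF sym] e_def e'_def by (simp only: abs_mult) simp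
  moreover have "2 / s\<^sup>2 * (2 * c + 72 * c\<^sup>2) = (4 * c + 144 * c\<^sup>2) / s\<^sup>2"
    by (simp add: add_divide_distrib distrib_left)
  ultimately show ?thesis by linarith
qed

lemma partial_d2_bump_support:
  fixes B :: "real^'n::finite^'n"
  assumes B: "quad_form_bounds c B" and s: "0 < s" and Y: "Y \<notin> cball X s"
  shows "partial_d i (partial_d j (bump B X s)) Y = 0"
  by (rule partial_d_eq_0[OF closed_cball _ Y], rule partial_d_eq_0[OF closed_cball bump_support[OF B s]])

lemma heat_kernel_continuous: "continuous_on S (heat_kernel B X s)" for B :: "real^'n::finite^'n"
  unfolding heat_kernel_def[abs_def]
  by (intro flat_algebra_continuous flat_algebra.flat ellipsoid_flat_algebra)

lemma heat_kernel_support: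
  "quad_form_bounds c B \<Longrightarrow> 0 < s \<Longrightarrow> Y \<notin> cball X s \<Longrightarrow> heat_kernel B X s Y = 0"
  unfolding heat_kernel_def by (intro flat_exp_nonpos ellipsoid_nonpos)

lemma heat_kernel_nonneg: "0 \<le> heat_kernel B X s Y"
  by (simp add: heat_kernel_def flat_exp_nonneg)

lemma heat_kernel_bound: "\<bar>heat_kernel B X s Y\<bar> \<le> 2"
  by (simp only: heat_kernel_def flat_exp_2_bound)

lemma heat_kernel_ds_flat_algebra: "heat_kernel_ds B X s \<in> flat_algebra" for B :: "real^'n::finite^'n"
  unfolding heat_kernel_ds_def[abs_def]
  by (intro flat_algebra_diff flat_algebra.mult flat_algebra_flat' flat_algebra.flat
      ellipsoid_flat_algebra flat_algebra.const)

lemma heat_kernel_ds_continuous: "continuous_on S (heat_kernel_ds B X s)" for B :: "real^'n::finite^'n"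
  by (rule flat_algebra_continuous[OF heat_kernel_ds_flat_algebra])

lemma heat_kernel_ds_support:
  assumes "quad_form_bounds c B" "0 < s" "Y \<notin> cball X s"
  shows "heat_kernel_ds B X s Y = 0"
  using ellipsoid_nonpos[OF assms] by (simp add: heat_kernel_ds_def flat_exp'_def)

text \<open>Not normalised: the average of \<open>1\<close> depends on \<open>B\<close> but not on \<open>s\<close>.\<close>
definition heat_average :: "real^'n^'n \<Rightarrow> real^'n \<Rightarrow> real \<Rightarrow> (real^'n::finite \<Rightarrow> real) \<Rightarrow> real" where
  "heat_average B X s w = (\<integral>Y. w Y * heat_kernel B X s Y \<partial>lborel) / s ^ CARD('n)"

section \<open>Kernel averages as functions of the scale\<close>

lemma heat_kernel_has_derivative_scale:
  assumes "s \<noteq> 0"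
  shows "((\<lambda>s. heat_kernel B X s Y) has_real_derivative
    flat_exp' 2 (ellipsoid B X s Y) * (2 * (1 - ellipsoid B X s Y) / s)) (at s)"
proof -
  have "((\<lambda>s. ellipsoid B X s Y) has_real_derivative (2 * (1 - ellipsoid B X s Y) / s)) (at s)"
    unfolding ellipsoid_def using assms
    by (auto intro!: derivative_eq_intros simp: field_simps power2_eq_square)
  from DERIV_chain2[OF flat_exp_deriv this] show ?thesis
    unfolding heat_kernel_def[abs_def] .
qed

lemma integral_heat_kernel_has_derivative:
  fixes B :: "real^'n::finite^'n"
  assumes B: "quad_form_bounds c B" and w: "continuous_on UNIV w" and s: "0 < s"
  shows "((\<lambda>s. \<integral>Y. w Y * heat_kernel B X s Y \<partial>lborel) has_real_derivative
    (\<integral>Y. w Y * (flat_exp' 2 (ellipsoid B X s Y) * (2 * (1 - ellipsoid B X s Y) / s)) \<partial>lborel)) (at s)"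
proof -
  \<comment> \<open>Staying within a factor 2 of \<open>s\<close> keeps the scale away from 0 and
    all supports in one box, so differentiation takes place under an integral over a fixed
    domain.\<close>
  define U where "U = {s / 2<..<2 * s}"
  have sU: "s \<in> U" and U: "open U" "convex U" using s by (auto simp: U_def)
  obtain a b where ab: "cball X (2 * s) \<subseteq> cbox a b"
    using bounded_subset_cbox_symmetric[OF bounded_cball] by metis
  have pos: "0 < t" and sub: "cball X t \<subseteq> cbox a b" if "t \<in> U" for t
  proof -
    show "0 < t" using that s by (auto simp: U_def)
    have "cball X t \<subseteq> cball X (2 * s)" using that by (intro subset_cball) (auto simp: U_def)
    with ab show "cball X t \<subseteq> cbox a b" by blast
  qed
  have ce: "continuous_on (U \<times> cbox a b) (\<lambda>x. ellipsoid B X (fst x) (snd x))"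
  proof -
    have "continuous_on (U \<times> cbox a b) (\<lambda>x. B *v (snd x - X))"
      by (intro bounded_linear.continuous_on[OF matrix_vector_mul_bounded_linear] continuous_intros)
    then show ?thesis
      unfolding ellipsoid_def using pos by (intro continuous_intros) force+
  qed
  have cw: "continuous_on S (\<lambda>Y. w Y * heat_kernel B X t Y)" for t S
    by (intro continuous_on_mult heat_kernel_continuous continuous_on_subset[OF w subset_UNIV])
  have "((\<lambda>t. integral (cbox a b) (\<lambda>Y. w Y * heat_kernel B X t Y)) has_real_derivative
      integral (cbox a b) (\<lambda>Y. w Y * (flat_exp' 2 (ellipsoid B X s Y) * (2 * (1 - ellipsoid B X s Y) / s)))) (at s within U)"
  proof (rule leibniz_rule_field_derivative
      [where fx="\<lambda>s Y. w Y * (flat_exp' 2 (ellipsoid B X s Y) * (2 * (1 - ellipsoid B X s Y) / s))"])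
    fix t Y assume "t \<in> U"
    then have "t \<noteq> 0" using pos by force
    from heat_kernel_has_derivative_scale[OF this]
    show "((\<lambda>s. w Y * heat_kernel B X s Y) has_real_derivative
      w Y * (flat_exp' 2 (ellipsoid B X t Y) * (2 * (1 - ellipsoid B X t Y) / t))) (at t within U)"
      by (rule has_field_derivative_at_within[OF DERIV_cmult])
  next
    show "(\<lambda>Y. w Y * heat_kernel B X t Y) integrable_on cbox a b" for t
      by (intro integrable_continuous cw)
    show "continuous_on (U \<times> cbox a b)
       (\<lambda>(s, Y). w Y * (flat_exp' 2 (ellipsoid B X s Y) * (2 * (1 - ellipsoid B X s Y) / s)))"
      unfolding case_prod_beta
      by (intro continuous_intros ce continuous_on_compose2[OF flat_exp'_continuous]
          continuous_on_compose2[OF w]) (use pos in force)+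
  qed (use sU U in auto)
  then have "((\<lambda>t. integral (cbox a b) (\<lambda>Y. w Y * heat_kernel B X t Y)) has_real_derivative
      integral (cbox a b) (\<lambda>Y. w Y * (flat_exp' 2 (ellipsoid B X s Y) * (2 * (1 - ellipsoid B X s Y) / s)))) (at s)"
    by (simp add: at_within_open[OF sU U(1)])
  moreover have "integral (cbox a b) (\<lambda>Y. w Y * heat_kernel B X t Y) = (\<integral>Y. w Y * heat_kernel B X t Y \<partial>lborel)"
    if "t \<in> U" for t
    using heat_kernel_support[OF B pos[OF that]] sub[OF that]
    by (intro integral_lborel_eq_integral_cbox[symmetric] cw) (auto simp: subset_iff)
  moreover have "integral (cbox a b) (\<lambda>Y. w Y * (flat_exp' 2 (ellipsoid B X s Y) * (2 * (1 - ellipsoid B X s Y) / s)))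
      = (\<integral>Y. w Y * (flat_exp' 2 (ellipsoid B X s Y) * (2 * (1 - ellipsoid B X s Y) / s)) \<partial>lborel)"
  proof (rule integral_lborel_eq_integral_cbox[symmetric])
    show "continuous_on UNIV (\<lambda>Y. w Y * (flat_exp' 2 (ellipsoid B X s Y) * (2 * (1 - ellipsoid B X s Y) / s)))"
      using s by (intro continuous_intros w ellipsoid_continuous continuous_on_compose2[OF flat_exp'_continuous]) auto
    fix Y assume "Y \<notin> cbox a b"
    then have "ellipsoid B X s Y \<le> 0" using ellipsoid_nonpos[OF B s] sub[OF sU] by blast
    then show "w Y * (flat_exp' 2 (ellipsoid B X s Y) * (2 * (1 - ellipsoid B X s Y) / s)) = 0"
      by (simp add: flat_exp'_def)
  qed
  ultimately show ?thesis
    by (simp only:) (rule has_field_derivative_transform_within_open[OF _ U(1) sU])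
qed

lemma heat_average_has_derivative:
  fixes B :: "real^'n::finite^'n"
  assumes B: "quad_form_bounds c B" and w: "continuous_on UNIV w" and s: "0 < s"
  shows "((\<lambda>s. heat_average B X s w) has_real_derivative
    (\<integral>Y. w Y * heat_kernel_ds B X s Y \<partial>lborel) / s ^ (CARD('n) + 1)) (at s)"
proof -
  define D where "D Y = flat_exp' 2 (ellipsoid B X s Y) * (2 * (1 - ellipsoid B X s Y) / s)" for Y
  let ?n = "CARD('n)"
  have cD: "continuous_on UNIV (\<lambda>Y. w Y * D Y)"
    unfolding D_def using s 
    by (intro continuous_intros w ellipsoid_continuous continuous_on_compose2[OF flat_exp'_continuous]) auto
  have zD: "w Y * D Y = 0" if "Y \<notin> cball X s" for Y
    using ellipsoid_nonpos[OF B s that] by (simp add: D_def flat_exp'_def)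
  have cH: "continuous_on UNIV (\<lambda>Y. w Y * heat_kernel B X s Y)"
    by (intro continuous_on_mult heat_kernel_continuous w)
  have zH: "w Y * heat_kernel B X s Y = 0" if "Y \<notin> cball X s" for Y
    using heat_kernel_support[OF B s that] by simp
  have "((\<lambda>s. heat_average B X s w) has_real_derivative
    ((\<integral>Y. w Y * D Y \<partial>lborel) * s ^ ?n - (\<integral>Y. w Y * heat_kernel B X s Y \<partial>lborel) * (real ?n * (1 * s ^ (?n - Suc 0))))
      / (s ^ ?n * s ^ ?n)) (at s)"
    unfolding heat_average_def D_def
    by (intro DERIV_divide DERIV_power DERIV_ident integral_heat_kernel_has_derivative[OF B w s]) (use s in auto)
  also have "((\<integral>Y. w Y * D Y \<partial>lborel) * s ^ ?n - (\<integral>Y. w Y * heat_kernel B X s Y \<partial>lborel) * (real ?n * (1 * s ^ (?n - Suc 0))))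
      / (s ^ ?n * s ^ ?n) = (s * (\<integral>Y. w Y * D Y \<partial>lborel) - real ?n * (\<integral>Y. w Y * heat_kernel B X s Y \<partial>lborel)) / s ^ (?n + 1)"
  proof -
    have "s ^ ?n = s * s ^ (?n - Suc 0)" by (simp add: power_eq_if)
    then show ?thesis using s by (simp add: field_simps)
  qed
  also have "s * (\<integral>Y. w Y * D Y \<partial>lborel) - real ?n * (\<integral>Y. w Y * heat_kernel B X s Y \<partial>lborel)
      = (\<integral>Y. s * (w Y * D Y) - real ?n * (w Y * heat_kernel B X s Y) \<partial>lborel)"
    using integrable_compact_support[OF cD compact_cball zD] integrable_compact_support[OF cH compact_cball zH]
    by simp
  also have "(\<lambda>Y. s * (w Y * D Y) - real ?n * (w Y * heat_kernel B X s Y)) = (\<lambda>Y. w Y * heat_kernel_ds B X s Y)"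
    using s by (auto simp: fun_eq_iff D_def heat_kernel_def heat_kernel_ds_def field_simps)
  finally show ?thesis .
qed

lemma heat_average_bound:
  fixes B :: "real^'n::finite^'n"
  assumes B: "quad_form_bounds c B" and w: "continuous_on UNIV w" and s: "0 < s"
    and N: "\<And>Y. Y \<in> cball X s \<Longrightarrow> \<bar>w Y\<bar> \<le> N"
  shows "\<bar>heat_average B X s w\<bar> \<le> 2 * unit_ball_vol (real CARD('n)) * N"
proof -
  have "\<bar>\<integral>Y. w Y * heat_kernel B X s Y \<partial>lborel\<bar> \<le> (N * 2) * (unit_ball_vol (real CARD('n)) * s ^ CARD('n))"
  proof (rule integral_abs_le_cball[where X=X])
    show "continuous_on UNIV (\<lambda>Y. w Y * heat_kernel B X s Y)"
      by (intro continuous_on_mult heat_kernel_continuous w)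
    show "\<bar>w Y * heat_kernel B X s Y\<bar> \<le> N * 2" if "Y \<in> cball X s" for Y
      unfolding abs_mult using N[OF that] by (intro mult_mono heat_kernel_bound) auto
  qed (use s heat_kernel_support[OF B s] in auto)
  then show ?thesis
    using s by (simp add: heat_average_def divide_le_eq abs_divide abs_of_pos field_simps)
qed

lemma heat_average_diff_const:
  fixes B :: "real^'n::finite^'n"
  assumes B: "quad_form_bounds c B" and w: "continuous_on UNIV w" and s: "0 < s"
  shows "heat_average B X s (\<lambda>Y. w Y - k) = heat_average B X s w - k * heat_average B X s (\<lambda>Y. 1)"
proof -
  have "integrable lborel (\<lambda>Y. w Y * heat_kernel B X s Y)"
    by (rule integrable_compact_support[OF continuous_on_mult[OF w heat_kernel_continuous] compact_cball[of X s]])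
       (simp add: heat_kernel_support[OF B s])
  moreover have "integrable lborel (heat_kernel B X s)"
    by (rule integrable_compact_support[OF heat_kernel_continuous compact_cball[of X s]])
       (simp add: heat_kernel_support[OF B s])
  ultimately show ?thesis
    by (simp add: heat_average_def left_diff_distrib diff_divide_distrib)
qed

text \<open>The scale derivative is at most M s^(\<theta> - 1), which is integrable at 0 and
  contributes M/\<theta> R^\<theta> up to scale \<open>R\<close>; by continuity the average of
  \<open>w - w X\<close> tends to 0 with the scale. Condition \<open>ds0\<close> allows the constant
  \<open>w X\<close> to be subtracted without changing the derivative.\<close>

lemma heat_average_deviation:
  fixes B :: "real^'n::finite^'n"
  assumes B: "quad_form_bounds c B" and w: "continuous_on UNIV w" and R: "0 < R" and \<theta>: "0 < \<theta>"
    and ds0: "\<And>s. 0 < s \<Longrightarrow> (\<integral>Y. heat_kernel_ds B X s Y \<partial>lborel) = 0"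
    and H: "\<And>s. 0 < s \<Longrightarrow> s \<le> R \<Longrightarrow>
      \<bar>\<integral>Y. w Y * heat_kernel_ds B X s Y \<partial>lborel\<bar> \<le> M * s powr \<theta> * s ^ CARD('n)"
  shows "\<bar>heat_average B X R w - w X * heat_average B X R (\<lambda>Y. 1)\<bar> \<le> M / \<theta> * R powr \<theta>"
proof -
  define V where "V = unit_ball_vol (real CARD('n))"
  have V: "0 < V" by (simp add: V_def)
  define G where "G s = heat_average B X s (\<lambda>Y. w Y - w X)" for s
  have cw: "continuous_on UNIV (\<lambda>Y. w Y - w X)" by (intro continuous_intros w)
  have dint: "(\<integral>Y. (w Y - w X) * heat_kernel_ds B X s Y \<partial>lborel) = (\<integral>Y. w Y * heat_kernel_ds B X s Y \<partial>lborel)"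
    if "0 < s" for s
  proof -
    have "integrable lborel (\<lambda>Y. w Y * heat_kernel_ds B X s Y)"
      by (rule integrable_compact_support[OF continuous_on_mult[OF w heat_kernel_ds_continuous] compact_cball[of X s]])
         (simp add: heat_kernel_ds_support[OF B that])
    moreover have "integrable lborel (heat_kernel_ds B X s)"
      by (rule integrable_compact_support[OF heat_kernel_ds_continuous compact_cball[of X s]])
         (simp add: heat_kernel_ds_support[OF B that])
    ultimately show ?thesis
      by (simp add: left_diff_distrib ds0[OF that])
  qed
  have dG: "(G has_real_derivative (\<integral>Y. w Y * heat_kernel_ds B X s Y \<partial>lborel) / s ^ (CARD('n) + 1)) (at s)"
    if "0 < s" for s
    using heat_average_has_derivative[OF B cw that, of X] unfolding G_def[abs_def] dint[OF that] .
  have dG_bound: "\<bar>(\<integral>Y. w Y * heat_kernel_ds B X s Y \<partial>lborel) / s ^ (CARD('n) + 1)\<bar> \<le> M * s powr (\<theta> - 1)"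
    if "0 < s" "s \<le> R" for s
    using H[OF that] that by (simp add: abs_divide divide_le_eq powr_diff)
  have mono: "\<bar>G R\<bar> \<le> M / \<theta> * R powr \<theta> + \<bar>G s\<bar>" if s: "0 < s" "s \<le> R" for s
  proof -
    have M: "0 \<le> M"
    proof -
      have "0 \<le> M * (R powr \<theta> * R ^ CARD('n))"
        using order_trans[OF abs_ge_zero H[OF R order_refl]] by (simp add: mult.assoc)
      moreover have "0 < R powr \<theta> * R ^ CARD('n)" using R by simp
      ultimately show ?thesis by (simp only: zero_le_mult_iff) linarith
    qed
    have d: "((\<lambda>t. M / \<theta> * t powr \<theta>) has_real_derivative M * t powr (\<theta> - 1)) (at t)" if "0 < t" for t
      using that \<theta> by (auto intro!: derivative_eq_intros simp: powr_diff)
    \<comment> \<open>In place of an integral over the scale: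
      \<open>M / \<theta> * t powr \<theta>\<close> plus or minus \<open>G t\<close> is
      nondecreasing, because the derivative of the first term dominates that of
      \<open>G\<close>.\<close>
    have "M / \<theta> * s powr \<theta> - G s \<le> M / \<theta> * R powr \<theta> - G R"
    proof (rule DERIV_nonneg_imp_nondecreasing[OF s(2)])
      fix t assume t: "s \<le> t" "t \<le> R"
      then have "0 < t" using s by simp
      from DERIV_diff[OF d[OF this] dG[OF this]] dG_bound[OF this t(2)]
      show "\<exists>y. ((\<lambda>t. M / \<theta> * t powr \<theta> - G t) has_real_derivative y) (at t) \<and> 0 \<le> y"
        by (intro exI conjI) (assumption, linarith)
    qed
    moreover have "M / \<theta> * s powr \<theta> + G s \<le> M / \<theta> * R powr \<theta> + G R"
    proof (rule DERIV_nonneg_imp_nondecreasing[OF s(2)])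
      fix t assume t: "s \<le> t" "t \<le> R"
      then have "0 < t" using s by simp
      from DERIV_add[OF d[OF this] dG[OF this]] dG_bound[OF this t(2)]
      show "\<exists>y. ((\<lambda>t. M / \<theta> * t powr \<theta> + G t) has_real_derivative y) (at t) \<and> 0 \<le> y"
        by (intro exI conjI) (assumption, linarith)
    qed
    moreover have "0 \<le> M / \<theta> * s powr \<theta>" using M \<theta> by simp
    ultimately show ?thesis by linarith
  qed
  have "\<bar>G R\<bar> \<le> M / \<theta> * R powr \<theta>"
  proof (rule field_le_epsilon)
    fix e :: real assume e: "0 < e"
    \<comment> \<open>Cancels the factor 2 V of \<open>heat_average_bound\<close>.\<close>
    define e' where "e' = e / (2 * V)"
    have e': "0 < e'" using e V by (simp add: e'_def)
    have "continuous (at X) w" using w by (simp add: continuous_on_eq_continuous_at)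
    then obtain d where d: "0 < d" "\<And>Y. dist Y X < d \<Longrightarrow> dist (w Y) (w X) < e'"
      using e' unfolding continuous_at_eps_delta by blast
    define s where "s = min (d / 2) R"
    have s: "0 < s" "s \<le> R" "s < d" using d R by (auto simp: s_def min_def)
    have "\<bar>G s\<bar> \<le> 2 * unit_ball_vol (real CARD('n)) * e'"
      unfolding G_def
    proof (rule heat_average_bound[OF B cw s(1)])
      fix Y assume "Y \<in> cball X s"
      then have "dist Y X < d" using s by (simp add: dist_commute)
      then show "\<bar>w Y - w X\<bar> \<le> e'" using d(2) by (fastforce simp: dist_real_def)
    qed
    also have "\<dots> = e" using V by (simp add: e'_def V_def[symmetric])
    finally show "\<bar>G R\<bar> \<le> M / \<theta> * R powr \<theta> + e" using mono[OF s(1,2)] by linarith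
  qed
  then show ?thesis
    unfolding G_def heat_average_diff_const[OF B w R] .
qed

text \<open>On \<open>cball X (\<delta> * s)\<close> the quadratic form is at most s^2/2, so the
  ellipsoid function is at least 1/2 and the kernel at least exp(-2). The bound depends on
  \<open>B\<close> only through \<open>c\<close>, hence one constant serves all frozen
  points.\<close>

lemma heat_average_one_ge:
  fixes B :: "real^'n::finite^'n"
  assumes B: "quad_form_bounds c B" and s: "0 < s" and \<delta>: "0 \<le> \<delta>" "c * \<delta>\<^sup>2 \<le> 1 / 2"
  shows "exp (-2) * unit_ball_vol (real CARD('n)) * \<delta> ^ CARD('n) \<le> heat_average B X s (\<lambda>Y. 1)"
proof -
  have c: "0 < c" using B by (simp add: quad_form_bounds_def)
  have "exp (-2) * (unit_ball_vol (real CARD('n)) * (\<delta> * s) ^ CARD('n)) \<le> integral\<^sup>L lborel (heat_kernel B X s)"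
  proof (rule integral_ge_cball[where X=X])
    show "integrable lborel (heat_kernel B X s)"
      by (rule integrable_compact_support[OF heat_kernel_continuous compact_cball[of X s]])
         (simp add: heat_kernel_support[OF B s])
    fix Y assume Y: "Y \<in> cball X (\<delta> * s)"
    have "(Y - X) \<bullet> (B *v (Y - X)) \<le> norm (Y - X) * norm (B *v (Y - X))" by (rule norm_cauchy_schwarz)
    also have "\<dots> \<le> norm (Y - X) * (c * norm (Y - X))"
      using B by (intro mult_left_mono) (auto simp: quad_form_bounds_def)
    also have "\<dots> = c * (norm (Y - X))\<^sup>2" by (simp add: power2_eq_square)
    also have "\<dots> \<le> c * (\<delta> * s)\<^sup>2"
      using Y c by (intro mult_left_mono power_mono) (auto simp: dist_norm norm_minus_commute)
    also have "\<dots> = c * \<delta>\<^sup>2 * s\<^sup>2" by (simp add: power_mult_distrib)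
    also have "\<dots> \<le> 1 / 2 * s\<^sup>2" using \<delta> by (intro mult_right_mono) auto
    finally have "1 / 2 \<le> ellipsoid B X s Y" using s by (simp add: ellipsoid_def field_simps)
    then show "exp (-2) \<le> heat_kernel B X s Y"
      unfolding heat_kernel_def by (rule flat_exp_2_lower[OF _ ellipsoid_le_1[OF B]])
  qed (use \<delta> s heat_kernel_nonneg in auto)
  then show ?thesis
    using s by (simp add: heat_average_def pos_le_divide_eq power_mult_distrib mult.assoc)
qed

section \<open>Power decay at a zero\<close>

text \<open>For symmetric \<open>B\<close> the difference is (y - z) . B(y + z) + z . (B - B')z,
  which separates the shift of the centre from the change of the matrix.\<close>

lemma quad_form_diff_bound:
  fixes B B' :: "real^'n::finite^'n"
  assumes sym: "transpose B = B" and bd: "\<And>x. norm (B *v x) \<le> c * norm x"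
    and diff: "\<And>x. norm ((B - B') *v x) \<le> e * norm x"
  shows "\<bar>y \<bullet> (B *v y) - z \<bullet> (B' *v z)\<bar> \<le> c * norm (y - z) * (norm y + norm z) + e * (norm z)\<^sup>2"
proof -
  have "y \<bullet> (B *v y) - z \<bullet> (B' *v z) = (y - z) \<bullet> (B *v (y + z)) + z \<bullet> ((B - B') *v z)"
    using symmetric_matrix_inner[OF sym, of y z]
    by (simp add: matrix_vector_right_distrib matrix_vector_mult_diff_rdistrib inner_simps)
  also have "\<bar>\<dots>\<bar> \<le> \<bar>(y - z) \<bullet> (B *v (y + z))\<bar> + \<bar>z \<bullet> ((B - B') *v z)\<bar>" by (rule abs_triangle_ineq)
  also have "\<dots> \<le> norm (y - z) * norm (B *v (y + z)) + norm z * norm ((B - B') *v z)"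
    by (intro add_mono Cauchy_Schwarz_ineq2)
  also have "\<dots> \<le> norm (y - z) * (c * (norm y + norm z)) + norm z * (e * norm z)"
  proof (intro add_mono mult_left_mono norm_ge_zero diff)
    have "0 \<le> c * norm (axis undefined 1 :: real^'n)" by (rule order_trans[OF norm_ge_zero bd])
    then have "0 \<le> c" by simp
    then have "c * norm (y + z) \<le> c * (norm y + norm z)" by (intro mult_left_mono norm_triangle_ineq)
    with bd[of "y + z"] show "norm (B *v (y + z)) \<le> c * (norm y + norm z)" by linarith
  qed
  finally show ?thesis by (simp add: power2_eq_square mult_ac)
qed

text \<open>\<open>N\<close> bounds the whole family because \<open>H\<close> controls one component
  through all of them. The averages at \<open>X\<close> and \<open>Z\<close> differ for two reasons:
  the displaced centre produces r/R, the changed matrix produces R^\<theta>.\<close>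

lemma vanishing_step:
  fixes B :: "real^'n::finite \<Rightarrow> real^'n^'n" and W :: "'k \<Rightarrow> real^'n \<Rightarrow> real"
  assumes \<theta>: "0 < \<theta>" and M: "0 \<le> M" and L: "0 \<le> L"
    and B: "\<And>X. X \<in> cball Z \<rho> \<Longrightarrow> quad_form_bounds c (B X)"
    and lip: "\<And>X y. X \<in> cball Z \<rho> \<Longrightarrow> norm ((B X - B Z) *v y) \<le> L * dist X Z powr \<theta> * norm y"
    and ds0: "\<And>X s. X \<in> cball Z \<rho> \<Longrightarrow> 0 < s \<Longrightarrow> (\<integral>Y. heat_kernel_ds (B X) X s Y \<partial>lborel) = 0"
    and cont: "\<And>k. continuous_on (cball Z \<rho>) (W k)" and WZ: "\<And>k. W k Z = 0"
    and H: "\<And>k X s N. X \<in> cball Z \<rho> \<Longrightarrow> 0 < s \<Longrightarrow> cball X s \<subseteq> cball Z \<rho> \<Longrightarrow>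
      (\<And>k Y. Y \<in> cball X s \<Longrightarrow> \<bar>W k Y\<bar> \<le> N) \<Longrightarrow>
      \<bar>\<integral>Y. W k Y * heat_kernel_ds (B X) X s Y \<partial>lborel\<bar> \<le> M * N * s powr \<theta> * s ^ CARD('n)"
  shows "\<exists>C>0. \<forall>r R N k X. 0 < r \<longrightarrow> r \<le> R \<longrightarrow> 2 * R \<le> \<rho> \<longrightarrow>
    (\<forall>k. \<forall>Y\<in>cball Z (2 * R). \<bar>W k Y\<bar> \<le> N) \<longrightarrow> X \<in> cball Z r \<longrightarrow>
    \<bar>W k X\<bar> \<le> C * (R powr \<theta> + r / R) * N"
proof (cases "0 < \<rho>")
  case False
  \<comment> \<open>No \<open>r\<close> and \<open>R\<close> with 0 < r \<le> R and 2 R \<le> \<rho>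
    exist here, so any positive constant will do.\<close>
  then show ?thesis by (intro exI[of _ 1]) auto
next
  case True
  define n where "n = CARD('n)"
  define V where "V = unit_ball_vol (real n)"
  have V: "0 < V" by (simp add: V_def)
  have c: "0 < c" using B[of Z] True by (simp add: quad_form_bounds_def)
  define \<delta> where "\<delta> = sqrt (1 / (2 * c))"
  have \<delta>: "0 < \<delta>" "c * \<delta>\<^sup>2 \<le> 1 / 2" using c by (simp_all add: \<delta>_def)
  define m where "m = exp (-2) * V * \<delta> ^ n"
  have m: "0 < m" using V \<delta> by (simp add: m_def)
  \<comment> \<open>36 is the Lipschitz constant of the kernel profile; \<open>2 ^ n * V\<close> is
    the volume of a ball of radius 2R divided by R^n.\<close>
  define K where "K = 36 * 2 ^ n * V"
  have K: "0 < K" using V by (simp add: K_def)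
  define C where "C = (2 * M / \<theta> + K * (5 * c + 4 * L)) / m"
  have C: "0 < C" using m K M \<theta> c L
    by (simp add: C_def add_nonneg_pos)
  show ?thesis
  proof (intro exI[of _ C] conjI C allI impI)
    fix r R N k X
    assume r: "0 < r" "r \<le> R" and R2: "2 * R \<le> \<rho>"
      and N: "\<forall>k. \<forall>Y\<in>cball Z (2 * R). \<bar>W k Y\<bar> \<le> N" and X: "X \<in> cball Z r"
    have R: "0 < R" using r by simp
    have dXZ: "dist X Z \<le> r" using X by (simp add: dist_commute)
    have sub: "cball X R \<subseteq> cball Z (2 * R)"
    proof
      fix Y assume "Y \<in> cball X R"
      then show "Y \<in> cball Z (2 * R)"
        using dXZ r dist_triangle[of Z Y X] by (simp add: dist_commute)
    qed
    have sub2: "cball Z (2 * R) \<subseteq> cball Z \<rho>" using R2 by (rule subset_cball)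
    have X\<rho>: "X \<in> cball Z \<rho>" and Z\<rho>: "Z \<in> cball Z \<rho>" using X r R2 True by auto
    have N0: "0 \<le> N" using N[rule_format, of Z k] R by (simp add: WZ)
    \<comment> \<open>The averages need a function continuous on the whole space; only its values on the ball matter.\<close>
    define w where "w = (\<lambda>Y. W k (closest_point (cball Z (2 * R)) Y))"
    have w: "continuous_on UNIV w"
      unfolding w_def
      by (intro continuous_on_compose2[OF continuous_on_subset[OF cont sub2]] continuous_on_closest_point)
         (use R in \<open>auto intro!: closest_point_in_set\<close>)
    have w_eq: "w Y = W k Y" if "Y \<in> cball Z (2 * R)" for Y
      unfolding w_def using that by (simp only: closest_point_self)
    have dev: "\<bar>heat_average (B P) P R w - w P * heat_average (B P) P R (\<lambda>Y. 1)\<bar> \<le> M * N / \<theta> * R powr \<theta>"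
      if P: "P \<in> cball Z \<rho>" and PR: "cball P R \<subseteq> cball Z (2 * R)" for P
    proof (rule heat_average_deviation[OF B[OF P] w R \<theta> ds0[OF P]])
      fix s assume s: "0 < s" "s \<le> R"
      have sub3: "cball P s \<subseteq> cball Z (2 * R)" using PR s subset_cball[OF s(2)] by blast
      have "(\<lambda>Y. w Y * heat_kernel_ds (B P) P s Y) = (\<lambda>Y. W k Y * heat_kernel_ds (B P) P s Y)"
        using heat_kernel_ds_support[OF B[OF P] s(1)] w_eq sub3 by fastforce
      then show "\<bar>\<integral>Y. w Y * heat_kernel_ds (B P) P s Y \<partial>lborel\<bar> \<le> M * N * s powr \<theta> * s ^ CARD('n)"
        using H[OF P s(1) subset_trans[OF sub3 sub2], of N k] sub3 N by (simp add: subset_iff)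
    qed
    have devX: "\<bar>heat_average (B X) X R w - W k X * heat_average (B X) X R (\<lambda>Y. 1)\<bar> \<le> M * N / \<theta> * R powr \<theta>"
      using dev[OF X\<rho> sub] w_eq[of X] sub R by (simp add: subset_iff)
    have devZ: "\<bar>heat_average (B Z) Z R w\<bar> \<le> M * N / \<theta> * R powr \<theta>"
      using dev[OF Z\<rho>] w_eq[of Z] R by (simp add: WZ subset_cball)
    have cmp: "\<bar>heat_average (B X) X R w - heat_average (B Z) Z R w\<bar> \<le> K * (5 * c * (r / R) + 4 * L * R powr \<theta>) * N"
    proof -
      define E where "E = 5 * c * (r / R) + 4 * L * R powr \<theta>"
      have E: "0 \<le> E" using c r R L by (simp add: E_def)
      let ?f = "\<lambda>P Y. w Y * heat_kernel (B P) P R Y"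
      have cf: "continuous_on UNIV (?f P)" for P
        by (intro continuous_on_mult w heat_kernel_continuous)
      have zf: "?f P Y = 0" if "P \<in> {X, Z}" "Y \<notin> cball Z (2 * R)" for P Y
      proof -
        have "cball P R \<subseteq> cball Z (2 * R)" using that(1) sub R by (auto simp: subset_cball)
        then have "Y \<notin> cball P R" using that(2) by blast
        moreover have "quad_form_bounds c (B P)" using that(1) B X\<rho> Z\<rho> by auto
        ultimately show ?thesis using heat_kernel_support[of c "B P" R Y P] R by simp
      qed
      have "\<bar>\<integral>Y. ?f X Y - ?f Z Y \<partial>lborel\<bar> \<le> N * (36 * E) * (unit_ball_vol (real CARD('n)) * (2 * R) ^ CARD('n))"
      proof (rule integral_abs_le_cball)
        show "continuous_on UNIV (\<lambda>Y. ?f X Y - ?f Z Y)" by (intro continuous_on_diff cf)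
        show "?f X Y - ?f Z Y = 0" if "Y \<notin> cball Z (2 * R)" for Y
          unfolding zf[of X Y, OF insertI1 that] zf[of Z Y, OF insertI2[OF insertI1] that] by simp
        show "\<bar>?f X Y - ?f Z Y\<bar> \<le> N * (36 * E)" if Y: "Y \<in> cball Z (2 * R)" for Y
        proof -
          define y z where "y = Y - X" and "z = Y - Z"
          have nz: "norm z \<le> 2 * R" using Y by (simp add: z_def dist_norm norm_minus_commute)
          have nyz: "norm (y - z) \<le> r" using dXZ by (simp add: y_def z_def dist_norm norm_minus_commute)
          have ny: "norm y \<le> 3 * R" using nz nyz r norm_triangle_ineq[of "y - z" z] by simp
          have "\<bar>y \<bullet> (B X *v y) - z \<bullet> (B Z *v z)\<bar>
              \<le> c * norm (y - z) * (norm y + norm z) + (L * dist X Z powr \<theta>) * (norm z)\<^sup>2"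
            using B[OF X\<rho>] lip[OF X\<rho>] by (intro quad_form_diff_bound) (auto simp: quad_form_bounds_def)
          \<comment> \<open>The constants of \<open>E\<close> originate here: 5 from norm y \<le> 3R
            and norm z \<le> 2R, and 4 from (2R)^2.\<close>
          also have "\<dots> \<le> c * r * (3 * R + 2 * R) + (L * R powr \<theta>) * (2 * R)\<^sup>2"
            using nz nyz ny c L R dXZ r \<theta> 
            by (intro add_mono mult_mono power_mono powr_mono2) auto
          also have "\<dots> = E * R\<^sup>2" using R by (simp add: E_def power2_eq_square field_simps)
          finally have "\<bar>y \<bullet> (B X *v y) - z \<bullet> (B Z *v z)\<bar> / R\<^sup>2 \<le> E"
            using R by (simp add: divide_le_eq)
          moreover have "ellipsoid (B X) X R Y - ellipsoid (B Z) Z R Y = - ((y \<bullet> (B X *v y) - z \<bullet> (B Z *v z)) / R\<^sup>2)"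
            by (simp add: ellipsoid_def y_def z_def diff_divide_distrib)
          ultimately have "\<bar>ellipsoid (B X) X R Y - ellipsoid (B Z) Z R Y\<bar> \<le> E" by (simp add: abs_divide)
          then have "\<bar>heat_kernel (B X) X R Y - heat_kernel (B Z) Z R Y\<bar> \<le> 36 * E"
            unfolding heat_kernel_def by (intro order_trans[OF flat_exp_2_lipschitz]) simp
          then have "\<bar>w Y * (heat_kernel (B X) X R Y - heat_kernel (B Z) Z R Y)\<bar> \<le> N * (36 * E)"
            unfolding abs_mult using N Y w_eq[OF Y] N0 by (intro mult_mono) auto
          then show ?thesis by (simp add: right_diff_distrib)
        qed
      qed (use R in auto)
      moreover have "(\<integral>Y. ?f X Y - ?f Z Y \<partial>lborel) = R ^ n * (heat_average (B X) X R w - heat_average (B Z) Z R w)"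
      proof -
        have "integrable lborel (?f X)" "integrable lborel (?f Z)"
          using zf by (auto intro!: integrable_compact_support[OF cf compact_cball[of Z "2 * R"]])
        then show ?thesis using R by (simp add: heat_average_def n_def right_diff_distrib)
      qed
      ultimately have "R ^ n * \<bar>heat_average (B X) X R w - heat_average (B Z) Z R w\<bar>
          \<le> R ^ n * (K * E * N)"
        using R by (simp add: abs_mult K_def V_def n_def power_mult_distrib mult_ac)
      then show ?thesis using R by (simp add: E_def)
    qed
    have mX: "m \<le> heat_average (B X) X R (\<lambda>Y. 1)"
      using heat_average_one_ge[OF B[OF X\<rho>] R _ \<delta>(2), of X] \<delta>(1) by (simp add: m_def V_def n_def)
    \<comment> \<open>The averages are not normalised; the uniform lower bound \<open>m\<close> for
      the average of 1 is what allows \<open>W k X\<close> itself to be recovered.\<close>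
    have "m * \<bar>W k X\<bar> \<le> \<bar>W k X * heat_average (B X) X R (\<lambda>Y. 1)\<bar>"
      using mult_right_mono[OF mX, of "\<bar>W k X\<bar>"] mX m by (simp add: abs_mult mult.commute)
    also have "\<dots> \<le> 2 * (M * N / \<theta> * R powr \<theta>) + K * (5 * c * (r / R) + 4 * L * R powr \<theta>) * N"
      using devX devZ cmp by linarith
    also have "\<dots> \<le> (2 * M / \<theta> + K * (5 * c + 4 * L)) * (R powr \<theta> + r / R) * N"
    proof -
      have "K * (5 * c * (r / R) + 4 * L * R powr \<theta>) \<le> K * ((5 * c + 4 * L) * (R powr \<theta> + r / R))"
        using K c L r R by (intro mult_left_mono) (auto simp: algebra_simps)
      moreover have "2 * M / \<theta> * R powr \<theta> \<le> 2 * M / \<theta> * (R powr \<theta> + r / R)"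
        using M \<theta> r R by (intro mult_left_mono) auto
      ultimately have "(2 * M / \<theta> * R powr \<theta> + K * (5 * c * (r / R) + 4 * L * R powr \<theta>)) * N
          \<le> (2 * M / \<theta> * (R powr \<theta> + r / R) + K * ((5 * c + 4 * L) * (R powr \<theta> + r / R))) * N"
        using N0 by (intro mult_right_mono add_mono)
      then show ?thesis by (simp add: algebra_simps)
    qed
    finally show "\<bar>W k X\<bar> \<le> C * (R powr \<theta> + r / R) * N"
      using m by (simp add: C_def field_simps)
  qed
qed

text \<open>Geometric iteration: shrinking the radius by \<mu> shrinks the bound by \<mu>^\<alpha>.
  With r/R = 2 \<mu> the factor in \<open>step\<close> is C R^\<theta> + 2 C \<mu>, and each summand
  has to be at most half of \<mu>^\<alpha>. For the second summand a small \<mu> achieves this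
  because \<alpha> < 1; the first is handled by a small starting radius.\<close>

lemma power_decay_of_step:
  fixes W :: "'k \<Rightarrow> 'a::metric_space \<Rightarrow> real"
  assumes \<alpha>: "0 < \<alpha>" "\<alpha> < 1" and \<theta>: "0 < \<theta>" and \<rho>: "0 < \<rho>" and C: "0 < C"
    and bound: "\<And>k Y. Y \<in> cball Z \<rho> \<Longrightarrow> \<bar>W k Y\<bar> \<le> N0"
    and WZ: "\<And>k. W k Z = 0"
    and step: "\<And>r R N k X. 0 < r \<Longrightarrow> r \<le> R \<Longrightarrow> 2 * R \<le> \<rho> \<Longrightarrow>
      (\<And>k Y. Y \<in> cball Z (2 * R) \<Longrightarrow> \<bar>W k Y\<bar> \<le> N) \<Longrightarrow> X \<in> cball Z r \<Longrightarrow>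
      \<bar>W k X\<bar> \<le> C * (R powr \<theta> + r / R) * N"
  shows "\<exists>r0 K. 0 < r0 \<and> r0 \<le> \<rho> \<and> 0 < K \<and> (\<forall>k. \<forall>X\<in>cball Z r0. \<bar>W k X\<bar> \<le> K * dist X Z powr \<alpha>)"
proof -
  have N0: "0 \<le> N0" using bound[of Z] \<rho> by (force simp: WZ)
  \<comment> \<open>The second argument of \<open>min\<close> solves 4 C \<mu> = \<mu>^\<alpha>; the
    cap 1/2 ensures r \<le> R for r = 2 \<mu> R.\<close>
  define \<mu> where "\<mu> = min (1 / 2) ((1 / (4 * C)) powr (1 / (1 - \<alpha>)))"
  have \<mu>: "0 < \<mu>" "\<mu> \<le> 1 / 2" using C by (auto simp: \<mu>_def)
  have \<mu>C: "4 * C * \<mu> \<le> \<mu> powr \<alpha>"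
  proof -
    have "\<mu> powr (1 - \<alpha>) \<le> ((1 / (4 * C)) powr (1 / (1 - \<alpha>))) powr (1 - \<alpha>)"
      using \<mu> \<alpha> by (intro powr_mono2) (auto simp: \<mu>_def)
    also have "\<dots> = 1 / (4 * C)" using \<alpha> C by (simp add: powr_powr)
    finally have "\<mu> powr (1 - \<alpha>) \<le> 1 / (4 * C)" .
    then show ?thesis using \<mu> C by (simp add: powr_diff field_simps)
  qed
  \<comment> \<open>Makes C R0^\<theta> at most \<mu>^\<alpha> / 2, and the inequality persists at
    all smaller radii.\<close>
  define R0 where "R0 = min \<rho> ((\<mu> powr \<alpha> / (2 * C)) powr (1 / \<theta>))"
  have R0: "0 < R0" "R0 \<le> \<rho>" using \<mu> C \<rho> by (auto simp: R0_def)
  have R0C: "C * R0 powr \<theta> \<le> \<mu> powr \<alpha> / 2"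
  proof -
    have "R0 powr \<theta> \<le> ((\<mu> powr \<alpha> / (2 * C)) powr (1 / \<theta>)) powr \<theta>"
      using R0 \<theta> by (intro powr_mono2) (auto simp: R0_def)
    also have "\<dots> = \<mu> powr \<alpha> / (2 * C)" using \<theta> C \<mu> by (simp add: powr_powr)
    finally show ?thesis using C by (simp add: field_simps)
  qed
  have iter: "\<bar>W k Y\<bar> \<le> N0 * (\<mu> powr \<alpha>) ^ j" if "Y \<in> cball Z (R0 * \<mu> ^ j)" for j k Y
    using that
  proof (induction j arbitrary: k Y)
    case 0
    then show ?case using R0(2) by (intro order_trans[OF bound]) auto
  next
    case (Suc j)
    \<comment> \<open>Half the current radius, because \<open>step\<close> asks for a bound on the
      ball of radius 2R.\<close>
    define R where "R = R0 * \<mu> ^ j / 2"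
    have \<mu>j: "0 < \<mu> ^ j" "\<mu> ^ j \<le> 1" using \<mu> by (auto simp: power_le_one)
    have R: "0 < R" "R \<le> R0"
      using R0 \<mu>j mult_left_mono[OF \<mu>j(2), of R0] by (auto simp: R_def)
    have R_2: "2 * R = R0 * \<mu> ^ j" by (simp add: R_def)
    have "\<bar>W k Y\<bar> \<le> C * (R powr \<theta> + (R0 * \<mu> ^ Suc j) / R) * (N0 * (\<mu> powr \<alpha>) ^ j)"
    proof (rule step)
      show "R0 * \<mu> ^ Suc j \<le> R"
        using mult_left_mono[OF \<mu>(2), of "R0 * \<mu> ^ j"] R0 \<mu>j by (simp add: R_def mult_ac)
      have "R0 * \<mu> ^ j \<le> R0 * 1" using R0 \<mu>j by (intro mult_left_mono) auto
      then show "2 * R \<le> \<rho>" using R0(2) unfolding R_2 by linarith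
      show "\<bar>W k Y\<bar> \<le> N0 * (\<mu> powr \<alpha>) ^ j" if "Y \<in> cball Z (2 * R)" for k Y
        using Suc.IH that unfolding R_2 .
    qed (use R0 \<mu> Suc.prems in auto)
    also have "\<dots> \<le> \<mu> powr \<alpha> * (N0 * (\<mu> powr \<alpha>) ^ j)"
    proof (rule mult_right_mono)
      have "(R0 * \<mu> ^ Suc j) / R = 2 * \<mu>" using R0 \<mu> by (simp add: R_def)
      moreover have "C * R powr \<theta> \<le> C * R0 powr \<theta>" using R C \<theta> by (intro mult_left_mono powr_mono2) auto
      ultimately show "C * (R powr \<theta> + (R0 * \<mu> ^ Suc j) / R) \<le> \<mu> powr \<alpha>"
        using R0C \<mu>C by (simp add: distrib_left)
    qed (use N0 in auto)
    finally show ?case by (simp add: mult_ac)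
  qed
  \<comment> \<open>The power of \<open>\<mu> * R0\<close> accounts for the starting radius and for
    rounding a distance to the geometric scale; the summand 1 keeps \<open>K\<close> positive when
    \<open>N0 = 0\<close>.\<close>
  define K where "K = N0 / (\<mu> * R0) powr \<alpha> + 1"
  have K: "0 < K" using N0 by (auto simp: K_def intro: add_nonneg_pos)
  show ?thesis
  proof (rule exI[of _ R0], rule exI[of _ K], intro conjI R0 K allI ballI)
    fix k X assume X: "X \<in> cball Z R0"
    show "\<bar>W k X\<bar> \<le> K * dist X Z powr \<alpha>"
    proof (cases "X = Z")
      case False
      define d where "d = dist X Z"
      have d: "0 < d" "d \<le> R0" using False X by (auto simp: d_def dist_commute)
      have "\<exists>j. R0 * \<mu> ^ Suc j < d"
      proof -
        obtain j where "\<mu> ^ j < d / R0"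
          using real_arch_pow_inv[of "d / R0" \<mu>] d R0 \<mu> by auto
        then have "R0 * \<mu> ^ j < d" using R0 by (simp add: field_simps)
        moreover have "R0 * \<mu> ^ Suc j \<le> R0 * \<mu> ^ j" using R0 \<mu> by (intro mult_left_mono power_decreasing) auto
        ultimately show ?thesis by (intro exI[of _ j]) simp
      qed
      \<comment> \<open>Places \<open>d\<close> between two scales, R0 \<mu>^(j+1) < d \<le> R0
        \<mu>^j: the upper bound admits \<open>iter\<close>, the lower one replaces \<mu>^(j+1) by
        d/R0.\<close>
      define j where "j = (LEAST j. R0 * \<mu> ^ Suc j < d)"
      have j1: "R0 * \<mu> ^ Suc j < d" unfolding j_def using \<open>\<exists>j. _\<close> by (rule LeastI_ex)
      have j2: "d \<le> R0 * \<mu> ^ j"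
      proof (cases j)
        case (Suc i)
        then have "\<not> R0 * \<mu> ^ Suc i < d" unfolding j_def by (intro not_less_Least) (simp add: j_def)
        then show ?thesis using Suc by simp
      qed (use d in simp)
      have "\<bar>W k X\<bar> \<le> N0 * (\<mu> powr \<alpha>) ^ j"
        using j2 by (intro iter) (simp add: d_def dist_commute)
      also have "(\<mu> powr \<alpha>) ^ j = (\<mu> ^ Suc j) powr \<alpha> / \<mu> powr \<alpha>"
        using \<mu> by (simp add: powr_mult powr_power powr_realpow[symmetric] powr_powr mult.commute)
      also have "N0 * ((\<mu> ^ Suc j) powr \<alpha> / \<mu> powr \<alpha>) \<le> N0 * ((d / R0) powr \<alpha> / \<mu> powr \<alpha>)"
        using j1 R0 \<mu> \<alpha> N0 by (intro mult_left_mono divide_right_mono powr_mono2) (auto simp: field_simps)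
      also have "\<dots> = N0 / (\<mu> * R0) powr \<alpha> * d powr \<alpha>"
        using R0 \<mu> d by (simp add: powr_mult powr_divide)
      also have "\<dots> \<le> K * d powr \<alpha>" by (intro mult_right_mono) (auto simp: K_def)
      finally show ?thesis by (simp add: d_def)
    qed (simp add: WZ)
  qed
qed

section \<open>Freezing the coefficients\<close>

lemma matrix_norm_le_entries:
  fixes M :: "real^'n::finite^'n"
  assumes "\<And>i j. \<bar>M $ i $ j\<bar> \<le> e"
  shows "norm (M *v y) \<le> (real CARD('n))\<^sup>2 * e * norm y"
proof -
  have "norm (M *v y) \<le> (\<Sum>i\<in>UNIV. \<bar>(M *v y) $ i\<bar>)" by (rule norm_le_l1_cart)
  also have "\<dots> \<le> (\<Sum>i\<in>(UNIV::'n set). \<Sum>j\<in>(UNIV::'n set). e * norm y)"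
    unfolding matrix_vector_mult_def vec_lambda_beta
    by (intro sum_mono order_trans[OF sum_abs])
       (auto simp: abs_mult intro!: mult_mono assms component_le_norm_cart order_trans[OF abs_ge_zero assms])
  finally show ?thesis by (simp add: power2_eq_square mult_ac)
qed

text \<open>Coercivity and Cauchy-Schwarz give \<open>lam * norm x \<le> norm (A *v x)\<close>,
  hence injectivity. The lower bound for the inverse comes from inserting Bx into the form of
  \<open>A\<close>: x . Bx = Bx . A(Bx) \<ge> lam |Bx|^2 \<ge> lam |x|^2 / K^2.\<close>

lemma elliptic_inverse:
  fixes A :: "real^'n::finite^'n"
  assumes lam: "0 < lam" and K: "0 < K" and sym: "transpose A = A"
    and ell: "\<And>x. lam * (norm x)\<^sup>2 \<le> x \<bullet> (A *v x)" and bd: "\<And>x. norm (A *v x) \<le> K * norm x"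
  shows "\<exists>B. A ** B = mat 1 \<and> B ** A = mat 1 \<and> transpose B = B \<and>
    (\<forall>x. norm (B *v x) \<le> norm x / lam) \<and> (\<forall>x. lam / K\<^sup>2 * (norm x)\<^sup>2 \<le> x \<bullet> (B *v x))"
proof -
  have low: "lam * norm x \<le> norm (A *v x)" for x
  proof (cases "x = 0")
    case False
    have "lam * norm x * norm x \<le> norm (A *v x) * norm x"
      using ell[of x] norm_cauchy_schwarz[of x "A *v x"] by (simp add: power2_eq_square mult_ac)
    then show ?thesis using False by simp
  qed simp
  have "x = 0" if "A *v x = 0" for x
    using low[of x] that lam by (simp add: mult_le_0_iff)
  then obtain B where BA: "B ** A = mat 1"
    using matrix_left_invertible_ker[of A] by blast
  have AB: "A ** B = mat 1" using BA matrix_left_right_inverse by blast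
  have ABx: "A *v (B *v x) = x" for x by (simp add: matrix_vector_mul_assoc AB)
  have "transpose B = transpose B ** (A ** B)" by (simp add: AB)
  also have "\<dots> = transpose (A ** B) ** B" by (simp add: matrix_transpose_mul sym matrix_mul_assoc)
  finally have tB: "transpose B = B" by (simp add: AB)
  have "norm (B *v x) \<le> norm x / lam" for x
    using low[of "B *v x"] lam by (simp add: ABx field_simps)
  moreover have "lam / K\<^sup>2 * (norm x)\<^sup>2 \<le> x \<bullet> (B *v x)" for x
  proof -
    have "norm x / K \<le> norm (B *v x)" using bd[of "B *v x"] K by (simp add: ABx field_simps)
    then have "lam * (norm x / K)\<^sup>2 \<le> lam * (norm (B *v x))\<^sup>2"
      using K lam by (intro mult_left_mono power_mono) auto
    also have "\<dots> \<le> (B *v x) \<bullet> x" using ell[of "B *v x"] by (simp add: ABx)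
    finally show ?thesis by (simp add: power_divide inner_commute)
  qed
  ultimately show ?thesis using AB BA tB by blast
qed

text \<open>\<open>B X\<close> is \<beta> times the inverse coefficient matrix, where \<beta> =
  K^2/lam does not depend on \<open>X\<close> and lifts the lower bound lam/K^2 of the inverse to
  the 1 in \<open>quad_form_bounds\<close>. Hoelder continuity passes to inverses by A(X)^-1 -
  A(Z)^-1 = A(X)^-1 (A(Z) - A(X)) A(Z)^-1.\<close>

lemma frozen_inverses:
  fixes a :: "'n::finite \<Rightarrow> 'n \<Rightarrow> real^'n \<Rightarrow> real"
  assumes lam: "0 < lam"
    and holder: "\<And>i j. holder_on \<theta> S (a i j)"
    and sym: "\<And>i j X. X \<in> S \<Longrightarrow> a i j X = a j i X"
    and ellip: "\<And>X \<xi>. X \<in> S \<Longrightarrow>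
        lam * (norm \<xi>)\<^sup>2 \<le> (\<Sum>i\<in>UNIV. \<Sum>j\<in>UNIV. a i j X * \<xi> $ i * \<xi> $ j)"
  obtains B :: "real^'n \<Rightarrow> real^'n^'n" and \<beta> c L where
    "0 < \<beta>" "0 \<le> L" "\<And>X. X \<in> S \<Longrightarrow> quad_form_bounds c (B X)"
    "\<And>X. X \<in> S \<Longrightarrow> (\<chi> i j. a i j X) ** B X = mat \<beta>"
    "\<And>X Z y. X \<in> S \<Longrightarrow> Z \<in> S \<Longrightarrow> norm ((B X - B Z) *v y) \<le> L * dist X Z powr \<theta> * norm y"
    "\<And>i j X Y. X \<in> S \<Longrightarrow> Y \<in> S \<Longrightarrow> \<bar>a i j X - a i j Y\<bar> \<le> L * dist X Y powr \<theta>"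
proof -
  define n where "n = real CARD('n)"
  have n: "0 < n" by (simp add: n_def)
  define A where "A X = (\<chi> i j. a i j X)" for X
  have A_nth: "A X $ i $ j = a i j X" for X i j by (simp add: A_def)
  have "\<exists>Ka. \<forall>i j. \<forall>X\<in>S. \<bar>a i j X\<bar> \<le> Ka"
  proof -
    have "\<forall>i j. \<exists>k. \<forall>X\<in>S. \<bar>a i j X\<bar> \<le> k"
      using holder by (auto simp: holder_on_def bounded_iff)
    then obtain k where k: "\<And>i j X. X \<in> S \<Longrightarrow> \<bar>a i j X\<bar> \<le> k i j" by metis
    have "\<bar>a i j X\<bar> \<le> (\<Sum>i\<in>UNIV. \<Sum>j\<in>UNIV. \<bar>k i j\<bar>)" if "X \<in> S" for i j X
    proof -
      have "\<bar>a i j X\<bar> \<le> \<bar>k i j\<bar>" using k[OF that, of i j] by simp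
      also have "\<dots> \<le> (\<Sum>j\<in>UNIV. \<bar>k i j\<bar>)" by (rule member_le_sum) auto
      also have "\<dots> \<le> (\<Sum>i\<in>UNIV. \<Sum>j\<in>UNIV. \<bar>k i j\<bar>)"
        by (rule member_le_sum[where f="\<lambda>i. \<Sum>j\<in>UNIV. \<bar>k i j\<bar>"]) (auto intro: sum_nonneg)
      finally show ?thesis .
    qed
    then show ?thesis by blast
  qed
  then obtain Ka where Ka: "\<And>i j X. X \<in> S \<Longrightarrow> \<bar>a i j X\<bar> \<le> Ka" by blast
  have "\<exists>Ca\<ge>0. \<forall>i j. \<forall>X\<in>S. \<forall>Y\<in>S. \<bar>a i j X - a i j Y\<bar> \<le> Ca * dist X Y powr \<theta>"
  proof -
    obtain k where k: "\<And>i j X Y. X \<in> S \<Longrightarrow> Y \<in> S \<Longrightarrow> \<bar>a i j X - a i j Y\<bar> \<le> k i j * dist X Y powr \<theta>"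
      using holder unfolding holder_on_def by metis
    \<comment> \<open>The constants in \<open>holder_on\<close> carry no sign; summing absolute
      values gives one nonnegative constant for all entries.\<close>
    define Ca where "Ca = (\<Sum>i\<in>UNIV. \<Sum>j\<in>UNIV. \<bar>k i j\<bar>)"
    have "\<bar>a i j X - a i j Y\<bar> \<le> Ca * dist X Y powr \<theta>" if "X \<in> S" "Y \<in> S" for i j X Y
    proof -
      have "\<bar>k i j\<bar> \<le> (\<Sum>j\<in>UNIV. \<bar>k i j\<bar>)" by (rule member_le_sum) auto
      also have "\<dots> \<le> Ca"
        unfolding Ca_def by (rule member_le_sum[where f="\<lambda>i. \<Sum>j\<in>UNIV. \<bar>k i j\<bar>"]) (auto intro: sum_nonneg)
      finally have "k i j * dist X Y powr \<theta> \<le> Ca * dist X Y powr \<theta>" by (intro mult_right_mono) auto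
      then show ?thesis using k[OF that, of i j] by linarith
    qed
    moreover have "0 \<le> Ca" by (simp add: Ca_def sum_nonneg)
    ultimately show ?thesis by blast
  qed
  then obtain Ca where Ca: "0 \<le> Ca"
    "\<And>i j X Y. X \<in> S \<Longrightarrow> Y \<in> S \<Longrightarrow> \<bar>a i j X - a i j Y\<bar> \<le> Ca * dist X Y powr \<theta>" by blast
  define K where "K = n\<^sup>2 * \<bar>Ka\<bar> + 1"
  have K: "0 < K" unfolding K_def by (intro add_nonneg_pos) auto
  have "\<exists>B. A X ** B = mat 1 \<and> B ** A X = mat 1 \<and> transpose B = B \<and>
    (\<forall>x. norm (B *v x) \<le> norm x / lam) \<and> (\<forall>x. lam / K\<^sup>2 * (norm x)\<^sup>2 \<le> x \<bullet> (B *v x))"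
    if X: "X \<in> S" for X
  proof (rule elliptic_inverse[OF lam K])
    show "transpose (A X) = A X" using sym[OF X] by (simp add: vec_eq_iff transpose_def A_nth)
    show "lam * (norm x)\<^sup>2 \<le> x \<bullet> (A X *v x)" for x
      using ellip[OF X, of x] by (simp add: inner_vec_def matrix_vector_mult_def A_nth sum_distrib_left mult_ac)
    show "norm (A X *v x) \<le> K * norm x" for x
    proof -
      have "norm (A X *v x) \<le> (real CARD('n))\<^sup>2 * \<bar>Ka\<bar> * norm x"
        by (rule matrix_norm_le_entries) (use Ka[OF X] abs_ge_self[of Ka] in \<open>auto simp: A_nth intro: order_trans simp del: abs_ge_self\<close>)
      also have "\<dots> \<le> K * norm x" by (intro mult_right_mono) (auto simp: K_def n_def)
      finally show ?thesis .
    qed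
  qed
  then obtain B0 where B0: "\<And>X. X \<in> S \<Longrightarrow> A X ** B0 X = mat 1" "\<And>X. X \<in> S \<Longrightarrow> B0 X ** A X = mat 1"
    "\<And>X. X \<in> S \<Longrightarrow> transpose (B0 X) = B0 X"
    "\<And>X x. X \<in> S \<Longrightarrow> norm (B0 X *v x) \<le> norm x / lam"
    "\<And>X x. X \<in> S \<Longrightarrow> lam / K\<^sup>2 * (norm x)\<^sup>2 \<le> x \<bullet> (B0 X *v x)"
    by metis
  define \<beta> where "\<beta> = K\<^sup>2 / lam"
  have \<beta>: "0 < \<beta>" using K lam by (simp add: \<beta>_def)
  define B where "B X = \<beta> *\<^sub>R B0 X" for X
  have Bv: "B X *v y = \<beta> *\<^sub>R (B0 X *v y)" for X y
    by (simp add: B_def scaleR_matrix_vector_assoc)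
  define L where "L = max Ca (\<beta> * (1 / lam * (n\<^sup>2 * Ca * (1 / lam))))"
  show thesis
  proof (rule that[of \<beta> L "\<beta> / lam" B])
    show "0 < \<beta>" by (rule \<beta>)
    show "0 \<le> L" using Ca by (simp add: L_def)
    show "quad_form_bounds (\<beta> / lam) (B X)" if X: "X \<in> S" for X
      unfolding quad_form_bounds_def Bv
    proof (intro conjI allI)
      show "0 < \<beta> / lam" using \<beta> lam by simp
      show "transpose (B X) = B X" by (simp add: B_def transpose_scalar B0(3)[OF X])
      show "(norm x)\<^sup>2 \<le> x \<bullet> (\<beta> *\<^sub>R (B0 X *v x))" for x
        using mult_left_mono[OF B0(5)[OF X, of x], of \<beta>] \<beta> lam K by (simp add: \<beta>_def)
      show "norm (\<beta> *\<^sub>R (B0 X *v x)) \<le> \<beta> / lam * norm x" for x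
        using mult_left_mono[OF B0(4)[OF X, of x], of \<beta>] \<beta> by simp
    qed
    show "(\<chi> i j. a i j X) ** B X = mat \<beta>" if X: "X \<in> S" for X
      unfolding A_def[symmetric] B_def matrix_scalar_ac scalar_matrix_assoc[symmetric] B0(1)[OF X]
      by (simp add: vec_eq_iff mat_def)
    show "\<bar>a i j X - a i j Y\<bar> \<le> L * dist X Y powr \<theta>" if "X \<in> S" "Y \<in> S" for i j X Y
    proof -
      have "Ca * dist X Y powr \<theta> \<le> L * dist X Y powr \<theta>"
        by (intro mult_right_mono) (auto simp: L_def)
      then show ?thesis using Ca(2)[OF that, of i j] by linarith
    qed
    show "norm ((B X - B Z) *v y) \<le> L * dist X Z powr \<theta> * norm y" if X: "X \<in> S" and Z: "Z \<in> S" for X Z y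
    proof -
      define p where "p = B0 Z *v y"
      have y: "y = A Z *v p" by (simp add: p_def matrix_vector_mul_assoc B0(1)[OF Z])
      have p: "p = B0 X *v (A X *v p)" by (simp add: matrix_vector_mul_assoc B0(2)[OF X])
      have "(B X - B Z) *v y = \<beta> *\<^sub>R (B0 X *v y - p)"
        by (simp add: matrix_vector_mult_diff_rdistrib Bv p_def scaleR_diff_right)
      also have "B0 X *v y - p = B0 X *v ((A Z - A X) *v p)"
        unfolding matrix_vector_mult_diff_rdistrib matrix_vector_mult_diff_distrib p[symmetric] y[symmetric] ..
      finally have "norm ((B X - B Z) *v y) = \<beta> * norm (B0 X *v ((A Z - A X) *v p))"
        using \<beta> by simp
      also have "\<dots> \<le> \<beta> * (1 / lam * (n\<^sup>2 * (Ca * dist X Z powr \<theta>) * (1 / lam * norm y)))"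
      proof (rule mult_left_mono)
        have "norm (B0 X *v ((A Z - A X) *v p)) \<le> 1 / lam * norm ((A Z - A X) *v p)"
          using B0(4)[OF X] by simp
        also have "\<dots> \<le> 1 / lam * (n\<^sup>2 * (Ca * dist X Z powr \<theta>) * norm p)"
          unfolding n_def using Ca(2)[OF Z X] lam
          by (intro mult_left_mono matrix_norm_le_entries) (auto simp: A_nth dist_commute)
        also have "\<dots> \<le> 1 / lam * (n\<^sup>2 * (Ca * dist X Z powr \<theta>) * (1 / lam * norm y))"
          using B0(4)[OF Z, of y] lam Ca(1) by (intro mult_left_mono) (auto simp: p_def)
        finally show "norm (B0 X *v ((A Z - A X) *v p)) \<le> 1 / lam * (n\<^sup>2 * (Ca * dist X Z powr \<theta>) * (1 / lam * norm y))" .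
      qed (use \<beta> in simp)
      also have "\<dots> = (\<beta> * (1 / lam * (n\<^sup>2 * Ca * (1 / lam)))) * (dist X Z powr \<theta> * norm y)" by (simp add: mult_ac)
      also have "\<dots> \<le> L * (dist X Z powr \<theta> * norm y)" by (intro mult_right_mono) (auto simp: L_def)
      finally show ?thesis by (simp add: mult.assoc)
    qed
  qed
qed

lemma holder_on_continuous:
  assumes "holder_on \<theta> S f" and \<theta>: "0 < \<theta>"
  shows "continuous_on S f"
proof -
  obtain L where L: "\<And>X Y. X \<in> S \<Longrightarrow> Y \<in> S \<Longrightarrow> \<bar>f X - f Y\<bar> \<le> L * dist X Y powr \<theta>"
    using assms(1) unfolding holder_on_def by blast
  show ?thesis
  proof (rule continuous_onI)
    fix X e assume X: "X \<in> S" and e: "(0::real) < e"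
    have "((\<lambda>Y. L * dist Y X powr \<theta>) \<longlongrightarrow> L * 0) (at X within S)"
      by (intro tendsto_mult tendsto_const tendsto_zero_powrI[where b=\<theta>] tendsto_eq_intros) (use \<theta> in auto)
    then have "\<forall>\<^sub>F Y in at X within S. L * dist Y X powr \<theta> < e"
      using e by (intro order_tendstoD) auto
    then have "\<exists>d>0. \<forall>Y\<in>S. Y \<noteq> X \<and> dist Y X < d \<longrightarrow> L * dist Y X powr \<theta> < e"
      by (simp add: eventually_at)
    then obtain d where d: "0 < d" "\<And>Y. Y \<in> S \<Longrightarrow> Y \<noteq> X \<Longrightarrow> dist Y X < d \<Longrightarrow> L * dist Y X powr \<theta> < e" by blast
    show "\<exists>d>0. \<forall>Y\<in>S. dist Y X < d \<longrightarrow> dist (f Y) (f X) \<le> e"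
    proof (intro exI[of _ d] conjI d(1) ballI impI)
      fix Y assume "Y \<in> S" "dist Y X < d"
      then show "dist (f Y) (f X) \<le> e"
        using d(2)[of Y] L[of Y X] X e by (cases "Y = X") (auto simp: dist_real_def)
    qed
  qed
qed

text \<open>The index maps \<open>p\<close>, \<open>q\<close>, \<open>r\<close> let both equations
  share one argument: for the Hessian, \<open>k\<close> is a pair and both derivatives on \<psi> are
  taken from it; for the gradient, one derivative direction is the summation index \<open>i\<close>
  and the other is \<open>k\<close>. Either way \<open>a i j X - a i j Y\<close> supplies
  s^\<theta>, and the factor s^2 of \<open>heat_kernel_ds_eq\<close> offsets the two derivatives of
  the bump.\<close>

lemma power_decay_of_frozen_identity:
  fixes a :: "'n::finite \<Rightarrow> 'n \<Rightarrow> real^'n \<Rightarrow> real" and W :: "'k \<Rightarrow> real^'n \<Rightarrow> real"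
    and p :: "'n \<Rightarrow> 'n \<Rightarrow> 'k" and q :: "'n \<Rightarrow> 'k \<Rightarrow> 'n" and r :: "'k \<Rightarrow> 'n"
  assumes S: "open S" and lam: "0 < lam" and \<theta>: "0 < \<theta>"
    and holder: "\<And>i j. holder_on \<theta> S (a i j)"
    and sym: "\<And>i j X. X \<in> S \<Longrightarrow> a i j X = a j i X"
    and ellip: "\<And>X \<xi>. X \<in> S \<Longrightarrow>
        lam * (norm \<xi>)\<^sup>2 \<le> (\<Sum>i\<in>UNIV. \<Sum>j\<in>UNIV. a i j X * \<xi> $ i * \<xi> $ j)"
    and cont: "\<And>k. continuous_on S (W k)" and fin: "finite (UNIV :: 'k set)"
    and Z: "Z \<in> S" "\<And>k. W k Z = 0"
    and frozen: "\<And>X s k \<psi>. 0 < s \<Longrightarrow> cball X s \<subseteq> S \<Longrightarrow> \<psi> \<in> flat_algebra \<Longrightarrow>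
      (\<And>Y. Y \<notin> cball X s \<Longrightarrow> \<psi> Y = 0) \<Longrightarrow>
      (\<integral>Y. W k Y * (\<Sum>i\<in>UNIV. \<Sum>j\<in>UNIV. a i j X * partial_d i (partial_d j \<psi>) Y) \<partial>lborel) =
      (\<integral>Y. (\<Sum>i\<in>UNIV. \<Sum>j\<in>UNIV. (a i j X - a i j Y) * W (p i j) Y * partial_d (q i k) (partial_d (r k) \<psi>) Y) \<partial>lborel)"
    and \<alpha>: "0 < \<alpha>" "\<alpha> < 1"
  shows "\<exists>r0 K. 0 < r0 \<and> 0 < K \<and> cball Z r0 \<subseteq> S \<and> (\<forall>k. \<forall>X\<in>cball Z r0. \<bar>W k X\<bar> \<le> K * dist X Z powr \<alpha>)"
proof -
  obtain B \<beta> c L where \<beta>: "0 < \<beta>" and L: "0 \<le> L" and B: "\<And>X. X \<in> S \<Longrightarrow> quad_form_bounds c (B X)"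
    and AB: "\<And>X. X \<in> S \<Longrightarrow> (\<chi> i j. a i j X) ** B X = mat \<beta>"
    and lip: "\<And>X Z y. X \<in> S \<Longrightarrow> Z \<in> S \<Longrightarrow> norm ((B X - B Z) *v y) \<le> L * dist X Z powr \<theta> * norm y"
    and aL: "\<And>i j X Y. X \<in> S \<Longrightarrow> Y \<in> S \<Longrightarrow> \<bar>a i j X - a i j Y\<bar> \<le> L * dist X Y powr \<theta>"
    using frozen_inverses[OF lam holder sym ellip] by metis
  obtain \<rho> where \<rho>: "0 < \<rho>" "cball Z \<rho> \<subseteq> S" using S Z open_contains_cball by blast
  define n where "n = CARD('n)"
  define V where "V = unit_ball_vol (real n)"
  have V: "0 < V" by (simp add: V_def)
  have c: "0 < c" using B[OF Z(1)] by (simp add: quad_form_bounds_def)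
  define C2 where "C2 = 4 * c + 144 * c\<^sup>2"
  have C2: "0 < C2" using c by (simp add: C2_def add_pos_pos)
  define M where "M = 1 / (2 * \<beta>) * ((real n)\<^sup>2 * L * C2 * V)"
  have M: "0 \<le> M" using \<beta> L C2 V by (simp add: M_def)
  have ds_eq: "heat_kernel_ds (B X) X s Y = s\<^sup>2 / (2 * \<beta>) *
      (\<Sum>i\<in>UNIV. \<Sum>j\<in>UNIV. a i j X * partial_d i (partial_d j (bump (B X) X s)) Y)"
    if "X \<in> S" "0 < s" for X s Y
    using heat_kernel_ds_eq[OF _ AB[OF that(1)], of s X Y] \<beta> B[OF that(1)] that(2)
    by (simp add: quad_form_bounds_def)
  have a_cont: "continuous_on S (a i j)" for i j by (rule holder_on_continuous[OF holder \<theta>])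
  have ds0: "(\<integral>Y. heat_kernel_ds (B X) X s Y \<partial>lborel) = 0" if X: "X \<in> S" and s: "0 < s" for X s
  proof -
    let ?\<psi> = "bump (B X) X s"
    have alg: "partial_d j ?\<psi> \<in> flat_algebra" for j by (intro flat_algebra_partial_d bump_flat_algebra)
    have z: "partial_d j ?\<psi> Y = 0" if "Y \<notin> cball X s" for j Y
      by (rule partial_d_eq_0[OF closed_cball bump_support[OF B[OF X] s] that])
    have int: "integrable lborel (partial_d i (partial_d j ?\<psi>))" for i j
      by (rule integrable_compact_support[OF flat_algebra_continuous compact_cball partial_d2_bump_support[OF B[OF X] s]])
         (intro flat_algebra_partial_d bump_flat_algebra)
    \<comment> \<open>The coefficients are frozen at \<open>X\<close>, so the integrand is a
      constant combination of derivatives of compactly supported functions.\<close>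
    have "(\<integral>Y. partial_d i (partial_d j ?\<psi>) Y \<partial>lborel) = 0" for i j
      by (rule integral_partial_d_eq_0[OF alg compact_cball z])
    then have "(\<integral>Y. (\<Sum>i\<in>UNIV. \<Sum>j\<in>UNIV. a i j X * partial_d i (partial_d j ?\<psi>) Y) \<partial>lborel) = 0"
      by (simp add: int)
    then show ?thesis unfolding ds_eq[OF X s] by simp
  qed
  have H: "\<bar>\<integral>Y. W k Y * heat_kernel_ds (B X) X s Y \<partial>lborel\<bar> \<le> M * N * s powr \<theta> * s ^ n"
    if X: "X \<in> cball Z \<rho>" and s: "0 < s" and sub: "cball X s \<subseteq> cball Z \<rho>"
      and N: "\<And>k Y. Y \<in> cball X s \<Longrightarrow> \<bar>W k Y\<bar> \<le> N" for k X s N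
  proof -
    let ?\<psi> = "bump (B X) X s"
    have XS: "X \<in> S" and subS: "cball X s \<subseteq> S" using X sub \<rho> by auto
    have N0: "0 \<le> N" using N[of X k] s by (simp add: order_trans[OF abs_ge_zero])
    have "(\<integral>Y. W k Y * heat_kernel_ds (B X) X s Y \<partial>lborel) = s\<^sup>2 / (2 * \<beta>) *
        (\<integral>Y. W k Y * (\<Sum>i\<in>UNIV. \<Sum>j\<in>UNIV. a i j X * partial_d i (partial_d j ?\<psi>) Y) \<partial>lborel)"
      unfolding ds_eq[OF XS s] by (subst mult.left_commute) (rule Bochner_Integration.integral_mult_right_zero)
    also have "(\<integral>Y. W k Y * (\<Sum>i\<in>UNIV. \<Sum>j\<in>UNIV. a i j X * partial_d i (partial_d j ?\<psi>) Y) \<partial>lborel) =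
        (\<integral>Y. (\<Sum>i\<in>UNIV. \<Sum>j\<in>UNIV. (a i j X - a i j Y) * W (p i j) Y * partial_d (q i k) (partial_d (r k) ?\<psi>) Y) \<partial>lborel)"
      by (rule frozen[OF s subS bump_flat_algebra bump_support[OF B[OF XS] s]])
    also have "\<bar>s\<^sup>2 / (2 * \<beta>) * \<dots>\<bar> \<le> s\<^sup>2 / (2 * \<beta>) * ((real n)\<^sup>2 * (L * s powr \<theta> * N * (C2 / s\<^sup>2)) *
        (unit_ball_vol (real CARD('n)) * s ^ CARD('n)))"
      unfolding abs_mult
    proof (intro mult_mono integral_abs_le_cball)
      show "continuous_on UNIV (\<lambda>Y. \<Sum>i\<in>UNIV. \<Sum>j\<in>UNIV. (a i j X - a i j Y) * W (p i j) Y * partial_d (q i k) (partial_d (r k) ?\<psi>) Y)"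
        by (intro continuous_on_sum continuous_on_mult_compact_support[OF S _ _ compact_cball subS]
            continuous_on_mult continuous_on_diff continuous_on_const a_cont cont flat_algebra_continuous
            flat_algebra_partial_d bump_flat_algebra partial_d2_bump_support[OF B[OF XS] s])
      fix Y
      show "(\<Sum>i\<in>UNIV. \<Sum>j\<in>UNIV. (a i j X - a i j Y) * W (p i j) Y * partial_d (q i k) (partial_d (r k) ?\<psi>) Y) = 0"
        if "Y \<notin> cball X s"
        by (simp only: partial_d2_bump_support[OF B[OF XS] s that]) simp
      assume Y: "Y \<in> cball X s"
      have "\<bar>\<Sum>i\<in>UNIV. \<Sum>j\<in>UNIV. (a i j X - a i j Y) * W (p i j) Y * partial_d (q i k) (partial_d (r k) ?\<psi>) Y\<bar>
          \<le> (\<Sum>i\<in>(UNIV::'n set). \<Sum>j\<in>(UNIV::'n set). L * s powr \<theta> * N * (C2 / s\<^sup>2))"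
      proof (intro sum_mono order_trans[OF sum_abs])
        fix i j
        have "\<bar>a i j X - a i j Y\<bar> \<le> L * dist X Y powr \<theta>" using XS Y subS by (intro aL) auto
        also have "\<dots> \<le> L * s powr \<theta>" using Y L \<theta> by (intro mult_left_mono powr_mono2) auto
        finally have "\<bar>a i j X - a i j Y\<bar> \<le> L * s powr \<theta>" .
        then show "\<bar>(a i j X - a i j Y) * W (p i j) Y * partial_d (q i k) (partial_d (r k) ?\<psi>) Y\<bar>
            \<le> L * s powr \<theta> * N * (C2 / s\<^sup>2)"
          unfolding abs_mult using partial_d2_bump_bound[OF B[OF XS] s Y] N[OF Y] L N0
          by (intro mult_mono) (auto simp: C2_def)
      qed
      also have "\<dots> = (real n)\<^sup>2 * (L * s powr \<theta> * N * (C2 / s\<^sup>2))"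
        by (simp add: n_def power2_eq_square)
      finally show "\<bar>\<Sum>i\<in>UNIV. \<Sum>j\<in>UNIV. (a i j X - a i j Y) * W (p i j) Y * partial_d (q i k) (partial_d (r k) ?\<psi>) Y\<bar>
          \<le> (real n)\<^sup>2 * (L * s powr \<theta> * N * (C2 / s\<^sup>2))" .
    qed (use \<beta> s in auto)
    also have "\<dots> = M * N * s powr \<theta> * s ^ n"
      using s by (simp add: M_def V_def n_def field_simps)
    finally show ?thesis .
  qed
  have "\<exists>C>0. \<forall>r R N k X. 0 < r \<longrightarrow> r \<le> R \<longrightarrow> 2 * R \<le> \<rho> \<longrightarrow>
    (\<forall>k. \<forall>Y\<in>cball Z (2 * R). \<bar>W k Y\<bar> \<le> N) \<longrightarrow> X \<in> cball Z r \<longrightarrow>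
    \<bar>W k X\<bar> \<le> C * (R powr \<theta> + r / R) * N"
  proof (rule vanishing_step[where B=B and c=c and L=L and M=M])
    show "0 < \<theta>" "0 \<le> M" "0 \<le> L" by fact+
    show "quad_form_bounds c (B X)" if "X \<in> cball Z \<rho>" for X using B that \<rho> by blast
    show "norm ((B X - B Z) *v y) \<le> L * dist X Z powr \<theta> * norm y" if "X \<in> cball Z \<rho>" for X y
      using lip that \<rho> Z(1) by blast
    show "(\<integral>Y. heat_kernel_ds (B X) X s Y \<partial>lborel) = 0" if "X \<in> cball Z \<rho>" "0 < s" for X s
      using ds0 that \<rho> by blast
    show "continuous_on (cball Z \<rho>) (W k)" for k using cont \<rho>(2) continuous_on_subset by blast
    show "\<bar>\<integral>Y. W k Y * heat_kernel_ds (B X) X s Y \<partial>lborel\<bar> \<le> M * N * s powr \<theta> * s ^ CARD('n)"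
      if "X \<in> cball Z \<rho>" "0 < s" "cball X s \<subseteq> cball Z \<rho>" "\<And>k Y. Y \<in> cball X s \<Longrightarrow> \<bar>W k Y\<bar> \<le> N" for k X s N
      using H[OF that] by (simp add: n_def)
  qed (rule Z(2))
  then obtain C where C: "0 < C" and step: "\<And>r R N k X. 0 < r \<Longrightarrow> r \<le> R \<Longrightarrow> 2 * R \<le> \<rho> \<Longrightarrow>
    (\<forall>k. \<forall>Y\<in>cball Z (2 * R). \<bar>W k Y\<bar> \<le> N) \<Longrightarrow> X \<in> cball Z r \<Longrightarrow>
    \<bar>W k X\<bar> \<le> C * (R powr \<theta> + r / R) * N" by blast
  have "\<exists>N0. \<forall>k. \<forall>Y\<in>cball Z \<rho>. \<bar>W k Y\<bar> \<le> N0"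
  proof -
    have "\<exists>N. \<forall>Y\<in>cball Z \<rho>. \<bar>W k Y\<bar> \<le> N" for k
      using compact_imp_bounded[OF compact_continuous_image[OF continuous_on_subset[OF cont \<rho>(2)] compact_cball]]
      by (auto simp: bounded_iff)
    then obtain N where N: "\<And>k Y. Y \<in> cball Z \<rho> \<Longrightarrow> \<bar>W k Y\<bar> \<le> N k" by metis
    have "\<bar>W k Y\<bar> \<le> (\<Sum>k\<in>UNIV. \<bar>N k\<bar>)" if "Y \<in> cball Z \<rho>" for k Y
      using N[OF that, of k] member_le_sum[of k UNIV "\<lambda>k. \<bar>N k\<bar>"] fin by auto
    then show ?thesis by blast
  qed
  then obtain N0 where N0: "\<And>k Y. Y \<in> cball Z \<rho> \<Longrightarrow> \<bar>W k Y\<bar> \<le> N0" by blast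
  have "\<exists>r0 K. 0 < r0 \<and> r0 \<le> \<rho> \<and> 0 < K \<and> (\<forall>k. \<forall>X\<in>cball Z r0. \<bar>W k X\<bar> \<le> K * dist X Z powr \<alpha>)"
    by (rule power_decay_of_step[where W=W and Z=Z, OF \<alpha> \<theta> \<rho>(1) C N0 Z(2) step]) auto
  then obtain r0 K where "0 < r0" "r0 \<le> \<rho>" "0 < K"
    "\<forall>k. \<forall>X\<in>cball Z r0. \<bar>W k X\<bar> \<le> K * dist X Z powr \<alpha>" by blast
  moreover have "cball Z r0 \<subseteq> S" using \<rho>(2) subset_cball[OF \<open>r0 \<le> \<rho>\<close>] by blast
  ultimately show ?thesis by blast
qed

section \<open>The frozen equations\<close>

lemma integrable_mult_flat_algebra:
  fixes \<phi> :: "real^'n::finite \<Rightarrow> real"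
  assumes "open S" "continuous_on S w" "\<phi> \<in> flat_algebra" "compact K" "K \<subseteq> S" "\<And>x. x \<notin> K \<Longrightarrow> \<phi> x = 0"
  shows "integrable lborel (\<lambda>x. w x * \<phi> x)"
  by (rule integrable_compact_support[OF continuous_on_mult_compact_support[OF assms(1,2)
        flat_algebra_continuous[OF assms(3)] assms(4-6)] assms(4)]) (auto simp: assms(6))

lemma partial_d_support:
  assumes "compact K" "\<And>x. x \<notin> K \<Longrightarrow> f x = 0" "x \<notin> K"
  shows "partial_d i f x = 0"
  by (rule partial_d_eq_0[OF compact_imp_closed[OF assms(1)] assms(2,3)])

lemma hessian_integration_by_parts:
  fixes u :: "real^'n::finite \<Rightarrow> real"
  assumes S: "open S"
    and u: "\<And>X. X \<in> S \<Longrightarrow> (u has_derivative (\<lambda>h. Du X \<bullet> h)) (at X)"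
    and Du: "\<And>X. X \<in> S \<Longrightarrow> (Du has_derivative (\<lambda>h. D2u X *v h)) (at X)"
    and cont: "continuous_on S D2u"
    and \<phi>: "\<phi> \<in> flat_algebra" and K: "compact K" "K \<subseteq> S" "\<And>x. x \<notin> K \<Longrightarrow> \<phi> x = 0"
  shows "(\<integral>Y. D2u Y $ k $ l * \<phi> Y \<partial>lborel) = (\<integral>Y. u Y * partial_d k (partial_d l \<phi>) Y \<partial>lborel)"
proof -
  have cDu: "continuous_on S Du"
    by (intro continuous_at_imp_continuous_on ballI has_derivative_continuous[OF Du])
  have "(\<integral>Y. (D2u Y *v axis l 1) $ k * \<phi> Y \<partial>lborel) = - (\<integral>Y. Du Y $ k * partial_d l \<phi> Y \<partial>lborel)"
  proof (rule integration_by_parts_compact_support[where v="\<lambda>x. Du x $ k" and v'="\<lambda>x h. (D2u x *v h) $ k", OF S _ _ \<phi> K])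
    show "((\<lambda>x. Du x $ k) has_derivative (\<lambda>h. (D2u x *v h) $ k)) (at x)" if "x \<in> S" for x
      by (rule bounded_linear.has_derivative[OF bounded_linear_vec_nth Du[OF that]])
    show "continuous_on S (\<lambda>x. (D2u x *v axis l 1) $ k)"
      by (simp add: matrix_vector_mult_basis column_def) (intro continuous_intros cont)
  qed
  moreover have "(\<integral>Y. (Du Y \<bullet> axis k 1) * partial_d l \<phi> Y \<partial>lborel) = - (\<integral>Y. u Y * partial_d k (partial_d l \<phi>) Y \<partial>lborel)"
    by (rule integration_by_parts_compact_support[where v=u and v'="\<lambda>x h. Du x \<bullet> h", OF S u _
          flat_algebra_partial_d[OF \<phi>] K(1,2) partial_d_support[OF K(1,3)]])
       (auto intro: continuous_intros cDu)
  ultimately show ?thesis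
    by (simp add: matrix_vector_mult_basis column_def inner_axis)
qed

text \<open>The integrals of D_kl u D_ij \<phi> and of D_ij u D_kl \<phi> agree, since both equal
  the integral of u times the same fourth derivative of \<phi>; thus two derivatives of
  \<open>u\<close> suffice. After this exchange the pointwise equation at \<open>Y\<close> can be
  subtracted, which turns \<open>a i j X\<close> into \<open>a i j X - a i j Y\<close>.\<close>

lemma nondivergence_frozen_identity:
  fixes u :: "real^'n::finite \<Rightarrow> real"
  assumes S: "open S"
    and u: "\<And>X. X \<in> S \<Longrightarrow> (u has_derivative (\<lambda>h. Du X \<bullet> h)) (at X)"
    and Du: "\<And>X. X \<in> S \<Longrightarrow> (Du has_derivative (\<lambda>h. D2u X *v h)) (at X)"
    and cont: "continuous_on S D2u"
    and eq: "\<And>X. X \<in> S \<Longrightarrow> (\<Sum>i\<in>UNIV. \<Sum>j\<in>UNIV. a i j X * D2u X $ i $ j) = 0"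
    and \<phi>: "\<phi> \<in> flat_algebra" and K: "compact K" "K \<subseteq> S" "\<And>x. x \<notin> K \<Longrightarrow> \<phi> x = 0"
  shows "(\<integral>Y. D2u Y $ k $ l * (\<Sum>i\<in>UNIV. \<Sum>j\<in>UNIV. a i j X * partial_d i (partial_d j \<phi>) Y) \<partial>lborel) =
    (\<integral>Y. (\<Sum>i\<in>UNIV. \<Sum>j\<in>UNIV. (a i j X - a i j Y) * D2u Y $ i $ j * partial_d k (partial_d l \<phi>) Y) \<partial>lborel)"
proof -
  have alg: "partial_d i (partial_d j \<phi>) \<in> flat_algebra" for i j by (intro flat_algebra_partial_d \<phi>)
  have z: "partial_d i (partial_d j \<phi>) x = 0" if "x \<notin> K" for i j x
    by (rule partial_d_support[OF K(1) partial_d_support[OF K(1,3)] that])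
  have c: "continuous_on S (\<lambda>Y. D2u Y $ i $ j)" for i j by (intro continuous_intros cont)
  note int = integrable_mult_flat_algebra[OF S c alg K(1,2) z]
  have parts: "(\<integral>Y. D2u Y $ k $ l * partial_d i (partial_d j \<phi>) Y \<partial>lborel) =
      (\<integral>Y. u Y * partial_d k (partial_d l (partial_d i (partial_d j \<phi>))) Y \<partial>lborel)" for i j k l
    by (rule hessian_integration_by_parts[OF S u Du cont alg K(1,2) z])
  have comm: "partial_d k (partial_d l (partial_d i (partial_d j \<phi>))) = partial_d i (partial_d j (partial_d k (partial_d l \<phi>)))"
    for i j
  proof -
    have move: "partial_d l (partial_d i (partial_d j f)) = partial_d i (partial_d j (partial_d l f))"
      if f: "f \<in> flat_algebra" for l f
      unfolding partial_d_commute[OF flat_algebra_partial_d[OF f], of l i] partial_d_commute[OF f, of l j] ..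
    show ?thesis
      unfolding move[OF \<phi>, of l] move[OF flat_algebra_partial_d[OF \<phi>], of k] ..
  qed
  have "(\<integral>Y. D2u Y $ k $ l * (\<Sum>i\<in>UNIV. \<Sum>j\<in>UNIV. a i j X * partial_d i (partial_d j \<phi>) Y) \<partial>lborel)
      = (\<integral>Y. (\<Sum>i\<in>UNIV. \<Sum>j\<in>UNIV. a i j X * (D2u Y $ k $ l * partial_d i (partial_d j \<phi>) Y)) \<partial>lborel)"
    by (simp add: sum_distrib_left mult.left_commute)
  also have "\<dots> = (\<Sum>i\<in>UNIV. \<Sum>j\<in>UNIV. a i j X * (\<integral>Y. D2u Y $ k $ l * partial_d i (partial_d j \<phi>) Y \<partial>lborel))"
    by (simp add: int)
  also have "\<dots> = (\<Sum>i\<in>UNIV. \<Sum>j\<in>UNIV. a i j X * (\<integral>Y. D2u Y $ i $ j * partial_d k (partial_d l \<phi>) Y \<partial>lborel))"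
    by (simp only: parts comm)
  also have "\<dots> = (\<integral>Y. (\<Sum>i\<in>UNIV. \<Sum>j\<in>UNIV. a i j X * (D2u Y $ i $ j * partial_d k (partial_d l \<phi>) Y)) \<partial>lborel)"
    by (simp add: int)
  also have "\<dots> = (\<integral>Y. (\<Sum>i\<in>UNIV. \<Sum>j\<in>UNIV. (a i j X - a i j Y) * D2u Y $ i $ j * partial_d k (partial_d l \<phi>) Y) \<partial>lborel)"
  proof (intro Bochner_Integration.integral_cong refl)
    fix Y
    show "(\<Sum>i\<in>UNIV. \<Sum>j\<in>UNIV. a i j X * (D2u Y $ i $ j * partial_d k (partial_d l \<phi>) Y)) =
      (\<Sum>i\<in>UNIV. \<Sum>j\<in>UNIV. (a i j X - a i j Y) * D2u Y $ i $ j * partial_d k (partial_d l \<phi>) Y)"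
    proof (cases "Y \<in> K")
      case True
      then have "(\<Sum>i\<in>UNIV. \<Sum>j\<in>UNIV. a i j Y * D2u Y $ i $ j * partial_d k (partial_d l \<phi>) Y) = 0"
        using eq[of Y] K(2) by (auto simp: sum_distrib_right[symmetric])
      then show ?thesis by (simp add: left_diff_distrib sum_subtractf mult.assoc)
    qed (simp add: z)
  qed
  finally show ?thesis .
qed

text \<open>Through third derivatives of \<phi>, the integral of D_k v D_ij \<phi> equals that of
  D_j v D_ik \<phi>. Then \<open>partial_d k \<phi>\<close> is an admissible test function, and the
  weak equation tested with it is exactly the term to subtract.\<close>

lemma divergence_frozen_identity:
  fixes v :: "real^'n::finite \<Rightarrow> real"
  assumes S: "open S"
    and v: "\<And>X. X \<in> S \<Longrightarrow> (v has_derivative (\<lambda>h. Dv X \<bullet> h)) (at X)"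
    and cont: "continuous_on S Dv" and a: "\<And>i j. continuous_on S (a i j)"
    and eq: "\<And>\<psi>. \<psi> \<in> flat_algebra \<Longrightarrow> (\<And>x. x \<notin> K \<Longrightarrow> \<psi> x = 0) \<Longrightarrow>
      (\<integral>Y. (\<Sum>i\<in>UNIV. \<Sum>j\<in>UNIV. a i j Y * Dv Y $ j * partial_d i \<psi> Y) \<partial>lborel) = 0"
    and \<phi>: "\<phi> \<in> flat_algebra" and K: "compact K" "K \<subseteq> S" "\<And>x. x \<notin> K \<Longrightarrow> \<phi> x = 0"
  shows "(\<integral>Y. Dv Y $ k * (\<Sum>i\<in>UNIV. \<Sum>j\<in>UNIV. a i j X * partial_d i (partial_d j \<phi>) Y) \<partial>lborel) =
    (\<integral>Y. (\<Sum>i\<in>UNIV. \<Sum>j\<in>UNIV. (a i j X - a i j Y) * Dv Y $ j * partial_d i (partial_d k \<phi>) Y) \<partial>lborel)"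
proof -
  have alg: "partial_d i (partial_d j \<phi>) \<in> flat_algebra" for i j by (intro flat_algebra_partial_d \<phi>)
  have z: "partial_d i (partial_d j \<phi>) x = 0" if "x \<notin> K" for i j x
    by (rule partial_d_support[OF K(1) partial_d_support[OF K(1,3)] that])
  have c: "continuous_on S (\<lambda>Y. Dv Y $ j)" for j by (intro continuous_intros cont)
  note int = integrable_mult_flat_algebra[OF S c alg K(1,2) z]
  have int_a: "integrable lborel (\<lambda>Y. a i j Y * Dv Y $ j * partial_d i (partial_d k \<phi>) Y)" for i j
    by (rule integrable_mult_flat_algebra[OF S continuous_on_mult[OF a c] alg K(1,2) z])
  have parts: "(\<integral>Y. Dv Y $ k * partial_d i (partial_d j \<phi>) Y \<partial>lborel) =
      - (\<integral>Y. v Y * partial_d k (partial_d i (partial_d j \<phi>)) Y \<partial>lborel)" for i j k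
    using integration_by_parts_compact_support[where v=v and v'="\<lambda>x h. Dv x \<bullet> h" and i=k, OF S v _ alg K(1,2) z]
    by (simp add: inner_axis c)
  have comm: "partial_d k (partial_d i (partial_d j \<phi>)) = partial_d j (partial_d i (partial_d k \<phi>))" for i j
  proof -
    have "partial_d k (partial_d i (partial_d j \<phi>)) = partial_d i (partial_d k (partial_d j \<phi>))"
      by (intro partial_d_commute flat_algebra_partial_d \<phi>)
    also have "partial_d k (partial_d j \<phi>) = partial_d j (partial_d k \<phi>)" by (intro partial_d_commute \<phi>)
    also have "partial_d i (partial_d j (partial_d k \<phi>)) = partial_d j (partial_d i (partial_d k \<phi>))"
      by (intro partial_d_commute flat_algebra_partial_d \<phi>)
    finally show ?thesis .
  qed
  have "(\<integral>Y. Dv Y $ k * (\<Sum>i\<in>UNIV. \<Sum>j\<in>UNIV. a i j X * partial_d i (partial_d j \<phi>) Y) \<partial>lborel)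
      = (\<integral>Y. (\<Sum>i\<in>UNIV. \<Sum>j\<in>UNIV. a i j X * (Dv Y $ k * partial_d i (partial_d j \<phi>) Y)) \<partial>lborel)"
    by (simp add: sum_distrib_left mult.left_commute)
  also have "\<dots> = (\<Sum>i\<in>UNIV. \<Sum>j\<in>UNIV. a i j X * (\<integral>Y. Dv Y $ k * partial_d i (partial_d j \<phi>) Y \<partial>lborel))"
    by (simp add: int)
  also have "\<dots> = (\<Sum>i\<in>UNIV. \<Sum>j\<in>UNIV. a i j X * (\<integral>Y. Dv Y $ j * partial_d i (partial_d k \<phi>) Y \<partial>lborel))"
    by (simp only: parts comm)
  also have "\<dots> = (\<integral>Y. (\<Sum>i\<in>UNIV. \<Sum>j\<in>UNIV. a i j X * (Dv Y $ j * partial_d i (partial_d k \<phi>) Y)) \<partial>lborel)"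
    by (simp add: int)
  also have "\<dots> = (\<integral>Y. (\<Sum>i\<in>UNIV. \<Sum>j\<in>UNIV. a i j X * (Dv Y $ j * partial_d i (partial_d k \<phi>) Y)) \<partial>lborel)
      - (\<integral>Y. (\<Sum>i\<in>UNIV. \<Sum>j\<in>UNIV. a i j Y * Dv Y $ j * partial_d i (partial_d k \<phi>) Y) \<partial>lborel)"
    using eq[OF flat_algebra_partial_d[OF \<phi>] partial_d_support[OF K(1,3)]] by simp
  also have "\<dots> = (\<integral>Y. (\<Sum>i\<in>UNIV. \<Sum>j\<in>UNIV. a i j X * (Dv Y $ j * partial_d i (partial_d k \<phi>) Y))
      - (\<Sum>i\<in>UNIV. \<Sum>j\<in>UNIV. a i j Y * Dv Y $ j * partial_d i (partial_d k \<phi>) Y) \<partial>lborel)"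
    by (intro Bochner_Integration.integral_diff[symmetric] Bochner_Integration.integrable_sum integrable_mult_right int int_a)
  finally show ?thesis by (simp add: left_diff_distrib sum_subtractf mult.assoc)
qed

section \<open>From the weak gradient to the classical gradient\<close>

lemma real_polynomial_function_flat_algebra:
  fixes p :: "real^'n::finite \<Rightarrow> real"
  shows "real_polynomial_function p \<Longrightarrow> p \<in> flat_algebra"
proof (induction rule: real_polynomial_function.induct)
  case (linear f)
  then interpret bounded_linear f .
  have "f x = (\<Sum>i\<in>UNIV. f (axis i 1) * x $ i)" for x
  proof -
    have "f x = f (\<Sum>i\<in>UNIV. x $ i *\<^sub>R axis i 1)"
      using basis_expansion[of x] by (simp add: scalar_mult_eq_scaleR)
    then show ?thesis by (simp add: sum scaleR mult.commute)
  qed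
  then have "f = (\<lambda>x. \<Sum>i\<in>UNIV. f (axis i 1) * x $ i)" by blast
  moreover have "(\<lambda>x. \<Sum>i\<in>UNIV. f (axis i 1) * x $ i) \<in> flat_algebra"
    by (intro flat_algebra_sum flat_algebra_cmult flat_algebra.coord)
  ultimately show ?case by (simp only:)
qed (auto intro: flat_algebra.intros)

text \<open>A continuous \<open>b\<close> supported inside the ball is a uniform limit of test functions \<open>p \<chi>\<close>,
  where \<open>\<chi>\<close> is a bump positive on the support and the polynomial \<open>p\<close> approximates \<open>b / \<chi>\<close>.\<close>
lemma integral_eq_0_of_flat_algebra:
  fixes h :: "real^'n::finite \<Rightarrow> real"
  assumes h: "integrable lebesgue h" and R: "0 < R"
    and test: "\<And>\<psi>. \<psi> \<in> flat_algebra \<Longrightarrow> (\<And>x. x \<notin> cball 0 R \<Longrightarrow> \<psi> x = 0) \<Longrightarrow> (\<integral>x. h x * \<psi> x \<partial>lebesgue) = 0"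
    and b: "continuous_on UNIV b" and K: "compact K" "K \<subseteq> ball 0 R" "\<And>x. x \<notin> K \<Longrightarrow> b x = 0"
    and supp: "\<And>x. x \<notin> cball 0 R \<Longrightarrow> h x = 0"
  shows "(\<integral>x. h x * b x \<partial>lebesgue) = 0"
proof -
  define q where "q x = flat_exp 0 (R\<^sup>2 - x \<bullet> x)" for x :: "real^'n"
  have q_alg: "q \<in> flat_algebra"
    unfolding q_def[abs_def] inner_vec_def inner_real_def
    by (intro flat_algebra.flat flat_algebra_diff flat_algebra.const flat_algebra_sum flat_algebra.mult flat_algebra.coord)
  have q_pos: "0 < q x" if "x \<in> ball 0 R" for x
    unfolding q_def using that R by (intro flat_exp_pos) (simp add: power2_norm_eq_inner[symmetric] power_strict_mono)
  have q_0: "q x = 0" if "x \<notin> ball 0 R" for x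
    unfolding q_def using that R by (intro flat_exp_nonpos) (simp add: power2_norm_eq_inner[symmetric] power_mono)
  have q_le: "q x \<le> 1" "0 \<le> q x" for x
    using flat_exp_le_fact[of 0] by (simp_all add: q_def flat_exp_nonneg)
  have "continuous_on (ball 0 R) (\<lambda>x. b x / q x)"
    using q_pos by (intro continuous_on_divide continuous_on_subset[OF b] flat_algebra_continuous[OF q_alg]) force+
  \<comment> \<open>Off \<open>K\<close> the quotient is 0, even where \<open>q\<close> vanishes,
    since 0 / 0 = 0.\<close>
  moreover have "continuous_on (- K) (\<lambda>x. b x / q x)"
    using K(3) by (subst continuous_on_cong[of "-K" "-K" _ "\<lambda>x. 0"]) auto
  moreover have "ball 0 R \<union> - K = UNIV" using K by auto
  ultimately have cq: "continuous_on UNIV (\<lambda>x. b x / q x)"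
    using continuous_on_open_Un[of "ball 0 R" "-K"] K(1) by (simp add: open_Compl compact_imp_closed)
  have meas: "f \<in> borel_measurable lebesgue" if "continuous_on UNIV f" for f :: "real^'n \<Rightarrow> real"
    using borel_measurable_continuous_onI[OF that] by (intro measurable_completion) simp
  have int: "integrable lebesgue (\<lambda>x. h x * f x)" if f: "continuous_on UNIV f" for f
  proof -
    obtain B where B: "\<And>x. x \<in> cball 0 R \<Longrightarrow> \<bar>f x\<bar> \<le> B"
      using compact_imp_bounded[OF compact_continuous_image[OF continuous_on_subset[OF f subset_UNIV] compact_cball[of 0 R]]]
      unfolding bounded_iff by fastforce
    have "integrable lebesgue (\<lambda>x. h x * B)" using h by simp
    then show ?thesis
    proof (rule Bochner_Integration.integrable_bound)
      show "(\<lambda>x. h x * f x) \<in> borel_measurable lebesgue" using h meas[OF f] by simp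
      show "AE x in lebesgue. norm (h x * f x) \<le> norm (h x * B)"
      proof (rule AE_I2)
        fix x show "norm (h x * f x) \<le> norm (h x * B)"
          using supp[of x] B[of x] by (cases "x \<in> cball 0 R") (auto simp: abs_mult intro!: mult_left_mono)
      qed
    qed
  qed
  have "\<bar>\<integral>x. h x * b x \<partial>lebesgue\<bar> \<le> 0"
  proof (rule field_le_epsilon)
    fix e :: real assume e: "0 < e"
    define I where "I = (\<integral>x. \<bar>h x\<bar> \<partial>lebesgue)"
    have I: "0 \<le> I" by (simp add: I_def)
    \<comment> \<open>\<open>I + 1\<close> avoids a division by 0 when \<open>h\<close> vanishes
      almost everywhere.\<close>
    define e' where "e' = e / (I + 1)"
    have e': "0 < e'" using e I by (simp add: e'_def)
    obtain p where p: "real_polynomial_function p" "\<And>x. x \<in> cball 0 R \<Longrightarrow> \<bar>b x / q x - p x\<bar> < e'"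
      using Stone_Weierstrass_real_polynomial_function[OF compact_cball continuous_on_subset[OF cq subset_UNIV] e'] by blast
    have alg: "(\<lambda>x. p x * q x) \<in> flat_algebra"
      by (intro flat_algebra.mult real_polynomial_function_flat_algebra p q_alg)
    have bound: "\<bar>b x - p x * q x\<bar> \<le> e'" for x
    proof (cases "x \<in> ball 0 R")
      case True
      then have "b x - p x * q x = (b x / q x - p x) * q x" using q_pos[OF True] by (simp add: field_simps)
      also have "\<bar>\<dots>\<bar> \<le> e' * 1"
        unfolding abs_mult using p(2)[of x] True q_le[of x] e' by (intro mult_mono) auto
      finally show ?thesis by simp
    next
      case False
      then have "x \<notin> K" using K(2) by blast
      then show ?thesis using q_0[OF False] K(3) e' by simp
    qed
    have "(\<integral>x. h x * (p x * q x) \<partial>lebesgue) = 0" using q_0 by (intro test alg) simp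
    then have "(\<integral>x. h x * b x \<partial>lebesgue) = (\<integral>x. h x * b x - h x * (p x * q x) \<partial>lebesgue)"
      using int[OF b] int[OF flat_algebra_continuous[OF alg]] by simp
    also have "\<bar>\<dots>\<bar> \<le> (\<integral>x. \<bar>h x * b x - h x * (p x * q x)\<bar> \<partial>lebesgue)"
      by (rule integral_abs_bound)
    also have "\<dots> \<le> (\<integral>x. \<bar>h x\<bar> * e' \<partial>lebesgue)"
    proof (rule integral_mono)
      show "integrable lebesgue (\<lambda>x. \<bar>h x * b x - h x * (p x * q x)\<bar>)"
        using int[OF b] int[OF flat_algebra_continuous[OF alg]] by simp
      show "integrable lebesgue (\<lambda>x. \<bar>h x\<bar> * e')" using h by simp
      show "\<bar>h x * b x - h x * (p x * q x)\<bar> \<le> \<bar>h x\<bar> * e'" for x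
        using mult_left_mono[OF bound[of x], of "\<bar>h x\<bar>"] by (simp add: abs_mult[symmetric] right_diff_distrib)
    qed
    also have "\<dots> = I * e'" by (simp add: I_def)
    also have "\<dots> \<le> 0 + e" using I e by (simp add: e'_def field_simps)
    finally show "\<bar>\<integral>x. h x * b x \<partial>lebesgue\<bar> \<le> 0 + e" .
  qed
  then show ?thesis by simp
qed

lemma compact_subset_cball_less:
  fixes K :: "'a::real_normed_vector set"
  assumes "compact K" "K \<subseteq> ball 0 1"
  obtains R where "0 < R" "R < 1" "K \<subseteq> ball 0 R"
proof (cases "K = {}")
  case True
  then show ?thesis using that[of "1/2"] by simp
next
  case False
  then obtain x where x: "x \<in> K" "\<And>y. y \<in> K \<Longrightarrow> norm y \<le> norm x"
    using continuous_attains_sup[OF assms(1) False continuous_on_norm_id] by blast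
  show ?thesis
  proof (rule that)
    show "0 < (norm x + 1) / 2" by (simp add: add_nonneg_pos)
    show "(norm x + 1) / 2 < 1" using x(1) assms(2) by force
    show "K \<subseteq> ball 0 ((norm x + 1) / 2)"
    proof
      fix y assume "y \<in> K"
      then show "y \<in> ball 0 ((norm x + 1) / 2)" using x assms(2) by force
    qed
  qed
qed

text \<open>\<open>g\<close> and \<open>Dv\<close> pair equally with test functions, because
  \<open>v\<close> agrees with \<open>u\<close> almost everywhere and can be integrated by parts
  classically. The weak equation, however, pairs them with
  \<open>a i j Y * partial_d i \<phi> Y\<close>, which is merely continuous;
  \<open>integral_eq_0_of_flat_algebra\<close> bridges this gap without establishing that
  \<open>g = Dv\<close> almost everywhere.\<close>

lemma weak_equation_classical_gradient:
  fixes a :: "'n::finite \<Rightarrow> 'n \<Rightarrow> real^'n \<Rightarrow> real"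
  assumes H1: "H1_weak_grad (ball 0 1) u g" and weak: "weak_div_solution a (ball 0 1) g"
    and ae: "AE x in lebesgue. x \<in> ball 0 1 \<longrightarrow> v x = u x"
    and v: "\<And>X. X \<in> ball 0 1 \<Longrightarrow> (v has_derivative (\<lambda>h. Dv X \<bullet> h)) (at X)"
    and cont: "continuous_on (ball 0 1) Dv" and a: "\<And>i j. continuous_on (ball 0 1) (a i j)"
    and \<phi>: "\<phi> \<in> flat_algebra" and K: "compact K" "K \<subseteq> ball 0 1" "\<And>x. x \<notin> K \<Longrightarrow> \<phi> x = 0"
  shows "(\<integral>Y. (\<Sum>i\<in>UNIV. \<Sum>j\<in>UNIV. a i j Y * Dv Y $ j * partial_d i \<phi> Y) \<partial>lborel) = 0"
proof -
  let ?S = "ball 0 1 :: (real^'n) set"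
  have leb: "(\<integral>x. f x \<partial>lebesgue) = integral\<^sup>L lborel f" if "continuous_on UNIV f" for f :: "real^'n \<Rightarrow> real"
    using borel_measurable_continuous_onI[OF that] by (intro integral_completion) simp
  have meas: "f \<in> borel_measurable lebesgue" if "continuous_on UNIV f" for f :: "real^'n \<Rightarrow> real"
    using borel_measurable_continuous_onI[OF that] by (intro measurable_completion) simp
  \<comment> \<open>\<open>Dv\<close> is controlled only on compact subsets of the open ball, so the
    comparison with \<open>g\<close> is confined to a smaller ball that still contains
    \<open>K\<close>.\<close>
  obtain R where R: "0 < R" "R < 1" "K \<subseteq> ball 0 R" by (rule compact_subset_cball_less[OF K(1,2)])
  have RS: "cball 0 R \<subseteq> ?S" using R by auto
  have cDv: "continuous_on ?S (\<lambda>x. Dv x $ j)" for j by (intro continuous_intros cont)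
  have cv: "continuous_on ?S v"
    by (intro continuous_at_imp_continuous_on ballI has_derivative_continuous[OF v])
  have grad: "(LINT x:?S|lebesgue. g x $ j * \<psi> x) = (\<integral>x. Dv x $ j * \<psi> x \<partial>lborel)"
    if \<psi>: "\<psi> \<in> flat_algebra" and z: "\<And>x. x \<notin> cball 0 R \<Longrightarrow> \<psi> x = 0" for \<psi> j
  proof -
    have z': "partial_d j \<psi> x = 0" if "x \<notin> cball 0 R" for x
      by (rule partial_d_support[OF compact_cball z that])
    have c': "continuous_on UNIV (\<lambda>x. v x * partial_d j \<psi> x)"
      by (rule continuous_on_mult_compact_support[OF open_ball cv
            flat_algebra_continuous[OF flat_algebra_partial_d[OF \<psi>]] compact_cball RS z'])
    have test: "test_fun ?S \<psi>"
      unfolding test_fun_def using flat_algebra_C_infinity[OF \<psi>] compact_cball RS z by blast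
    have um: "set_borel_measurable lebesgue ?S u" using H1 by (simp add: H1_weak_grad_def)
    have "- (LINT x:?S|lebesgue. g x $ j * \<psi> x) = (LINT x:?S|lebesgue. u x * partial_d j \<psi> x)"
      using H1 test by (auto simp: H1_weak_grad_def)
    also have "\<dots> = (\<integral>x. v x * partial_d j \<psi> x \<partial>lebesgue)"
      unfolding set_lebesgue_integral_def
    proof (rule integral_cong_AE)
      have "(\<lambda>x. (indicator ?S x *\<^sub>R u x) * partial_d j \<psi> x) \<in> borel_measurable lebesgue"
        using um meas[OF flat_algebra_continuous[OF flat_algebra_partial_d[OF \<psi>]]]
        unfolding set_borel_measurable_def by (rule borel_measurable_times)
      then show "(\<lambda>x. indicator ?S x *\<^sub>R (u x * partial_d j \<psi> x)) \<in> borel_measurable lebesgue"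
        by (simp add: mult.assoc)
      show "(\<lambda>x. v x * partial_d j \<psi> x) \<in> borel_measurable lebesgue" by (rule meas[OF c'])
      show "AE x in lebesgue. indicator ?S x *\<^sub>R (u x * partial_d j \<psi> x) = v x * partial_d j \<psi> x"
        using ae
      proof eventually_elim
        case (elim x)
        then show ?case using z'[of x] RS by (cases "x \<in> ?S") (auto simp: indicator_def subset_iff)
      qed
    qed
    also have "\<dots> = (\<integral>x. v x * partial_d j \<psi> x \<partial>lborel)" by (rule leb[OF c'])
    also have "\<dots> = - (\<integral>x. Dv x $ j * \<psi> x \<partial>lborel)"
      using integration_by_parts_compact_support[where v=v and v'="\<lambda>x h. Dv x \<bullet> h" and i=j,
          OF open_ball v _ \<psi> compact_cball RS z]
      by (simp add: inner_axis cDv)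
    finally show ?thesis by simp
  qed
  have g_int: "set_integrable lebesgue ?S (\<lambda>x. g x $ j)" for j
  proof -
    have m: "set_borel_measurable lebesgue ?S (\<lambda>x. g x $ j)"
      and sq: "set_integrable lebesgue ?S (\<lambda>x. (g x $ j)\<^sup>2)"
      using H1 by (auto simp: H1_weak_grad_def)
    have "emeasure lebesgue ?S < \<infinity>"
      using emeasure_lborel_ball_finite[of "0::real^'n" 1] by simp
    then have "set_integrable lebesgue ?S (\<lambda>x. 1::real)"
      unfolding set_integrable_def by simp
    from set_integral_add(1)[OF this sq]
    show ?thesis
      unfolding set_integrable_def
    proof (rule Bochner_Integration.integrable_bound)
      show "(\<lambda>x. indicat_real ?S x *\<^sub>R g x $ j) \<in> borel_measurable lebesgue"
        using m by (simp add: set_borel_measurable_def)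
      \<comment> \<open>On a set of finite measure this inequality puts L^2 inside L^1.\<close>
      have "\<bar>t\<bar> \<le> 1 + t\<^sup>2" for t :: real
      proof -
        have "0 \<le> (\<bar>t\<bar> - 1)\<^sup>2" by simp
        then have "2 * \<bar>t\<bar> \<le> 1 + t\<^sup>2" by (simp add: power2_diff)
        then show ?thesis by linarith
      qed
      then show "AE x in lebesgue. norm (indicat_real ?S x *\<^sub>R g x $ j)
          \<le> norm (indicat_real ?S x *\<^sub>R (1 + (g x $ j)\<^sup>2))"
        by (auto simp: indicator_def)
    qed
  qed
  define h where "h j x = indicat_real (cball 0 R) x * (g x $ j - Dv x $ j)" for j x
  have gR: "integrable lebesgue (\<lambda>x. indicat_real (cball 0 R) x * g x $ j)" for j
    using set_integrable_subset[OF g_int[of j] _ RS] by (simp add: set_integrable_def)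
  have DvR: "integrable lebesgue (\<lambda>x. indicat_real (cball 0 R) x * Dv x $ j)" for j
    using borel_integrable_compact[OF compact_cball continuous_on_subset[OF cDv RS], of j]
    by (intro integrable_completion[THEN iffD2]) (auto simp: borel_measurable_integrable)
  have h_int: "integrable lebesgue (h j)" for j
    unfolding h_def right_diff_distrib by (intro Bochner_Integration.integrable_diff gR DvR)
  have ci: "continuous_on UNIV (\<lambda>Y. w Y * partial_d i \<phi> Y)" if "continuous_on ?S w" for w i
    by (rule continuous_on_mult_compact_support[OF open_ball that
          flat_algebra_continuous[OF flat_algebra_partial_d[OF \<phi>]] K(1,2) partial_d_support[OF K(1,3)]])
  define b where "b i j Y = a i j Y * partial_d i \<phi> Y" for i j Y
  have b: "continuous_on UNIV (b i j)" for i j unfolding b_def by (intro ci a)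
  have bz: "b i j x = 0" if "x \<notin> K" for i j x
    using partial_d_support[OF K(1,3) that] by (simp add: b_def)
  have hb0: "(\<integral>x. h j x * b i j x \<partial>lebesgue) = 0" for i j
  proof (rule integral_eq_0_of_flat_algebra[OF h_int R(1) _ b K(1) R(3) bz])
    show "h j x = 0" if "x \<notin> cball 0 R" for x using that by (simp add: h_def)
    fix \<psi> :: "real^'n \<Rightarrow> real"
    assume \<psi>: "\<psi> \<in> flat_algebra" and z: "\<And>x. x \<notin> cball 0 R \<Longrightarrow> \<psi> x = 0"
    have c: "continuous_on UNIV (\<lambda>x. Dv x $ j * \<psi> x)"
      by (rule continuous_on_mult_compact_support[OF open_ball cDv flat_algebra_continuous[OF \<psi>] compact_cball RS z])
    have hg: "h j x * \<psi> x = indicat_real ?S x *\<^sub>R (g x $ j * \<psi> x) - Dv x $ j * \<psi> x" for x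
      using z[of x] RS by (cases "x \<in> cball 0 R") (auto simp: h_def indicator_def left_diff_distrib subset_iff)
    have i2: "integrable lebesgue (\<lambda>x. Dv x $ j * \<psi> x)"
      using integrable_compact_support[OF c compact_cball[of 0 R]] z
      by (intro integrable_completion[THEN iffD2] borel_measurable_integrable) auto
    have i1: "integrable lebesgue (\<lambda>x. indicat_real ?S x *\<^sub>R (g x $ j * \<psi> x))"
    proof -
      obtain B where B: "\<And>x. x \<in> cball 0 R \<Longrightarrow> \<bar>\<psi> x\<bar> \<le> B"
        using compact_imp_bounded[OF compact_continuous_image[OF flat_algebra_continuous[OF \<psi>] compact_cball[of 0 R]]]
        unfolding bounded_iff by fastforce
      have B': "\<bar>\<psi> x\<bar> \<le> \<bar>B\<bar>" for x using B[of x] z[of x] by (cases "x \<in> cball 0 R") auto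
      have "integrable lebesgue (\<lambda>x. (indicat_real ?S x *\<^sub>R g x $ j) * B)"
        using g_int[of j] unfolding set_integrable_def by (rule integrable_mult_left)
      then show ?thesis
      proof (rule Bochner_Integration.integrable_bound)
        have "(\<lambda>x. indicat_real ?S x *\<^sub>R g x $ j * \<psi> x) \<in> borel_measurable lebesgue"
          using g_int[of j] meas[OF flat_algebra_continuous[OF \<psi>]]
          unfolding set_integrable_def by (intro borel_measurable_times) simp_all
        then show "(\<lambda>x. indicat_real ?S x *\<^sub>R (g x $ j * \<psi> x)) \<in> borel_measurable lebesgue"
          by (simp add: mult.assoc)
        show "AE x in lebesgue. norm (indicat_real ?S x *\<^sub>R (g x $ j * \<psi> x)) \<le> norm (indicat_real ?S x *\<^sub>R g x $ j * B)"
          using B' by (auto simp: indicator_def abs_mult intro!: mult_left_mono)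
      qed
    qed
    show "(\<integral>x. h j x * \<psi> x \<partial>lebesgue) = 0"
      unfolding hg using i1 i2 grad[OF \<psi> z, of j] leb[OF c] by (simp add: set_lebesgue_integral_def)
  qed
  have hb_int: "integrable lebesgue (\<lambda>x. h j x * b i j x)" for i j
  proof -
    obtain B where B: "\<And>x. x \<in> K \<Longrightarrow> \<bar>b i j x\<bar> \<le> B"
      using compact_imp_bounded[OF compact_continuous_image[OF continuous_on_subset[OF b subset_UNIV] K(1)], of i j]
      unfolding bounded_iff by fastforce
    have B': "\<bar>b i j x\<bar> \<le> \<bar>B\<bar>" for x using B[of x] bz[of x i j] by (cases "x \<in> K") auto
    have "integrable lebesgue (\<lambda>x. h j x * B)" using h_int by simp
    then show ?thesis
      by (rule Bochner_Integration.integrable_bound)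
         (use h_int[of j] meas[OF b] B' in \<open>auto simp: abs_mult intro!: mult_left_mono\<close>)
  qed
  have cab: "continuous_on UNIV (\<lambda>Y. a i j Y * Dv Y $ j * partial_d i \<phi> Y)" for i j
    by (intro ci continuous_on_mult a cDv)
  have cabz: "a i j Y * Dv Y $ j * partial_d i \<phi> Y = 0" if "Y \<notin> K" for i j Y
    using partial_d_support[OF K(1,3) that] by simp
  have csum: "continuous_on UNIV (\<lambda>Y. \<Sum>i\<in>UNIV. \<Sum>j\<in>UNIV. a i j Y * Dv Y $ j * partial_d i \<phi> Y)"
    by (intro continuous_on_sum cab)
  have isum: "integrable lebesgue (\<lambda>Y. \<Sum>i\<in>UNIV. \<Sum>j\<in>UNIV. a i j Y * Dv Y $ j * partial_d i \<phi> Y)"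
  proof -
    have "integrable lborel (\<lambda>Y. \<Sum>i\<in>UNIV. \<Sum>j\<in>UNIV. a i j Y * Dv Y $ j * partial_d i \<phi> Y)"
      by (intro Bochner_Integration.integrable_sum integrable_compact_support[OF cab K(1)] cabz)
    then show ?thesis
      by (intro integrable_completion[THEN iffD2] borel_measurable_integrable)
  qed
  have test: "test_fun ?S \<phi>"
    unfolding test_fun_def using flat_algebra_C_infinity[OF \<phi>] K by blast
  have "0 = (LINT x:?S|lebesgue. (\<Sum>i\<in>UNIV. \<Sum>j\<in>UNIV. a i j x * g x $ j * partial_d i \<phi> x))"
    using weak test by (simp add: weak_div_solution_def)
  also have "\<dots> = (\<integral>x. (\<Sum>i\<in>UNIV. \<Sum>j\<in>UNIV. h j x * b i j x)
      + (\<Sum>i\<in>UNIV. \<Sum>j\<in>UNIV. a i j x * Dv x $ j * partial_d i \<phi> x) \<partial>lebesgue)"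
    unfolding set_lebesgue_integral_def
  proof (intro Bochner_Integration.integral_cong refl)
    fix x
    show "indicat_real ?S x *\<^sub>R (\<Sum>i\<in>UNIV. \<Sum>j\<in>UNIV. a i j x * g x $ j * partial_d i \<phi> x) =
      (\<Sum>i\<in>UNIV. \<Sum>j\<in>UNIV. h j x * b i j x) + (\<Sum>i\<in>UNIV. \<Sum>j\<in>UNIV. a i j x * Dv x $ j * partial_d i \<phi> x)"
    proof (cases "x \<in> K")
      case True
      then have "x \<in> ?S" "x \<in> cball 0 R" using K(2) R(3) by auto
      then show ?thesis
        by (simp add: h_def b_def sum.distrib[symmetric] algebra_simps)
    next
      case False
      then show ?thesis using partial_d_support[OF K(1,3) False] by (simp add: bz)
    qed
  qed
  also have "\<dots> = (\<Sum>i\<in>UNIV. \<Sum>j\<in>UNIV. (\<integral>x. h j x * b i j x \<partial>lebesgue))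
      + (\<integral>x. (\<Sum>i\<in>UNIV. \<Sum>j\<in>UNIV. a i j x * Dv x $ j * partial_d i \<phi> x) \<partial>lebesgue)"
    by (subst Bochner_Integration.integral_add[OF _ isum])
       (auto simp: hb_int intro!: Bochner_Integration.integrable_sum hb_int)
  also have "\<dots> = (\<integral>x. (\<Sum>i\<in>UNIV. \<Sum>j\<in>UNIV. a i j x * Dv x $ j * partial_d i \<phi> x) \<partial>lborel)"
    by (simp add: hb0 leb[OF csum])
  finally show ?thesis by simp
qed

text \<open>Mean value inequality on the ball whose radius is the distance from \<open>X\<close> to
  \<open>Z\<close>: the derivative bound is largest at that radius, and the increment contributes
  one further power.\<close>

lemma power_bound_of_derivative_bound:
  fixes f :: "'a::real_normed_vector \<Rightarrow> 'b::real_normed_vector"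
  assumes f: "\<And>Y. Y \<in> cball Z r \<Longrightarrow> (f has_derivative f' Y) (at Y)"
    and bd: "\<And>Y h. Y \<in> cball Z r \<Longrightarrow> norm (f' Y h) \<le> K * dist Y Z powr \<gamma> * norm h"
    and "0 \<le> \<gamma>" "0 \<le> K" and X: "X \<in> cball Z r"
  shows "norm (f X - f Z) \<le> K * dist X Z powr (1 + \<gamma>)"
proof -
  define d where "d = dist X Z"
  have sub: "cball Z d \<subseteq> cball Z r" using X by (auto simp: d_def dist_commute)
  have "norm (f X - f Z) \<le> K * d powr \<gamma> * norm (X - Z)"
  proof (rule differentiable_bound[OF convex_cball])
    show "(f has_derivative f' Y) (at Y within cball Z d)" if "Y \<in> cball Z d" for Y
      using f that sub by (blast intro: has_derivative_at_withinI)
    show "onorm (f' Y) \<le> K * d powr \<gamma>" if Y: "Y \<in> cball Z d" for Y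
    proof (rule onorm_bound)
      show "0 \<le> K * d powr \<gamma>" using assms by simp
      have "K * dist Y Z powr \<gamma> \<le> K * d powr \<gamma>"
        using Y assms by (intro mult_left_mono powr_mono2) (auto simp: dist_commute)
      then show "norm (f' Y h) \<le> K * d powr \<gamma> * norm h" for h
        using Y sub by (intro order_trans[OF bd mult_right_mono]) auto
    qed
  qed (auto simp: d_def dist_commute)
  then show ?thesis by (simp add: d_def dist_norm powr_add mult_ac)
qed

theorem theorem1:
  fixes a :: "'n::finite \<Rightarrow> 'n \<Rightarrow> real^'n \<Rightarrow> real"
    and lam Lam \<theta> :: real
  assumes "CARD('n) \<ge> 2"
    and "0 < lam" and "lam \<le> Lam" and "0 < \<theta>" and "\<theta> < 1"
    and holder: "\<And>i j. holder_on \<theta> (ball 0 1) (a i j)"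
    and sym: "\<And>i j X. X \<in> ball 0 1 \<Longrightarrow> a i j X = a j i X"
    and ellip: "\<And>X \<xi>. X \<in> ball 0 1 \<Longrightarrow>
        lam * (norm \<xi>)\<^sup>2 \<le> (\<Sum>i\<in>UNIV. \<Sum>j\<in>UNIV. a i j X * \<xi> $ i * \<xi> $ j) \<and>
        (\<Sum>i\<in>UNIV. \<Sum>j\<in>UNIV. a i j X * \<xi> $ i * \<xi> $ j) \<le> Lam * (norm \<xi>)\<^sup>2"
  shows
    "(\<forall>(u :: real^'n \<Rightarrow> real) (Du :: real^'n \<Rightarrow> real^'n) (D2u :: real^'n \<Rightarrow> real^'n^'n) Z.
        (\<forall>X\<in>ball 0 1. (u has_derivative (\<lambda>h. Du X \<bullet> h)) (at X)) \<and>
        (\<forall>X\<in>ball 0 1. (Du has_derivative (\<lambda>h. D2u X *v h)) (at X)) \<and>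
        continuous_on (ball 0 1) D2u \<and>
        (\<forall>X\<in>ball 0 1. (\<Sum>i\<in>UNIV. \<Sum>j\<in>UNIV. a i j X * D2u X $ i $ j) = 0) \<and>
        Z \<in> ball 0 1 \<and> D2u Z = 0
      \<longrightarrow> (\<forall>\<alpha>. 0 < \<alpha> \<and> \<alpha> < 1 \<longrightarrow>
            (\<exists>r0 C. 0 < r0 \<and> 0 < C \<and> ball Z r0 \<subseteq> ball 0 1 \<and>
               (\<forall>X\<in>ball Z r0. \<bar>u X - u Z - Du Z \<bullet> (X - Z)\<bar> \<le> C * norm (X - Z) powr (2 + \<alpha>)))))
   \<and>
    (\<forall>(u :: real^'n \<Rightarrow> real) (g :: real^'n \<Rightarrow> real^'n) (v :: real^'n \<Rightarrow> real) (Dv :: real^'n \<Rightarrow> real^'n) Z.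
        H1_weak_grad (ball 0 1) u g \<and> weak_div_solution a (ball 0 1) g \<and>
        (AE x in lebesgue. x \<in> ball 0 1 \<longrightarrow> v x = u x) \<and>
        (\<forall>X\<in>ball 0 1. (v has_derivative (\<lambda>h. Dv X \<bullet> h)) (at X)) \<and>
        continuous_on (ball 0 1) Dv \<and>
        Z \<in> ball 0 1 \<and> Dv Z = 0
      \<longrightarrow> (\<forall>\<alpha>. 0 < \<alpha> \<and> \<alpha> < 1 \<longrightarrow>
            (\<exists>r0 C. 0 < r0 \<and> 0 < C \<and> ball Z r0 \<subseteq> ball 0 1 \<and>
               (\<forall>X\<in>ball Z r0. \<bar>v X - v Z\<bar> \<le> C * norm (X - Z) powr (1 + \<alpha>)) \<and>
               (\<forall>r. 0 < r \<and> r < r0 \<longrightarrow>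
                  (1 / measure lebesgue (ball Z r)) * (LINT X:ball Z r|lebesgue. (v X - v Z)\<^sup>2)
                    \<le> C\<^sup>2 * r powr (2 * (1 + \<alpha>))))))"
proof (intro conjI allI impI, goal_cases)
  case (1 u Du D2u Z \<alpha>)
  then have u: "\<And>X. X \<in> ball 0 1 \<Longrightarrow> (u has_derivative (\<lambda>h. Du X \<bullet> h)) (at X)"
    and Du: "\<And>X. X \<in> ball 0 1 \<Longrightarrow> (Du has_derivative (\<lambda>h. D2u X *v h)) (at X)"
    and cont: "continuous_on (ball 0 1) D2u"
    and eq: "\<And>X. X \<in> ball 0 1 \<Longrightarrow> (\<Sum>i\<in>UNIV. \<Sum>j\<in>UNIV. a i j X * D2u X $ i $ j) = 0"
    and Z: "Z \<in> ball 0 1" "D2u Z = 0" and \<alpha>: "0 < \<alpha>" "\<alpha> < 1" by blast+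
  \<comment> \<open>Pairs as indices turn all entries of the Hessian into one family.\<close>
  define W where "W k Y = D2u Y $ fst k $ snd k" for k and Y :: "real^'n"
  have "\<exists>r0 K. 0 < r0 \<and> 0 < K \<and> cball Z r0 \<subseteq> ball 0 1 \<and> (\<forall>k. \<forall>X\<in>cball Z r0. \<bar>W k X\<bar> \<le> K * dist X Z powr \<alpha>)"
  proof (rule power_decay_of_frozen_identity[where p="\<lambda>i j. (i, j)" and q="\<lambda>i k. fst k" and r=snd,
        OF open_ball assms(2) assms(4) holder sym conjunct1[OF ellip] _ _ Z(1) _ _ \<alpha>])
    show "continuous_on (ball 0 1) (W k)" for k unfolding W_def by (intro continuous_intros cont)
    show "W k Z = 0" for k by (simp add: W_def Z(2))
    show "(\<integral>Y. W k Y * (\<Sum>i\<in>UNIV. \<Sum>j\<in>UNIV. a i j X * partial_d i (partial_d j \<phi>) Y) \<partial>lborel) =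
      (\<integral>Y. (\<Sum>i\<in>UNIV. \<Sum>j\<in>UNIV. (a i j X - a i j Y) * W (i, j) Y * partial_d (fst k) (partial_d (snd k) \<phi>) Y) \<partial>lborel)"
      if "0 < s" "cball X s \<subseteq> ball 0 1" "\<phi> \<in> flat_algebra" "\<And>Y. Y \<notin> cball X s \<Longrightarrow> \<phi> Y = 0" for X s k \<phi>
      using nondivergence_frozen_identity[OF open_ball u Du cont eq that(3) compact_cball that(2,4), of "fst k" "snd k" X]
      by (simp add: W_def)
  qed simp_all
  then obtain r0 K where r0: "0 < r0" "cball Z r0 \<subseteq> ball 0 1" and K: "0 < K"
    and W: "\<And>k X. X \<in> cball Z r0 \<Longrightarrow> \<bar>W k X\<bar> \<le> K * dist X Z powr \<alpha>" by blast
  define K' where "K' = (real CARD('n))\<^sup>2 * K"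
  have K': "0 < K'" using K by (simp add: K'_def)
  have D2: "norm (D2u Y *v h) \<le> K' * dist Y Z powr \<alpha> * norm h" if "Y \<in> cball Z r0" for Y h
    using matrix_norm_le_entries[of "D2u Y" "K * dist Y Z powr \<alpha>" h] W[OF that, of "(_, _)"]
    by (simp add: W_def K'_def mult_ac)
  \<comment> \<open>The first of two gains of a full power, from the Hessian to the
    gradient.\<close>
  have D1: "norm (Du Y - Du Z) \<le> K' * dist Y Z powr (1 + \<alpha>)" if "Y \<in> cball Z r0" for Y
    using r0 K' \<alpha> by (intro power_bound_of_derivative_bound[where f'="\<lambda>Y h. D2u Y *v h", OF Du D2 _ _ that]) auto
  \<comment> \<open>Subtracting the linear part makes the gradient \<open>Du Y - Du Z\<close>, to
    which \<open>D1\<close> applies, so a second gain leads to the exponent 2 + \<alpha>.\<close>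
  define f where "f Y = u Y - Du Z \<bullet> Y" for Y
  have f: "\<bar>f Y - f Z\<bar> \<le> K' * dist Y Z powr (1 + (1 + \<alpha>))" if Y: "Y \<in> cball Z r0" for Y
    unfolding real_norm_def[symmetric]
  proof (rule power_bound_of_derivative_bound[where f'="\<lambda>Y h. (Du Y - Du Z) \<bullet> h", OF _ _ _ _ Y])
    fix X assume X: "X \<in> cball Z r0"
    then have "X \<in> ball 0 1" using r0 by blast
    then show "(f has_derivative (\<lambda>h. (Du X - Du Z) \<bullet> h)) (at X)"
      unfolding f_def[abs_def] inner_diff_left
      by (intro has_derivative_diff u has_derivative_inner_right has_derivative_ident)
    show "norm ((Du X - Du Z) \<bullet> h) \<le> K' * dist X Z powr (1 + \<alpha>) * norm h" for h
      using Cauchy_Schwarz_ineq2[of "Du X - Du Z" h] mult_right_mono[OF D1[OF X] norm_ge_zero[of h]] by simp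
  qed (use K' \<alpha> in auto)
  show ?case
  proof (rule exI[of _ r0], rule exI[of _ K'], intro conjI ballI r0 K')
    show "ball Z r0 \<subseteq> ball 0 1" using r0 ball_subset_cball by blast
    fix X assume "X \<in> ball Z r0"
    then have "\<bar>f X - f Z\<bar> \<le> K' * dist X Z powr (1 + (1 + \<alpha>))" by (intro f) simp
    then show "\<bar>u X - u Z - Du Z \<bullet> (X - Z)\<bar> \<le> K' * norm (X - Z) powr (2 + \<alpha>)"
      by (simp add: f_def inner_diff_right dist_norm algebra_simps)
  qed
next
  case (2 u g v Dv Z \<alpha>)
  then have H1: "H1_weak_grad (ball 0 1) u g" and weak: "weak_div_solution a (ball 0 1) g"
    and ae: "AE x in lebesgue. x \<in> ball 0 1 \<longrightarrow> v x = u x"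
    and v: "\<And>X. X \<in> ball 0 1 \<Longrightarrow> (v has_derivative (\<lambda>h. Dv X \<bullet> h)) (at X)"
    and cont: "continuous_on (ball 0 1) Dv"
    and Z: "Z \<in> ball 0 1" "Dv Z = 0" and \<alpha>: "0 < \<alpha>" "\<alpha> < 1" by blast+
  have a: "continuous_on (ball 0 1) (a i j)" for i j by (rule holder_on_continuous[OF holder assms(4)])
  have "\<exists>r0 K. 0 < r0 \<and> 0 < K \<and> cball Z r0 \<subseteq> ball 0 1 \<and> (\<forall>k. \<forall>X\<in>cball Z r0. \<bar>Dv X $ k\<bar> \<le> K * dist X Z powr \<alpha>)"
  proof (rule power_decay_of_frozen_identity[where p="\<lambda>i j. j" and q="\<lambda>i k. i" and r="\<lambda>k. k"
        and W="\<lambda>k X. Dv X $ k",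
        OF open_ball assms(2) assms(4) holder sym conjunct1[OF ellip] _ _ Z(1) _ _ \<alpha>])
    show "continuous_on (ball 0 1) (\<lambda>X. Dv X $ k)" for k by (intro continuous_intros cont)
    show "(\<integral>Y. Dv Y $ k * (\<Sum>i\<in>UNIV. \<Sum>j\<in>UNIV. a i j X * partial_d i (partial_d j \<phi>) Y) \<partial>lborel) =
      (\<integral>Y. (\<Sum>i\<in>UNIV. \<Sum>j\<in>UNIV. (a i j X - a i j Y) * Dv Y $ j * partial_d i (partial_d k \<phi>) Y) \<partial>lborel)"
      if "0 < s" "cball X s \<subseteq> ball 0 1" "\<phi> \<in> flat_algebra" "\<And>Y. Y \<notin> cball X s \<Longrightarrow> \<phi> Y = 0" for X s k \<phi>
      by (rule divergence_frozen_identity[OF open_ball v cont a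
            weak_equation_classical_gradient[OF H1 weak ae v cont a _ compact_cball that(2)]
            that(3) compact_cball that(2,4)])
  qed (simp_all add: Z(2))
  then obtain r0 K where r0: "0 < r0" "cball Z r0 \<subseteq> ball 0 1" and K: "0 < K"
    and W: "\<And>k X. X \<in> cball Z r0 \<Longrightarrow> \<bar>Dv X $ k\<bar> \<le> K * dist X Z powr \<alpha>" by blast
  define K' where "K' = real CARD('n) * K"
  have K': "0 < K'" using K by (simp add: K'_def)
  have D: "norm (Dv Y \<bullet> h) \<le> K' * dist Y Z powr \<alpha> * norm h" if "Y \<in> cball Z r0" for Y h
  proof -
    have "norm (Dv Y) \<le> (\<Sum>k\<in>(UNIV::'n set). K * dist Y Z powr \<alpha>)"
      by (intro order_trans[OF norm_le_l1_cart] sum_mono W that)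
    then have "norm (Dv Y) \<le> K' * dist Y Z powr \<alpha>" by (simp add: K'_def mult.assoc)
    then show ?thesis
      using Cauchy_Schwarz_ineq2[of "Dv Y" h] mult_right_mono[OF _ norm_ge_zero[of h]] by fastforce
  qed
  have bound: "\<bar>v X - v Z\<bar> \<le> K' * norm (X - Z) powr (1 + \<alpha>)" if "X \<in> ball Z r0" for X
  proof -
    have "norm (v X - v Z) \<le> K' * dist X Z powr (1 + \<alpha>)"
      using that r0 K' \<alpha>
      by (intro power_bound_of_derivative_bound[where f'="\<lambda>Y h. Dv Y \<bullet> h" and r=r0, OF v D]) auto
    then show ?thesis by (simp add: dist_norm)
  qed
  show ?case
  proof (rule exI[of _ r0], rule exI[of _ K'], intro conjI ballI allI impI r0 K' bound)
    show "ball Z r0 \<subseteq> ball 0 1" using r0 ball_subset_cball by blast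
    fix r assume r: "0 < r \<and> r < r0"
    let ?B = "K'\<^sup>2 * r powr (2 * (1 + \<alpha>))"
    have m: "0 < measure lebesgue (ball Z r)" using content_ball_pos[of r Z] r by simp
    have "(LINT X:ball Z r|lebesgue. (v X - v Z)\<^sup>2) \<le> ?B * measure lebesgue (ball Z r)"
    \<comment> \<open>If the square were not integrable, its integral would be 0 by convention and
      the bound trivial; the case distinction replaces a proof of integrability.\<close>
    proof (cases "set_integrable lebesgue (ball Z r) (\<lambda>X. (v X - v Z)\<^sup>2)")
      case True
      have "(LINT X:ball Z r|lebesgue. (v X - v Z)\<^sup>2) \<le> (LINT X:ball Z r|lebesgue. ?B)"
      proof (rule set_integral_mono[OF True])
        show "set_integrable lebesgue (ball Z r) (\<lambda>X. ?B)"
          using emeasure_lborel_ball_finite[of Z r] by (simp add: set_integrable_def)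
        fix X assume X: "X \<in> ball Z r"
        have "\<bar>v X - v Z\<bar> \<le> K' * norm (X - Z) powr (1 + \<alpha>)" using X r by (intro bound) auto
        also have "\<dots> \<le> K' * r powr (1 + \<alpha>)"
          using X K' \<alpha> by (intro mult_left_mono powr_mono2) (auto simp: dist_norm norm_minus_commute)
        finally have "\<bar>v X - v Z\<bar>\<^sup>2 \<le> (K' * r powr (1 + \<alpha>))\<^sup>2" by (rule power_mono) simp
        also have "\<dots> = ?B"
          using r by (simp add: power_mult_distrib powr_powr flip: powr_realpow) (simp add: mult.commute)
        finally show "(v X - v Z)\<^sup>2 \<le> ?B" by simp
      qed
      also have "\<dots> = ?B * measure lebesgue (ball Z r)"
        using emeasure_lborel_ball_finite[of Z r] by (simp add: set_lebesgue_integral_def)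
      finally show ?thesis .
    next
      case False
      then have "(LINT X:ball Z r|lebesgue. (v X - v Z)\<^sup>2) = 0"
        unfolding set_integrable_def set_lebesgue_integral_def by (rule not_integrable_integral_eq)
      then show ?thesis using m by simp
    qed
    then show "1 / measure lebesgue (ball Z r) * (LINT X:ball Z r|lebesgue. (v X - v Z)\<^sup>2) \<le> ?B"
      using m by (simp add: divide_le_eq)
  qed
qed

end
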